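(* The $n$-dimensional Bohr radius $\mathcal{R}_P(\mathbb{B}_{\ell_p^n})$ satisfies the following. (1) If $n=1$ and $p\in[1,\infty]$, then $\mathcal{R}_P(\mathbb{B}_{\ell_p^n})=\frac13$; in particular the constant $1/3$ is sharp. (2) There is an absolute constant $C\geq 1$ such that for all $n\geq 2$ and $p\in[1,\infty)$, $$\frac1C\left(\frac{\log n}{n}\right)^{1-\frac{1}{\min\{p,2\}}}\leq\mathcal{R}_P(\mathbb{B}_{\ell_p^n})\leq C\left(\frac{\log n}{n}\right)^{1-\frac{1}{\min\{p,2\}}}.$$ (3) If $p=\infty$, then $$\lim_{n\to\infty}\frac{\mathcal{R}_P(\mathbb{B}_{\ell_\infty^n})}{\sqrt{\frac{\log n}{n}}}=1.$$
   Context: For $p\in[1,\infty)$, $\|z\|_p=(\sum_j|z_j|^p)^{1/p}$, and $\|z\|_\infty=\max_j|z_j|$; $\mathbb{B}_{\ell_p^n}=\{z\in\mathbb{C}^n:\|z\|_p<1\}$ and $\rho\mathbb{B}_{\ell_p^n}=\{z\in\mathbb{C}^n:\|z\|_p<\rho\}$. Multi-indices $\alpha$ are $n$-tuples of nonnegative integers, $z^\alpha=\prod_kz_k^{\alpha_k}$. A twice continuously differentiable complex-valued function $f$ on a domain $\Omega\subset\mathbb{C}^n$ is pluriharmonic if for each fixed $z\in\Omega$ and $\theta\in\mathbb{C}^n$ with $\|\theta\|_2=1$, $\zeta\mapsto f(z+\zeta\theta)$ is harmonic in $\{|\zeta|<d_\Omega(z)\}$, where $d_\Omega(z)$ is the Euclidean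 distance from $z$ to $\partial\Omega$. $\mathscr{PH}(\mathbb{B}_{\ell_p^n})$ is the set of all pluriharmonic functions from $\mathbb{B}_{\ell_p^n}$ into $\mathbb{C}$; each such $f$ equals $h+\overline g$ with $h=\sum_\alpha a_\alpha z^\alpha$, $g=\sum_\alpha b_\alpha z^\alpha$ holomorphic, written $f(z)=\sum_\alpha a_\alpha z^\alpha+\sum_\alpha\overline b_\alpha\overline z^\alpha$. Put $$\mathscr{PH}_+(\mathbb{B}_{\ell_p^n})=\Big\{f\in\mathscr{PH}(\mathbb{B}_{\ell_p^n}):\ \sup_{z\in\mathbb{B}_{\ell_p^n}}\mathrm{Re}(f(z))\leq1\ \text{and}\ f(0)\geq0\Big\},$$ where $f(0)\ge 0$ means that $f(0)$ is a nonnegative real number. $\mathcal{R}_P(\mathbb{B}_{\ell_p^n})$ is the largest number $\rho$ such that whenever $f(z)=\sum_\alpha a_\alpha z^\alpha+\sum_\alpha\overline{b}_\alpha\overline{z}^\alpha\in\mathscr{PH}_+(\mathbb{B}_{\ell_p^n})$ with $b_0=0$, then $\sum_\alpha|(a_\alpha+b_\alpha)z^\alpha|\leq1$ for all $z\in\rho\mathbb{B}_{\ell_p^n}$ (the sum is over all multi-indices, including $\alpha=0$). *)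

theory Defs
  imports "HOL-Analysis.Analysis"
begin

text \<open>
  The dimension varies inside the statement, so vectors in \<open>n\<close>-dimensional complex space and
  \<open>n\<close>-tuples of naturals are functions on \<open>nat\<close> (coordinates \<open>0, \<dots>, n - 1\<close>) vanishing from \<open>n\<close> on.
  The topology on \<open>nat \<Rightarrow> complex\<close> is the product topology, which induces the usual topology
  on \<open>Cn n\<close>; the subset \<open>Cn n\<close> is not open in it, so topological notions below are relative to \<open>Cn n\<close>.
\<close>

definition Cn :: "nat \<Rightarrow> (nat \<Rightarrow> complex) set"
  where "Cn n = {z. \<forall>k\<ge>n. z k = 0}"

definition multi_indices :: "nat \<Rightarrow> (nat \<Rightarrow> nat) set"
  where "multi_indices n = {\<alpha>. \<forall>k\<ge>n. \<alpha> k = 0}"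

definition monomial :: "nat \<Rightarrow> (nat \<Rightarrow> nat) \<Rightarrow> (nat \<Rightarrow> complex) \<Rightarrow> complex"
  where "monomial n \<alpha> z = (\<Prod>k<n. z k ^ \<alpha> k)"

definition lp_norm :: "nat \<Rightarrow> ereal \<Rightarrow> (nat \<Rightarrow> complex) \<Rightarrow> real"
  where "lp_norm n p z =
    (if p = \<infinity> then (MAX k\<in>{..<n}. cmod (z k))
     else (\<Sum>k<n. cmod (z k) powr real_of_ereal p) powr (1 / real_of_ereal p))"

definition lp_ball :: "nat \<Rightarrow> ereal \<Rightarrow> real \<Rightarrow> (nat \<Rightarrow> complex) set"
  where "lp_ball n p \<rho> = {z \<in> Cn n. lp_norm n p z < \<rho>}"

text \<open>
  A real coordinate direction is given by its translation map \<open>s\<close>: the point \<open>s x t\<close> is \<open>x\<close> moved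
  by \<open>t\<close> in that direction. This covers the plane and \<open>Cn n\<close>, whose ambient function
  type is not an instance of \<open>real_vector\<close>, at the same time.
\<close>

definition partial_deriv :: "('a \<Rightarrow> real \<Rightarrow> 'a) \<Rightarrow> ('a \<Rightarrow> complex) \<Rightarrow> 'a \<Rightarrow> complex"
  where "partial_deriv s f x = vector_derivative (\<lambda>t. f (s x t)) (at 0)"

definition C1_on :: "('a::topological_space \<Rightarrow> real \<Rightarrow> 'a) set \<Rightarrow> 'a set \<Rightarrow> ('a \<Rightarrow> complex) \<Rightarrow> bool"
  where "C1_on S \<Omega> f \<longleftrightarrow> continuous_on \<Omega> f \<and>
    (\<forall>s\<in>S. (\<forall>x\<in>\<Omega>. (\<lambda>t. f (s x t)) differentiable at 0) \<and> continuous_on \<Omega> (partial_deriv s f))"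

definition C2_on :: "('a::topological_space \<Rightarrow> real \<Rightarrow> 'a) set \<Rightarrow> 'a set \<Rightarrow> ('a \<Rightarrow> complex) \<Rightarrow> bool"
  where "C2_on S \<Omega> f \<longleftrightarrow> C1_on S \<Omega> f \<and> (\<forall>s\<in>S. C1_on S \<Omega> (partial_deriv s f))"

definition shift_re :: "complex \<Rightarrow> real \<Rightarrow> complex"
  where "shift_re w t = w + of_real t"

definition shift_im :: "complex \<Rightarrow> real \<Rightarrow> complex"
  where "shift_im w t = w + \<i> * of_real t"

definition coord_shifts :: "nat \<Rightarrow> ((nat \<Rightarrow> complex) \<Rightarrow> real \<Rightarrow> (nat \<Rightarrow> complex)) set"
  where "coord_shifts n =
    (\<Union>k<n. {\<lambda>z t. z(k := shift_re (z k) t), \<lambda>z t. z(k := shift_im (z k) t)})"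

definition harmonic_on :: "complex set \<Rightarrow> (complex \<Rightarrow> complex) \<Rightarrow> bool"
  where "harmonic_on U u \<longleftrightarrow> C2_on {shift_re, shift_im} U u \<and>
    (\<forall>w\<in>U. partial_deriv shift_re (partial_deriv shift_re u) w +
           partial_deriv shift_im (partial_deriv shift_im u) w = 0)"

text \<open>The value is \<open>\<infinity>\<close> when the boundary is empty, that is for \<open>\<Omega> = Cn n\<close>.\<close>

definition boundary_dist :: "nat \<Rightarrow> (nat \<Rightarrow> complex) set \<Rightarrow> (nat \<Rightarrow> complex) \<Rightarrow> ereal"
  where "boundary_dist n \<Omega> z =
    (INF w \<in> top_of_set (Cn n) frontier_of \<Omega>. ereal (lp_norm n 2 (\<lambda>k. z k - w k)))"

text \<open>Meant for domains \<open>\<Omega>\<close>, i.e. connected subsets of \<open>Cn n\<close> that are open in \<open>Cn n\<close>.\<close>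

definition pluriharmonic_on :: "nat \<Rightarrow> (nat \<Rightarrow> complex) set \<Rightarrow> ((nat \<Rightarrow> complex) \<Rightarrow> complex) \<Rightarrow> bool"
  where "pluriharmonic_on n \<Omega> f \<longleftrightarrow> C2_on (coord_shifts n) \<Omega> f \<and>
    (\<forall>z\<in>\<Omega>. \<forall>\<theta>\<in>Cn n. lp_norm n 2 \<theta> = 1 \<longrightarrow>
       harmonic_on {\<zeta>. ereal (cmod \<zeta>) < boundary_dist n \<Omega> z} (\<lambda>\<zeta>. f (\<lambda>k. z k + \<zeta> * \<theta> k)))"

definition PH_plus :: "nat \<Rightarrow> ereal \<Rightarrow> ((nat \<Rightarrow> complex) \<Rightarrow> complex) set"
  where "PH_plus n p = {f. pluriharmonic_on n (lp_ball n p 1) f \<and>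
    (SUP z \<in> lp_ball n p 1. ereal (Re (f z))) \<le> 1 \<and> f (\<lambda>_. 0) \<in> \<real>\<^sub>\<ge>\<^sub>0}"

definition has_pluriharmonic_expansion ::
    "nat \<Rightarrow> ereal \<Rightarrow> ((nat \<Rightarrow> complex) \<Rightarrow> complex) \<Rightarrow>
     ((nat \<Rightarrow> nat) \<Rightarrow> complex) \<Rightarrow> ((nat \<Rightarrow> nat) \<Rightarrow> complex) \<Rightarrow> bool"
  where "has_pluriharmonic_expansion n p f a b \<longleftrightarrow>
    (\<forall>z \<in> lp_ball n p 1.
       (\<lambda>\<alpha>. a \<alpha> * monomial n \<alpha> z) summable_on multi_indices n \<and>
       (\<lambda>\<alpha>. cnj (b \<alpha>) * monomial n \<alpha> (\<lambda>k. cnj (z k))) summable_on multi_indices n \<and>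
       f z = (\<Sum>\<^sub>\<infinity>\<alpha>\<in>multi_indices n. a \<alpha> * monomial n \<alpha> z) +
             (\<Sum>\<^sub>\<infinity>\<alpha>\<in>multi_indices n. cnj (b \<alpha>) * monomial n \<alpha> (\<lambda>k. cnj (z k))))"

text \<open>
  Summability is required explicitly because \<open>infsum\<close> is \<open>0\<close> for a family that is not summable.
\<close>

definition bohr_property :: "nat \<Rightarrow> ereal \<Rightarrow> real \<Rightarrow> bool"
  where "bohr_property n p \<rho> \<longleftrightarrow>
    (\<forall>f a b. f \<in> PH_plus n p \<and> has_pluriharmonic_expansion n p f a b \<and> b (\<lambda>_. 0) = 0 \<longrightarrow>
       (\<forall>z \<in> lp_ball n p \<rho>.
          (\<lambda>\<alpha>. cmod ((a \<alpha> + b \<alpha>) * monomial n \<alpha> z)) summable_on multi_indices n \<and>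
          (\<Sum>\<^sub>\<infinity>\<alpha>\<in>multi_indices n. cmod ((a \<alpha> + b \<alpha>) * monomial n \<alpha> z)) \<le> 1))"

definition bohr_radius :: "nat \<Rightarrow> ereal \<Rightarrow> real"
  where "bohr_radius n p = (GREATEST \<rho>. bohr_property n p \<rho>)"

end

theory Submission
  imports Defs "HOL-Real_Asymp.Real_Asymp"
begin

text \<open>
  \<^bold>\<open>Reduction to homogeneous polynomials.\<close> If \<open>f = h + cnj g\<close> is pluriharmonic with coefficients
  \<open>a\<close>, \<open>b\<close>, then \<open>Re f = Re F\<close> for the holomorphic \<open>F = h + g\<close>, whose coefficients are \<open>c = a + b\<close>;
  so the Bohr radius is that of holomorphic functions with \<open>Re F \<le> 1\<close> and \<open>F 0 \<ge> 0\<close>. By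
  Caratheodory's inequality on complex lines, the homogeneous part of degree \<open>m \<ge> 1\<close> of \<open>F\<close> is bounded
  by \<open>2 * (1 - c 0)\<close> on the ball. Hence \<open>\<rho>\<close> has the Bohr property as soon as
  \<open>\<Sum>m\<ge>1. \<kappa> m * \<rho> ^ m \<le> 1/2\<close>, where \<open>\<kappa> m\<close> bounds the sum of the absolute values of the monomial
  terms of an \<open>m\<close>-homogeneous polynomial of sup norm 1 (\<open>bohr_property_from_homogeneous\<close>). Conversely, a
  homogeneous polynomial of degree at least 1 and sup norm 1 is itself an admissible \<open>F\<close> (\<open>bohr_property_polynomial\<close>). For \<open>n = 1\<close> one has
  \<open>\<kappa> m = 1\<close>, which gives \<open>1/3\<close>; Taylor polynomials of \<open>-2z/(1-z)\<close> at a slightly contracted argument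
  show that this is sharp.

  \<^bold>\<open>Lower bounds.\<close> For \<open>p \<le> 2\<close>, the directional derivatives of \<open>P\<close> are bounded by \<open>e * m\<close> times the
  norm of \<open>P\<close>; bounding their coefficients by Cauchy's estimate at the point where a monomial is largest,
  and summing with Hoelder's inequality, gives \<open>lp_monomial_sum\<close> with
  \<open>\<kappa> m = e\<^sup>m * m * N powr (1 - 1/p)\<close>, \<open>N\<close> the number of monomials of degree \<open>m - 1\<close>. For \<open>p \<ge> 2\<close> it
  suffices to treat the polydisc. There \<open>\<kappa> m\<close> is bounded by splitting off \<open>k\<close> of the \<open>m\<close> factors of each monomial
  (\<open>polydisc_coefficient_sum\<close>): the \<open>m - k\<close> remaining factors are handled by Cauchy--Schwarz and the
  hypercontractive inequality between the \<open>L\<^sup>q\<close> and \<open>L\<^sup>2\<close> norms on the torus with \<open>q = 2k/(k+1)\<close>,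
  and the \<open>k\<close> factors by the Bohnenblust--Hille inequality with any constant depending on \<open>k\<close> only. The
  hypercontractive constant is \<open>2 powr (1/k)\<close> per degree, so it tends to 1 as \<open>k\<close> grows: this is what makes the
  constant in the asymptotics for \<open>p = \<infinity>\<close> equal to 1. The number \<open>N\<close> of monomials of degree \<open>d\<close> is controlled
  by its generating function, \<open>N * x ^ d \<le> (1 - x) powr (-n)\<close>; with \<open>x\<close> a multiple \<open>\<theta> * ln n / n\<close> the
  right-hand side is about \<open>n powr \<theta>\<close>, which explains the logarithm.

  \<^bold>\<open>Upper bounds.\<close> Random signs in front of the coefficients of \<open>(\<Sum>k. z k) ^ m\<close> produce a polynomial with
  the same absolute coefficient sums but with sup norm on the unit ball of \<open>\<l>\<^sub>q\<close>, \<open>1 \<le> q \<le> 2\<close>, at most a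
  constant times \<open>(m!) powr (1 - 1/q) * sqrt (n * ln (98 * n * m))\<close> (\<open>random_polynomial\<close>, after Kahane,
  Salem, Zygmund and Boas). Testing the Bohr property on it with
  \<open>m\<close> about \<open>ln n\<close> gives both the order of magnitude and, as \<open>(m!) powr (1/m)\<close> is about \<open>m/e\<close> and
  \<open>n powr (1/m)\<close> is about \<open>e\<close>, the constant 1 for \<open>p = \<infinity>\<close>.

  Integrals over the torus are replaced throughout by averages over roots of unity of large order, which are
  exact for polynomials.
\<close>

section \<open>Multi-indices of given degree\<close>

text \<open>
  Multi-indices vanish from \<open>n\<close> on, whereas \<open>Pi\<^sub>E\<close> fixes the value \<open>undefined\<close> there; this is the
  product set with the default value \<open>0\<close>.
\<close>

definition index_box :: "nat \<Rightarrow> (nat \<Rightarrow> nat set) \<Rightarrow> (nat \<Rightarrow> nat) set"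
  where "index_box n B = {\<alpha> \<in> multi_indices n. \<forall>k<n. \<alpha> k \<in> B k}"

definition MI :: "nat \<Rightarrow> nat \<Rightarrow> (nat \<Rightarrow> nat) set"
  where "MI n d = {\<alpha> \<in> multi_indices n. (\<Sum>k<n. \<alpha> k) = d}"

lemma index_box_0: "index_box 0 B = {\<lambda>_. 0}"
  by (auto simp: index_box_def multi_indices_def)

lemma sum_index_box_Suc:
  "(\<Sum>\<alpha>\<in>index_box (Suc n) B. F \<alpha>) = (\<Sum>\<alpha>\<in>index_box n B. \<Sum>b\<in>B n. F (\<alpha>(n := b)))"
proof -
  have "(\<Sum>\<alpha>\<in>index_box (Suc n) B. F \<alpha>) = (\<Sum>x\<in>index_box n B \<times> B n. F ((fst x)(n := snd x)))"
    by (rule sum.reindex_bij_witness[where j = "\<lambda>\<alpha>. (\<alpha>(n := 0), \<alpha> n)" and i = "\<lambda>x. (fst x)(n := snd x)"])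
       (auto simp: index_box_def multi_indices_def fun_eq_iff less_Suc_eq Suc_le_eq)
  also have "\<dots> = (\<Sum>\<alpha>\<in>index_box n B. \<Sum>b\<in>B n. F (\<alpha>(n := b)))"
    by (simp add: sum.cartesian_product case_prod_beta)
  finally show ?thesis .
qed

lemma prod_sum_index_box:
  fixes f :: "nat \<Rightarrow> nat \<Rightarrow> 'a::comm_semiring_1"
  shows "(\<Prod>k<n. \<Sum>b\<in>B k. f k b) = (\<Sum>\<alpha>\<in>index_box n B. \<Prod>k<n. f k (\<alpha> k))"
proof (induction n)
  case 0
  then show ?case by (simp add: index_box_0)
next
  case (Suc n)
  have "(\<Prod>k<Suc n. \<Sum>b\<in>B k. f k b) = (\<Sum>\<alpha>\<in>index_box n B. \<Prod>k<n. f k (\<alpha> k)) * (\<Sum>b\<in>B n. f n b)"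
    using Suc by simp
  also have "\<dots> = (\<Sum>\<alpha>\<in>index_box n B. \<Sum>b\<in>B n. (\<Prod>k<n. f k (\<alpha> k)) * f n b)"
    by (simp add: sum_product)
  also have "\<dots> = (\<Sum>\<alpha>\<in>index_box n B. \<Sum>b\<in>B n. (\<Prod>k<Suc n. f k ((\<alpha>(n := b)) k)))"
    by simp
  finally show ?case by (simp only: sum_index_box_Suc)
qed

lemma finite_index_box:
  assumes "\<And>k. k < n \<Longrightarrow> finite (B k)"
  shows "finite (index_box n B)"
  using assms
proof (induction n)
  case (Suc n)
  have "index_box (Suc n) B \<subseteq> (\<lambda>x. (fst x)(n := snd x)) ` (index_box n B \<times> B n)"
  proof
    fix \<alpha> assume "\<alpha> \<in> index_box (Suc n) B"
    then have "(\<alpha>(n := 0), \<alpha> n) \<in> index_box n B \<times> B n"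
      by (auto simp: index_box_def multi_indices_def Suc_le_eq)
    then show "\<alpha> \<in> (\<lambda>x. (fst x)(n := snd x)) ` (index_box n B \<times> B n)"
      by (intro image_eqI[where x = "(\<alpha>(n := 0), \<alpha> n)"]) auto
  qed
  with Suc show ?case
    by (meson finite_SigmaI finite_imageI finite_subset less_Suc_eq)
qed (simp add: index_box_0)

lemma card_index_box: "card (index_box n B) = (\<Prod>k<n. card (B k))"
  using prod_sum_index_box[of "\<lambda>_ _. 1::nat" B n] by simp

lemma MI_le:
  assumes "\<alpha> \<in> MI n d" shows "\<alpha> k \<le> d"
proof (cases "k < n")
  case True
  then have "\<alpha> k \<le> (\<Sum>k<n. \<alpha> k)" by (intro member_le_sum) auto
  then show ?thesis using assms by (simp add: MI_def)
qed (use assms in \<open>auto simp: MI_def multi_indices_def\<close>)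

lemma MI_subset_index_box: "MI n d \<subseteq> index_box n (\<lambda>_. {..d})"
  using MI_le by (auto simp: index_box_def MI_def)

lemma finite_MI: "finite (MI n d)"
  by (rule finite_subset[OF MI_subset_index_box finite_index_box]) simp

lemma MI_0: "MI n 0 = {\<lambda>_. 0}"
  by (auto simp: MI_def multi_indices_def fun_eq_iff) (metis lessThan_iff not_le)

lemma sum_MI_Suc:
  "(\<Sum>\<alpha>\<in>MI (Suc n) d. F \<alpha>) = (\<Sum>b\<le>d. \<Sum>\<alpha>\<in>MI n (d - b). F (\<alpha>(n := b)))"
proof -
  have s: "(\<Sum>k<n. (\<alpha>(n := b)) k) = (\<Sum>k<n. \<alpha> k)" for \<alpha> and b :: nat
    by (rule sum.cong) auto
  have "(\<Sum>\<alpha>\<in>MI (Suc n) d. F \<alpha>) = (\<Sum>x\<in>(SIGMA b:{..d}. MI n (d - b)). F ((snd x)(n := fst x)))"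
    by (rule sum.reindex_bij_witness[where j = "\<lambda>\<alpha>. (\<alpha> n, \<alpha>(n := 0))" and i = "\<lambda>x. (snd x)(n := fst x)"])
       (auto simp: MI_def multi_indices_def fun_eq_iff less_Suc_eq Suc_le_eq s)
  also have "\<dots> = (\<Sum>b\<le>d. \<Sum>\<alpha>\<in>MI n (d - b). F (\<alpha>(n := b)))"
    by (subst sum.Sigma) (auto simp: finite_MI case_prod_beta)
  finally show ?thesis .
qed

definition multinom :: "nat \<Rightarrow> (nat \<Rightarrow> nat) \<Rightarrow> real"
  where "multinom n \<alpha> = fact (\<Sum>k<n. \<alpha> k) / (\<Prod>k<n. fact (\<alpha> k))"

text \<open>
  Split off the last variable, apply the binomial theorem to it and induct on the number of variables.
\<close>

theorem multinomial_theorem: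
  fixes x :: "nat \<Rightarrow> real"
  shows "(\<Sum>\<alpha>\<in>MI n d. multinom n \<alpha> * (\<Prod>k<n. x k ^ \<alpha> k)) = (\<Sum>k<n. x k) ^ d"
proof (induction n arbitrary: d)
  case 0
  show ?case
  proof (cases "d = 0")
    case True
    then show ?thesis by (simp add: MI_0 multinom_def)
  next
    case False
    then have "MI 0 d = {}" by (auto simp: MI_def)
    then show ?thesis using False by simp
  qed
next
  case (Suc n)
  have *: "multinom (Suc n) (\<alpha>(n := b)) * (\<Prod>k<Suc n. x k ^ (\<alpha>(n := b)) k)
      = real (d choose b) * x n ^ b * (multinom n \<alpha> * (\<Prod>k<n. x k ^ \<alpha> k))"
    if "b \<le> d" "\<alpha> \<in> MI n (d - b)" for b \<alpha>
  proof -
    have "(\<Sum>k<n. (\<alpha>(n := b)) k) = d - b"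
      using that by (auto simp: MI_def intro: sum.cong)
    moreover have "(\<Prod>k<n. fact ((\<alpha>(n := b)) k)) = (\<Prod>k<n. fact (\<alpha> k) :: real)"
      by (auto intro: prod.cong)
    moreover have "(\<Prod>k<n. x k ^ ((\<alpha>(n := b)) k)) = (\<Prod>k<n. x k ^ \<alpha> k)"
      by (auto intro: prod.cong)
    moreover have "(\<Sum>k<n. \<alpha> k) = d - b"
      using that by (auto simp: MI_def)
    ultimately show ?thesis
      using that by (simp add: multinom_def binomial_fact field_simps)
  qed
  have "(\<Sum>\<alpha>\<in>MI (Suc n) d. multinom (Suc n) \<alpha> * (\<Prod>k<Suc n. x k ^ \<alpha> k))
     = (\<Sum>b\<le>d. \<Sum>\<alpha>\<in>MI n (d - b). real (d choose b) * x n ^ b * (multinom n \<alpha> * (\<Prod>k<n. x k ^ \<alpha> k)))"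
    unfolding sum_MI_Suc by (intro sum.cong refl *) auto
  also have "\<dots> = (\<Sum>b\<le>d. real (d choose b) * x n ^ b * (\<Sum>k<n. x k) ^ (d - b))"
    by (simp add: Suc flip: sum_distrib_left)
  also have "\<dots> = (\<Sum>k<Suc n. x k) ^ d"
    by (simp add: binomial_ring[of "x n" "\<Sum>k<n. x k"] add.commute)
  finally show ?case .
qed

lemma multinom_ge_1: "multinom n \<alpha> \<ge> 1"
proof -
  have "(\<Prod>k<n. fact (\<alpha> k)) \<le> (fact (\<Sum>k<n. \<alpha> k) :: nat)"
  proof (induction n)
    case (Suc n)
    have "(\<Prod>k<Suc n. fact (\<alpha> k)) \<le> (fact (\<Sum>k<n. \<alpha> k) * fact (\<alpha> n) :: nat)"
      using Suc by simp
    also have "\<dots> \<le> fact (\<Sum>k<Suc n. \<alpha> k)"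
      using fact_fact_dvd_fact[of "\<Sum>k<n. \<alpha> k" "\<alpha> n"] by (intro dvd_imp_le) auto
    finally show ?case .
  qed simp
  then have "real (\<Prod>k<n. fact (\<alpha> k)) \<le> real (fact (\<Sum>k<n. \<alpha> k))"
    by (rule of_nat_mono)
  then show ?thesis
    by (simp add: multinom_def prod_pos)
qed

lemma multinom_le_fact: "\<alpha> \<in> MI n d \<Longrightarrow> multinom n \<alpha> \<le> fact d"
proof -
  assume "\<alpha> \<in> MI n d"
  moreover have "(\<Prod>k<n. fact (\<alpha> k) :: real) \<ge> 1" by (intro prod_ge_1) auto
  ultimately show ?thesis by (simp add: multinom_def MI_def field_simps)
qed

lemma card_MI_le_power: "real (card (MI n d)) \<le> real n ^ d"
proof -
  have "real (card (MI n d)) = (\<Sum>\<alpha>\<in>MI n d. 1)" by simp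
  also have "\<dots> \<le> (\<Sum>\<alpha>\<in>MI n d. multinom n \<alpha> * (\<Prod>k<n. 1 ^ \<alpha> k))"
    by (intro sum_mono) (simp add: multinom_ge_1)
  also have "\<dots> = real n ^ d" by (subst multinomial_theorem) simp
  finally show ?thesis .
qed

text \<open>
  All terms of the generating function \<open>(1 - x) powr (-n)\<close> of the number of monomials are nonnegative,
  so a single one is at most the sum. This bound replaces estimates of binomial coefficients below.
\<close>

lemma card_MI_generating:
  fixes x :: real
  assumes "0 \<le> x" "x < 1"
  shows "card (MI n d) * x ^ d \<le> (1 / (1 - x)) ^ n"
proof -
  have "card (MI n d) * x ^ d = (\<Sum>\<alpha>\<in>MI n d. \<Prod>k<n. x ^ \<alpha> k)"
    by (simp add: MI_def flip: power_sum)
  also have "\<dots> \<le> (\<Sum>\<alpha>\<in>index_box n (\<lambda>_. {..d}). \<Prod>k<n. x ^ \<alpha> k)"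
    using assms MI_subset_index_box by (intro sum_mono2 finite_index_box prod_nonneg) auto
  also have "\<dots> = (\<Prod>k<n. \<Sum>b\<le>d. x ^ b)"
    by (rule prod_sum_index_box[symmetric])
  also have "\<dots> \<le> (\<Prod>k<n. 1 / (1 - x))"
  proof (intro prod_mono conjI sum_nonneg)
    have "(\<Sum>b\<le>d. x ^ b) = (1 - x ^ Suc d) / (1 - x)"
      using assms by (simp add: sum_gp0)
    also have "\<dots> \<le> 1 / (1 - x)" using assms by (intro divide_right_mono) auto
    finally show "(\<Sum>b\<le>d. x ^ b) \<le> 1 / (1 - x)" .
  qed (use assms in auto)
  also have "\<dots> = (1 / (1 - x)) ^ n" by simp
  finally show ?thesis .
qed

section \<open>Hoelder inequality for finite sums\<close>

lemma Young_nonneg: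
  fixes a b s t :: real
  assumes "a \<ge> 0" "b \<ge> 0" "s \<ge> 0" "t \<ge> 0" "s + t = 1"
  shows "a powr s * b powr t \<le> s * a + t * b"
proof (cases "a = 0 \<or> b = 0")
  case True
  then show ?thesis using assms by auto
next
  case False
  then show ?thesis using assms Youngs_inequality_0[of s t a b] by auto
qed

text \<open>
  Hoelder's inequality in the form with exponents \<open>s\<close> and \<open>t\<close> of the sums: after normalizing both sums
  to 1, it is Young's inequality summed over \<open>I\<close>.
\<close>

lemma Holder_sum:
  fixes f g :: "'a \<Rightarrow> real"
  assumes "\<And>i. i \<in> I \<Longrightarrow> f i \<ge> 0" "\<And>i. i \<in> I \<Longrightarrow> g i \<ge> 0" "s \<ge> 0" "t \<ge> 0" "s + t = 1"
  shows "(\<Sum>i\<in>I. f i powr s * g i powr t) \<le> (\<Sum>i\<in>I. f i) powr s * (\<Sum>i\<in>I. g i) powr t"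
proof (cases "finite I \<and> sum f I \<noteq> 0 \<and> sum g I \<noteq> 0")
  case False
  then have "\<forall>i\<in>I. f i powr s * g i powr t = 0" if "finite I"
    using that assms(1,2) by (auto simp: sum_nonneg_eq_0_iff)
  then have "(\<Sum>i\<in>I. f i powr s * g i powr t) = 0"
    by (cases "finite I") (auto intro: sum.neutral)
  then show ?thesis by simp
next
  case True
  define F G where "F = sum f I" and "G = sum g I"
  have F: "F > 0" and G: "G > 0"
    using True assms(1,2) sum_nonneg[of I f] sum_nonneg[of I g] unfolding F_def G_def by force+
  have "(\<Sum>i\<in>I. f i powr s * g i powr t) = (\<Sum>i\<in>I. F powr s * G powr t * ((f i / F) powr s * (g i / G) powr t))"
    using assms(1,2) F G by (intro sum.cong) (auto simp: powr_divide)
  also have "\<dots> \<le> (\<Sum>i\<in>I. F powr s * G powr t * (s * (f i / F) + t * (g i / G)))"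
    using assms F G by (intro sum_mono mult_left_mono Young_nonneg) auto
  also have "\<dots> = F powr s * G powr t * (s * (sum f I / F) + t * (sum g I / G))"
    by (simp add: sum.distrib sum_divide_distrib sum_distrib_left distrib_left)
  also have "\<dots> = F powr s * G powr t"
    using F G assms(5) by (simp add: F_def G_def)
  finally show ?thesis by (simp add: F_def G_def)
qed

lemma power_mean_sum:
  fixes f :: "'a \<Rightarrow> real"
  assumes "\<And>i. i \<in> I \<Longrightarrow> f i \<ge> 0" "p \<ge> 1"
  shows "(\<Sum>i\<in>I. f i) \<le> real (card I) powr (1 - 1/p) * (\<Sum>i\<in>I. f i powr p) powr (1/p)"
proof -
  have "(\<Sum>i\<in>I. f i) = (\<Sum>i\<in>I. 1 powr (1 - 1/p) * (f i powr p) powr (1/p))"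
    using assms by (intro sum.cong) (auto simp: powr_powr)
  also have "\<dots> \<le> (\<Sum>i\<in>I. 1) powr (1 - 1/p) * (\<Sum>i\<in>I. f i powr p) powr (1/p)"
    using assms by (intro Holder_sum) auto
  finally show ?thesis by simp
qed

lemma sum_powr_superadditive:
  fixes f :: "'a \<Rightarrow> real"
  assumes "finite I" "\<And>i. i \<in> I \<Longrightarrow> f i \<ge> 0" "p \<ge> 1"
  shows "(\<Sum>i\<in>I. f i powr p) \<le> (\<Sum>i\<in>I. f i) powr p"
proof -
  have "(\<Sum>i\<in>I. f i powr p) \<le> (\<Sum>i\<in>I. f i * (\<Sum>i\<in>I. f i) powr (p - 1))"
  proof (rule sum_mono)
    fix i assume i: "i \<in> I"
    have "f i \<le> (\<Sum>i\<in>I. f i)" using assms i by (intro member_le_sum) auto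
    then have "f i powr (p - 1) \<le> (\<Sum>i\<in>I. f i) powr (p - 1)"
      using assms i by (intro powr_mono2) auto
    moreover have "f i powr p = f i * f i powr (p - 1)"
      using assms(2)[OF i] by (cases "f i = 0") (auto simp: powr_mult_base)
    ultimately show "f i powr p \<le> f i * (\<Sum>i\<in>I. f i) powr (p - 1)"
      using assms(2)[OF i] by (simp add: mult_left_mono)
  qed
  also have "\<dots> = (\<Sum>i\<in>I. f i) powr p"
    using sum_nonneg[of I f] assms(2)
    by (cases "sum f I = 0") (auto simp: powr_mult_base simp flip: sum_distrib_right)
  finally show ?thesis .
qed

section \<open>Homogeneous polynomials on a discrete torus\<close>

lemma cis_eq_1_iff_int: "cis x = 1 \<longleftrightarrow> (\<exists>k::int. x = 2 * pi * k)"
proof -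
  have "cis x = 1 \<longleftrightarrow> exp (\<i> * complex_of_real x) = 1" by (simp add: cis_conv_exp)
  also have "\<dots> \<longleftrightarrow> (\<exists>k::int. x = 2 * pi * k)"
    by (simp add: exp_eq_1 mult_ac)
  finally show ?thesis .
qed

definition unity_root :: "nat \<Rightarrow> nat \<Rightarrow> complex"
  where "unity_root N i = cis (2 * pi * real i / real N)"

lemma cmod_unity_root [simp]: "cmod (unity_root N i) = 1"
  by (simp add: unity_root_def)

text \<open>
  The characters of the cyclic group of order \<open>N\<close> are orthogonal: for distinct \<open>k\<close>, \<open>j\<close> the sum is geometric
  with ratio an \<open>N\<close>-th root of unity other than 1.
\<close>

lemma roots_of_unity_orthogonal:
  assumes "k < N" "j < N"
  shows "(\<Sum>i<N. unity_root N i ^ k * cnj (unity_root N i ^ j)) = (if k = j then of_nat N else 0)"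
proof -
  define w where "w = cis (2 * pi * (real k - real j) / real N)"
  have "unity_root N i ^ k * cnj (unity_root N i ^ j) = w ^ i" for i
    unfolding unity_root_def w_def by (simp add: cis_cnj Complex.DeMoivre cis_mult)
      (simp add: algebra_simps diff_divide_distrib)
  then have s: "(\<Sum>i<N. unity_root N i ^ k * cnj (unity_root N i ^ j)) = (\<Sum>i<N. w ^ i)" by simp
  show ?thesis
  proof (cases "k = j")
    case False
    have "w \<noteq> 1"
    proof
      assume "w = 1"
      then obtain t :: int where "2 * pi * (real k - real j) / real N = 2 * pi * t"
        unfolding w_def cis_eq_1_iff_int by blast
      then have "2 * pi * ((real k - real j) / real N) = 2 * pi * t" by simp
      then have "(real k - real j) / real N = t" by (simp only: mult_cancel_left) simp
      then have "real_of_int (int k - int j) = real_of_int (t * int N)"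
        using assms by (simp add: field_simps)
      then have "int k - int j = t * int N" by (simp only: of_int_eq_iff)
      moreover have "\<bar>int k - int j\<bar> < int N" using assms by auto
      ultimately show False using False dvd_imp_le_int[of "int k - int j" "int N"] by force
    qed
    moreover have "w ^ N = cis (2 * pi * real_of_int (int k - int j))"
      using assms by (simp add: w_def Complex.DeMoivre)
    then have "w ^ N = 1" by (simp only: cis_eq_1_iff_int) blast
    ultimately show ?thesis using s False by (simp add: geometric_sum)
  qed (use s in \<open>simp add: w_def\<close>)
qed

definition hpoly :: "nat \<Rightarrow> nat \<Rightarrow> ((nat \<Rightarrow> nat) \<Rightarrow> complex) \<Rightarrow> (nat \<Rightarrow> complex) \<Rightarrow> complex"
  where "hpoly n d c z = (\<Sum>\<alpha>\<in>MI n d. c \<alpha> * monomial n \<alpha> z)"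

definition torus_point :: "nat \<Rightarrow> nat \<Rightarrow> (nat \<Rightarrow> nat) \<Rightarrow> nat \<Rightarrow> complex"
  where "torus_point n N j k = (if k < n then unity_root N (j k) else 0)"

text \<open>
  The average over the \<open>N ^ n\<close> points of the torus whose coordinates are \<open>N\<close>-th roots of unity. It equals the
  integral over the torus for trigonometric polynomials of degree less than \<open>N\<close> in each variable.
\<close>

definition torus_avg :: "nat \<Rightarrow> nat \<Rightarrow> ((nat \<Rightarrow> complex) \<Rightarrow> 'a::field) \<Rightarrow> 'a"
  where "torus_avg n N F = (\<Sum>j\<in>index_box n (\<lambda>_. {..<N}). F (torus_point n N j)) / of_nat N ^ n"

lemma torus_point_Cn: "torus_point n N j \<in> Cn n"
  by (simp add: torus_point_def Cn_def)

lemma cmod_torus_point: "k < n \<Longrightarrow> cmod (torus_point n N j k) = 1"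
  by (simp add: torus_point_def)

lemma monomial_mult: "monomial n \<alpha> (\<lambda>k. z k * w k) = monomial n \<alpha> z * monomial n \<alpha> w"
  by (simp add: monomial_def power_mult_distrib prod.distrib)

lemma monomial_add: "monomial n (\<lambda>k. \<alpha> k + \<beta> k) z = monomial n \<alpha> z * monomial n \<beta> z"
  by (simp add: monomial_def power_add prod.distrib)

lemma monomial_scale: "\<alpha> \<in> MI n d \<Longrightarrow> monomial n \<alpha> (\<lambda>k. c * z k) = c ^ d * monomial n \<alpha> z"
  by (auto simp: monomial_def power_mult_distrib prod.distrib MI_def simp flip: power_sum)

lemma hpoly_scale: "hpoly n d c (\<lambda>k. t * z k) = t ^ d * hpoly n d c z"
  by (simp add: hpoly_def monomial_scale sum_distrib_left mult_ac)

lemma torus_avg_mono: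
  fixes F G :: "(nat \<Rightarrow> complex) \<Rightarrow> real"
  assumes "\<And>w. w \<in> Cn n \<Longrightarrow> (\<And>k. k < n \<Longrightarrow> cmod (w k) = 1) \<Longrightarrow> F w \<le> G w"
  shows "torus_avg n N F \<le> torus_avg n N G"
  unfolding torus_avg_def using assms torus_point_Cn cmod_torus_point
  by (intro divide_right_mono sum_mono) auto

lemma torus_avg_const: "N > 0 \<Longrightarrow> torus_avg n N (\<lambda>_. c :: 'a::field_char_0) = c"
  by (simp add: torus_avg_def card_index_box)

lemma torus_avg_sum: "torus_avg n N (\<lambda>w. \<Sum>i\<in>I. F i w) = (\<Sum>i\<in>I. torus_avg n N (F i))"
  unfolding torus_avg_def by (subst sum.swap) (simp add: sum_divide_distrib)

lemma torus_avg_cmult: "torus_avg n N (\<lambda>w. c * F w) = c * torus_avg n N F"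
  by (simp add: torus_avg_def sum_distrib_left)

lemma torus_avg_nonneg:
  fixes F :: "(nat \<Rightarrow> complex) \<Rightarrow> real"
  shows "(\<And>w. F w \<ge> 0) \<Longrightarrow> torus_avg n N F \<ge> 0"
  unfolding torus_avg_def by (intro divide_nonneg_nonneg sum_nonneg) auto

lemma torus_avg_monomial_orthogonal:
  assumes N: "N > 0" and "\<alpha> \<in> index_box n (\<lambda>_. {..<N})" "\<beta> \<in> index_box n (\<lambda>_. {..<N})"
  shows "torus_avg n N (\<lambda>w. monomial n \<alpha> w * cnj (monomial n \<beta> w)) = (if \<alpha> = \<beta> then 1 else 0)"
proof -
  have "(\<Sum>j\<in>index_box n (\<lambda>_. {..<N}). monomial n \<alpha> (torus_point n N j) * cnj (monomial n \<beta> (torus_point n N j)))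
    = (\<Sum>j\<in>index_box n (\<lambda>_. {..<N}). \<Prod>k<n. unity_root N (j k) ^ \<alpha> k * cnj (unity_root N (j k) ^ \<beta> k))"
    unfolding monomial_def cnj_prod prod.distrib[symmetric]
    by (intro sum.cong prod.cong refl) (simp add: torus_point_def)
  also have "\<dots> = (\<Prod>k<n. \<Sum>i<N. unity_root N i ^ \<alpha> k * cnj (unity_root N i ^ \<beta> k))"
    by (rule prod_sum_index_box[symmetric])
  also have "\<dots> = (\<Prod>k<n. if \<alpha> k = \<beta> k then of_nat N else 0)"
    using assms by (intro prod.cong refl roots_of_unity_orthogonal) (auto simp: index_box_def)
  also have "\<dots> = (if \<alpha> = \<beta> then of_nat N ^ n else 0)"
  proof (cases "\<alpha> = \<beta>")
    case False
    then obtain k where "\<alpha> k \<noteq> \<beta> k" by auto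
    moreover from this have "k < n" using assms by (auto simp: index_box_def multi_indices_def) (metis not_le)
    ultimately show ?thesis using False by (auto intro!: prod_zero)
  qed simp
  finally show ?thesis using N by (simp add: torus_avg_def)
qed

lemma MI_subset_index_box_less: "d < N \<Longrightarrow> MI n d \<subseteq> index_box n (\<lambda>_. {..<N})"
  using MI_subset_index_box[of n d] by (fastforce simp: index_box_def)

lemma torus_avg_hpoly_coeff:
  assumes "d < N" "\<beta> \<in> MI n d"
  shows "torus_avg n N (\<lambda>w. hpoly n d c (\<lambda>k. z k * w k) * cnj (monomial n \<beta> w)) = c \<beta> * monomial n \<beta> z"
proof -
  have "torus_avg n N (\<lambda>w. hpoly n d c (\<lambda>k. z k * w k) * cnj (monomial n \<beta> w))
    = torus_avg n N (\<lambda>w. \<Sum>\<alpha>\<in>MI n d. (c \<alpha> * monomial n \<alpha> z) * (monomial n \<alpha> w * cnj (monomial n \<beta> w)))"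
    by (simp add: hpoly_def monomial_mult sum_distrib_left sum_distrib_right mult_ac)
  also have "\<dots> = (\<Sum>\<alpha>\<in>MI n d. (c \<alpha> * monomial n \<alpha> z) * (if \<alpha> = \<beta> then 1 else 0))"
    unfolding torus_avg_sum torus_avg_cmult using assms MI_subset_index_box_less[of d N n]
    by (intro sum.cong arg_cong2[where f = "(*)"] refl torus_avg_monomial_orthogonal) auto
  also have "\<dots> = c \<beta> * monomial n \<beta> z"
    using assms by (simp add: finite_MI if_distrib[where f = "\<lambda>x. _ * x"] cong: if_cong)
  finally show ?thesis .
qed

lemma cmod_torus_avg_le: "cmod (torus_avg n N F) \<le> torus_avg n N (\<lambda>w. cmod (F w))"
  by (simp add: torus_avg_def norm_divide norm_power divide_right_mono sum_norm_le)

text \<open>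
  Cauchy's estimate: up to the factor \<open>monomial n \<beta> z\<close>, the coefficient is an average of the polynomial over the
  torus through \<open>z\<close>.
\<close>

lemma hpoly_coeff_bound:
  assumes "\<beta> \<in> MI n d"
    and "\<And>w. w \<in> Cn n \<Longrightarrow> (\<And>k. k < n \<Longrightarrow> cmod (w k) = 1) \<Longrightarrow> cmod (hpoly n d c (\<lambda>k. z k * w k)) \<le> M"
  shows "cmod (c \<beta> * monomial n \<beta> z) \<le> M"
proof -
  have "cmod (c \<beta> * monomial n \<beta> z)
      \<le> torus_avg n (Suc d) (\<lambda>w. cmod (hpoly n d c (\<lambda>k. z k * w k) * cnj (monomial n \<beta> w)))"
    using cmod_torus_avg_le torus_avg_hpoly_coeff[of d "Suc d" \<beta> n c z] assms(1) by (metis lessI)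
  also have "\<dots> \<le> torus_avg n (Suc d) (\<lambda>_. M)"
  proof (rule torus_avg_mono)
    fix w assume w: "w \<in> Cn n" "\<And>k. k < n \<Longrightarrow> cmod (w k) = 1"
    then have "cmod (monomial n \<beta> w) = 1" by (simp add: monomial_def prod_norm[symmetric] norm_power)
    then show "cmod (hpoly n d c (\<lambda>k. z k * w k) * cnj (monomial n \<beta> w)) \<le> M"
      using assms(2)[OF w] by (simp add: norm_mult)
  qed
  finally show ?thesis by (simp add: torus_avg_const)
qed

lemma Parseval_hpoly:
  assumes "d < N"
  shows "torus_avg n N (\<lambda>w. (cmod (hpoly n d a w))\<^sup>2) = (\<Sum>\<alpha>\<in>MI n d. (cmod (a \<alpha>))\<^sup>2)"
proof -
  have "complex_of_real (torus_avg n N (\<lambda>w. (cmod (hpoly n d a w))\<^sup>2))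
      = torus_avg n N (\<lambda>w. hpoly n d a w * cnj (hpoly n d a w))"
    by (simp add: torus_avg_def complex_norm_square[symmetric])
  also have "\<dots> = torus_avg n N (\<lambda>w. \<Sum>\<beta>\<in>MI n d. cnj (a \<beta>) * (hpoly n d a (\<lambda>k. 1 * w k) * cnj (monomial n \<beta> w)))"
    by (simp add: hpoly_def[of n d a "\<lambda>k. _ k"] sum_distrib_left mult_ac)
  also have "\<dots> = (\<Sum>\<beta>\<in>MI n d. cnj (a \<beta>) * (a \<beta> * monomial n \<beta> (\<lambda>_. 1)))"
    unfolding torus_avg_sum torus_avg_cmult using assms by (intro sum.cong refl) (simp only: torus_avg_hpoly_coeff)
  also have "\<dots> = complex_of_real (\<Sum>\<alpha>\<in>MI n d. (cmod (a \<alpha>))\<^sup>2)"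
    by (simp add: monomial_def complex_norm_square mult_ac del: of_real_power)
  finally show ?thesis by (simp only: of_real_eq_iff)
qed

section \<open>Hypercontractivity\<close>

text \<open>
  The square of the polynomial has the coefficients \<open>b \<gamma> = \<Sum> a \<beta> * a \<beta>'\<close>, summed over the splittings
  \<open>\<gamma> = \<beta> + \<beta>'\<close>. There are at most \<open>\<Prod>k. \<gamma> k + 1 \<le> 2 ^ (2 * d)\<close> of them, so Cauchy--Schwarz bounds the \<open>L\<^sup>2\<close>
  norm of the square.
\<close>

lemma L4_hpoly:
  assumes N: "2 * d < N"
  shows "torus_avg n N (\<lambda>w. (cmod (hpoly n d a w)) ^ 4) \<le> 4 ^ d * (\<Sum>\<alpha>\<in>MI n d. (cmod (a \<alpha>))\<^sup>2)\<^sup>2"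
proof -
  define ad where "ad = (\<lambda>x (k::nat). fst x k + snd x k :: nat)"
  define R where "R = (\<lambda>\<gamma>. {x \<in> MI n d \<times> MI n d. ad x = \<gamma>})"
  define b where "b = (\<lambda>\<gamma>. \<Sum>x\<in>R \<gamma>. a (fst x) * a (snd x))"
  have adMI: "ad ` (MI n d \<times> MI n d) \<subseteq> MI n (2 * d)"
    by (auto simp: ad_def MI_def multi_indices_def sum.distrib)
  have fin: "finite (MI n d \<times> MI n d)" by (simp add: finite_MI)
  have sq: "(hpoly n d a w)\<^sup>2 = hpoly n (2 * d) b w" for w
  proof -
    have "(hpoly n d a w)\<^sup>2 = (\<Sum>x\<in>MI n d \<times> MI n d. a (fst x) * a (snd x) * monomial n (ad x) w)"
      by (simp add: hpoly_def power2_eq_square sum_product sum.cartesian_product case_prod_beta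
          ad_def monomial_add mult_ac)
    also have "\<dots> = (\<Sum>\<gamma>\<in>MI n (2 * d). \<Sum>x\<in>R \<gamma>. a (fst x) * a (snd x) * monomial n (ad x) w)"
      unfolding R_def by (rule sum.group[symmetric, OF fin finite_MI adMI])
    also have "\<dots> = hpoly n (2 * d) b w"
      unfolding hpoly_def b_def sum_distrib_right by (intro sum.cong refl) (auto simp: R_def)
    finally show ?thesis .
  qed
  have cardR: "real (card (R \<gamma>)) \<le> 4 ^ d" if "\<gamma> \<in> MI n (2 * d)" for \<gamma>
  proof -
    have "inj_on fst (R \<gamma>)"
      by (auto simp: inj_on_def R_def ad_def fun_eq_iff)
         (metis add_left_cancel)
    moreover have "fst ` R \<gamma> \<subseteq> index_box n (\<lambda>k. {..\<gamma> k})"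
      by (auto simp: R_def ad_def index_box_def MI_def)
    ultimately have "card (R \<gamma>) \<le> card (index_box n (\<lambda>k. {..\<gamma> k}))"
      by (metis card_image card_mono finite_atMost finite_index_box)
    also have "\<dots> = (\<Prod>k<n. \<gamma> k + 1)" by (simp add: card_index_box)
    also have "\<dots> \<le> (\<Prod>k<n. 2 ^ \<gamma> k)" by (intro prod_mono) (auto simp: Suc_le_eq)
    also have "\<dots> = 2 ^ (2 * d)" using that by (simp add: MI_def flip: power_sum)
    also have "\<dots> = 4 ^ d" by (simp add: power_mult)
    finally have "real (card (R \<gamma>)) \<le> real (4 ^ d)" by (rule of_nat_mono)
    then show ?thesis by simp
  qed
  have "torus_avg n N (\<lambda>w. (cmod (hpoly n d a w)) ^ 4) = torus_avg n N (\<lambda>w. (cmod (hpoly n (2 * d) b w))\<^sup>2)"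
    by (simp flip: sq add: norm_power)
  also have "\<dots> = (\<Sum>\<gamma>\<in>MI n (2 * d). (cmod (b \<gamma>))\<^sup>2)"
    by (rule Parseval_hpoly[OF N])
  also have "\<dots> \<le> (\<Sum>\<gamma>\<in>MI n (2 * d). 4 ^ d * (\<Sum>x\<in>R \<gamma>. (cmod (a (fst x)))\<^sup>2 * (cmod (a (snd x)))\<^sup>2))"
  proof (rule sum_mono)
    fix \<gamma> assume g: "\<gamma> \<in> MI n (2 * d)"
    have "(cmod (b \<gamma>))\<^sup>2 \<le> (\<Sum>x\<in>R \<gamma>. 1 * cmod (a (fst x) * a (snd x)))\<^sup>2"
      unfolding b_def by (intro power_mono) (auto intro: sum_norm_le)
    also have "\<dots> \<le> (\<Sum>x\<in>R \<gamma>. 1\<^sup>2) * (\<Sum>x\<in>R \<gamma>. (cmod (a (fst x) * a (snd x)))\<^sup>2)"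
      by (rule Cauchy_Schwarz_ineq_sum)
    also have "\<dots> \<le> 4 ^ d * (\<Sum>x\<in>R \<gamma>. (cmod (a (fst x)))\<^sup>2 * (cmod (a (snd x)))\<^sup>2)"
      using cardR[OF g] by (auto simp: norm_mult power_mult_distrib intro!: mult_right_mono sum_nonneg)
    finally show "(cmod (b \<gamma>))\<^sup>2 \<le> 4 ^ d * (\<Sum>x\<in>R \<gamma>. (cmod (a (fst x)))\<^sup>2 * (cmod (a (snd x)))\<^sup>2)" .
  qed
  also have "\<dots> = 4 ^ d * (\<Sum>x\<in>MI n d \<times> MI n d. (cmod (a (fst x)))\<^sup>2 * (cmod (a (snd x)))\<^sup>2)"
    unfolding R_def by (simp add: sum.group[OF fin finite_MI adMI] flip: sum_distrib_left)
  also have "\<dots> = 4 ^ d * (\<Sum>\<alpha>\<in>MI n d. (cmod (a \<alpha>))\<^sup>2)\<^sup>2"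
    by (simp add: power2_eq_square[of "sum _ _"] sum_product sum.cartesian_product case_prod_beta)
  finally show ?thesis .
qed

text \<open>
  Interpolating the \<open>L\<^sup>2\<close> norm between \<open>L\<^sup>q\<close> and \<open>L\<^sup>4\<close> and inserting the bound of the \<open>L\<^sup>4\<close> norm by the
  \<open>L\<^sup>2\<close> norm, one can solve for the latter. As \<open>q\<close> tends to 2 the weight of the \<open>L\<^sup>4\<close> norm vanishes, and with it
  the exponential loss in the degree \<open>d\<close>.
\<close>

lemma hypercontractive_hpoly:
  assumes q: "1 \<le> q" "q < 2" and N: "2 * d < N"
  shows "(\<Sum>\<alpha>\<in>MI n d. (cmod (a \<alpha>))\<^sup>2) powr (q / 2)
     \<le> 2 powr (real d * (2 - q)) * torus_avg n N (\<lambda>w. cmod (hpoly n d a w) powr q)"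
proof -
  define B where "B = index_box n (\<lambda>_. {..<N})"
  define x where "x = (\<lambda>j. cmod (hpoly n d a (torus_point n N j)))"
  define K :: real where "K = real N ^ n"
  have K: "K > 0" using N by (simp add: K_def)
  define M2 Mq where "M2 = (\<Sum>\<alpha>\<in>MI n d. (cmod (a \<alpha>))\<^sup>2)" and "Mq = torus_avg n N (\<lambda>w. cmod (hpoly n d a w) powr q)"
  \<comment> \<open>the weights for which \<open>q * s + 4 * t = 2\<close>\<close>
  define s t where "s = 2 / (4 - q)" and "t = (2 - q) / (4 - q)"
  have st: "s > 0" "t > 0" "s + t = 1"
    using q by (auto simp: s_def t_def simp flip: add_divide_distrib)
  have e2: "q * s + 4 * t = 2"
  proof -
    have "q * s + 4 * t = (2 * (4 - q)) / (4 - q)"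
      unfolding s_def t_def times_divide_eq_right add_divide_distrib[symmetric] by simp
    moreover have "4 - q \<noteq> 0" using q by simp
    ultimately show ?thesis by (metis nonzero_mult_div_cancel_right)
  qed
  have Mq: "Mq = (\<Sum>j\<in>B. x j powr q / K)"
    by (simp add: Mq_def torus_avg_def B_def x_def K_def sum_divide_distrib)
  have M2: "M2 = (\<Sum>j\<in>B. (x j)\<^sup>2 / K)"
    unfolding M2_def using N Parseval_hpoly[of d N n a] by (simp add: torus_avg_def B_def x_def K_def sum_divide_distrib)
  have M4: "(\<Sum>j\<in>B. x j ^ 4 / K) \<le> 4 ^ d * M2\<^sup>2"
    using L4_hpoly[OF N, of n a] by (simp add: torus_avg_def B_def x_def K_def M2_def sum_divide_distrib)
  have x0: "x j \<ge> 0" for j by (simp add: x_def)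
  have Mq0: "Mq \<ge> 0" unfolding Mq using K by (intro sum_nonneg) auto
  have M20: "M2 \<ge> 0" unfolding M2_def by (intro sum_nonneg) auto
  have "M2 = (\<Sum>j\<in>B. (x j powr q / K) powr s * (x j ^ 4 / K) powr t)"
    unfolding M2
  proof (rule sum.cong[OF refl])
    fix j
    show "(x j)\<^sup>2 / K = (x j powr q / K) powr s * (x j ^ 4 / K) powr t"
    proof (cases "x j = 0")
      case False
      then have p: "x j > 0" using x0[of j] by simp
      have "(x j powr q / K) powr s * (x j ^ 4 / K) powr t = x j powr (q * s + 4 * t) / K powr (s + t)"
        using p K by (simp add: powr_divide powr_powr powr_add flip: powr_numeral)
      then show ?thesis using p K by (simp add: e2 st(3))
    qed simp
  qed
  also have "\<dots> \<le> Mq powr s * (\<Sum>j\<in>B. x j ^ 4 / K) powr t"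
    unfolding Mq using st K x0 by (intro Holder_sum) auto
  also have "\<dots> \<le> Mq powr s * (4 ^ d * M2\<^sup>2) powr t"
    using M4 st K x0 by (intro mult_left_mono powr_mono2 sum_nonneg) auto
  finally have main: "M2 \<le> Mq powr s * (4 ^ d * M2\<^sup>2) powr t" .
  have "M2 powr (q / 2) \<le> 2 powr (real d * (2 - q)) * Mq"
  proof (cases "M2 = 0")
    case False
    then have p: "M2 > 0" using M20 by simp
    have "(4 ^ d * M2\<^sup>2) powr t = 2 powr (2 * real d * t) * M2 powr (2 * t)"
    proof -
      have "(4::real) ^ d = 2 powr (2 * real d)"
        by (simp add: powr_realpow[symmetric] powr_powr[symmetric])
      moreover have "M2\<^sup>2 = M2 powr 2" using p by simp
      ultimately show ?thesis using p by (simp only: powr_mult powr_powr)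
    qed
    with main have "M2 \<le> Mq powr s * 2 powr (2 * real d * t) * M2 powr (2 * t)"
      by (simp add: mult_ac)
    then have "M2 powr (1 - 2 * t) \<le> Mq powr s * 2 powr (2 * real d * t)"
      using p by (simp add: powr_diff field_simps)
    then have "(M2 powr (1 - 2 * t)) powr (1 / s) \<le> (Mq powr s * 2 powr (2 * real d * t)) powr (1 / s)"
      using st by (intro powr_mono2) auto
    moreover have "(1 - 2 * t) * (1 / s) = q / 2" using q by (simp add: s_def t_def field_simps)
    moreover have "2 * real d * t * (1 / s) = real d * (2 - q)" using q by (simp add: s_def t_def field_simps)
    moreover have "s * (1 / s) = 1" using st by simp
    ultimately show ?thesis using Mq0 by (simp only: powr_powr powr_mult powr_one') (simp add: mult.commute)
  qed (use Mq0 in simp)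
  then show ?thesis by (simp add: M2_def Mq_def)
qed

section \<open>The norms on n-dimensional complex space\<close>

lemma lp_norm_inf: "lp_norm n \<infinity> z = (MAX k\<in>{..<n}. cmod (z k))"
  by (simp add: lp_norm_def)

lemma lp_norm_ereal: "lp_norm n (ereal p) z = (\<Sum>k<n. cmod (z k) powr p) powr (1 / p)"
  by (simp add: lp_norm_def)

lemma exponent_cases:
  assumes "1 \<le> (p::ereal)"
  obtains "p = \<infinity>" | r where "p = ereal r" "1 \<le> r"
  using assms by (cases p) auto

lemma lp_norm_powr: "1 \<le> p \<Longrightarrow> lp_norm n (ereal p) z powr p = (\<Sum>k<n. cmod (z k) powr p)"
  by (simp add: lp_norm_ereal powr_powr sum_nonneg)

lemma component_le_lp_norm:
  assumes "1 \<le> p" "k < n" shows "cmod (z k) \<le> lp_norm n p z"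
  using assms(1)
proof (cases p rule: exponent_cases)
  case 1
  then show ?thesis using assms by (auto simp: lp_norm_inf intro: Max_ge)
next
  case (2 r)
  have "cmod (z k) powr r \<le> (\<Sum>k<n. cmod (z k) powr r)"
    using assms by (intro member_le_sum) auto
  then have "(cmod (z k) powr r) powr (1/r) \<le> (\<Sum>k<n. cmod (z k) powr r) powr (1/r)"
    using 2 by (intro powr_mono2) auto
  then show ?thesis using 2 by (simp add: lp_norm_ereal powr_powr)
qed

lemma lp_norm_nonneg: "1 \<le> p \<Longrightarrow> 0 < n \<Longrightarrow> 0 \<le> lp_norm n p z"
  using component_le_lp_norm[of p 0 n z] norm_ge_zero[of "z 0"] by linarith

lemma lp_norm_mono:
  assumes "1 \<le> p" "0 < n" "\<And>k. k < n \<Longrightarrow> cmod (z k) \<le> cmod (w k)"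
  shows "lp_norm n p z \<le> lp_norm n p w"
  using assms(1)
proof (cases p rule: exponent_cases)
  case 1
  have "cmod (z k) \<le> (MAX k\<in>{..<n}. cmod (w k))" if "k < n" for k
    using assms(3)[OF that] Max_ge[of "(\<lambda>k. cmod (w k)) ` {..<n}" "cmod (w k)"] that
    by (meson finite_imageI finite_lessThan imageI lessThan_iff order_trans)
  then show ?thesis using 1 assms(2) by (auto simp: lp_norm_inf intro!: Max.boundedI)
next
  case (2 r)
  then show ?thesis using assms
    by (auto simp: lp_norm_ereal intro!: powr_mono2 sum_mono sum_nonneg)
qed

lemma lp_norm_cong: "(\<And>k. k < n \<Longrightarrow> cmod (z k) = cmod (w k)) \<Longrightarrow> lp_norm n p z = lp_norm n p w"
  unfolding lp_norm_def by (auto intro!: arg_cong[where f = Max])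

lemma lp_norm_scale:
  assumes "1 \<le> p" "0 < n"
  shows "lp_norm n p (\<lambda>k. c * z k) = cmod c * lp_norm n p z"
  using assms(1)
proof (cases p rule: exponent_cases)
  case 1
  have "mono ((*) (cmod c))" by (auto intro!: monoI mult_left_mono)
  then have "cmod c * Max ((\<lambda>k. cmod (z k)) ` {..<n}) = Max ((*) (cmod c) ` ((\<lambda>k. cmod (z k)) ` {..<n}))"
    using assms(2) by (intro mono_Max_commute) auto
  then show ?thesis using 1 by (simp add: lp_norm_inf norm_mult image_image)
next
  case (2 r)
  have "(\<Sum>k<n. cmod (c * z k) powr r) = cmod c powr r * (\<Sum>k<n. cmod (z k) powr r)"
    by (simp add: norm_mult powr_mult sum_distrib_left)
  then show ?thesis using 2 by (simp add: lp_norm_ereal powr_mult powr_powr sum_nonneg)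
qed

lemma powr_convex_nonneg:
  fixes a b s t p :: real
  assumes "a \<ge> 0" "b \<ge> 0" "s \<ge> 0" "t \<ge> 0" "s + t = 1" "p \<ge> 1"
  shows "(s * a + t * b) powr p \<le> s * a powr p + t * b powr p"
proof -
  have *: "(s * a) powr p \<le> s * a powr p" if "0 \<le> s" "s \<le> 1" "a \<ge> 0" for s a :: real
  proof (cases "s = 0")
    case False
    then have "s powr p \<le> s powr 1" using that assms(6) by (intro powr_mono') auto
    then show ?thesis using that by (simp add: powr_mult mult_right_mono)
  qed simp
  consider "a = 0" | "b = 0" | "a > 0" "b > 0" using assms by force
  then show ?thesis
  proof cases
    case 1
    then show ?thesis using *[of t b] assms by simp
  next
    case 2
    then show ?thesis using *[of s a] assms by simp
  next
    case 3
    have "s = 1 - t" using assms by simp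
    then show ?thesis
      using convex_onD[OF powr_convex[OF assms(6)], of t a b] assms(3,4) 3 by simp
  qed
qed

text \<open>
  Minkowski's inequality: if \<open>a\<close> and \<open>b\<close> are the norms of \<open>z\<close> and \<open>w\<close>, then \<open>\<bar>z k\<bar> + \<bar>w k\<bar>\<close> is \<open>a + b\<close>
  times a convex combination of \<open>\<bar>z k\<bar> / a\<close> and \<open>\<bar>w k\<bar> / b\<close>; apply convexity of \<open>x powr r\<close> and sum.
\<close>

lemma lp_norm_triangle:
  assumes "1 \<le> p" "0 < n"
  shows "lp_norm n p (\<lambda>k. z k + w k) \<le> lp_norm n p z + lp_norm n p w"
  using assms(1)
proof (cases p rule: exponent_cases)
  case 1
  have "cmod (z k + w k) \<le> lp_norm n p z + lp_norm n p w" if "k < n" for k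
    using component_le_lp_norm[OF assms(1) that, of z] component_le_lp_norm[OF assms(1) that, of w]
      norm_triangle_ineq[of "z k" "w k"] by linarith
  then show ?thesis using 1 assms(2) by (subst lp_norm_def) (auto intro!: Max.boundedI)
next
  case (2 r)
  define a b where "a = lp_norm n p z" and "b = lp_norm n p w"
  have ab: "a \<ge> 0" "b \<ge> 0" using lp_norm_nonneg[OF assms] by (auto simp: a_def b_def)
  have az: "cmod (z k) \<le> a" and bw: "cmod (w k) \<le> b" if "k < n" for k
    using component_le_lp_norm[OF assms(1) that] by (auto simp: a_def b_def)
  consider "a = 0" | "b = 0" | "a > 0" "b > 0" using ab by force
  then show ?thesis
  proof cases
    case 1
    then have "lp_norm n p (\<lambda>k. z k + w k) = lp_norm n p w"
      using az by (intro lp_norm_cong) force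
    then show ?thesis using ab by (simp flip: a_def b_def)
  next
    case 2
    then have "lp_norm n p (\<lambda>k. z k + w k) = lp_norm n p z"
      using bw by (intro lp_norm_cong) force
    then show ?thesis using ab by (simp flip: a_def b_def)
  next
    case 3
    have "(\<Sum>k<n. cmod (z k + w k) powr r)
        \<le> (\<Sum>k<n. (a + b) powr r * (a / (a + b) * (cmod (z k) / a) powr r + b / (a + b) * (cmod (w k) / b) powr r))"
    proof (rule sum_mono)
      fix k assume "k \<in> {..<n}"
      have "cmod (z k + w k) powr r \<le> ((a + b) * (a / (a + b) * (cmod (z k) / a) + b / (a + b) * (cmod (w k) / b))) powr r"
      proof (rule powr_mono2)
        have "(a + b) * (a / (a + b) * (cmod (z k) / a) + b / (a + b) * (cmod (w k) / b)) = cmod (z k) + cmod (w k)"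
          using 3 by (simp add: distrib_left)
        then show "cmod (z k + w k) \<le> (a + b) * (a / (a + b) * (cmod (z k) / a) + b / (a + b) * (cmod (w k) / b))"
          using norm_triangle_ineq by simp
      qed (use 2 in auto)
      also have "\<dots> = (a + b) powr r * (a / (a + b) * (cmod (z k) / a) + b / (a + b) * (cmod (w k) / b)) powr r"
        using 3 by (intro powr_mult)
      also have "\<dots> \<le> (a + b) powr r * (a / (a + b) * (cmod (z k) / a) powr r + b / (a + b) * (cmod (w k) / b) powr r)"
        using 3 2 by (intro mult_left_mono powr_convex_nonneg) (auto simp flip: add_divide_distrib)
      finally show "cmod (z k + w k) powr r \<le> (a + b) powr r * (a / (a + b) * (cmod (z k) / a) powr r + b / (a + b) * (cmod (w k) / b) powr r)" .
    qed
    also have "\<dots> = (a + b) powr r * (a / (a + b) * ((\<Sum>k<n. cmod (z k) powr r) / a powr r) + b / (a + b) * ((\<Sum>k<n. cmod (w k) powr r) / b powr r))"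
      using 3 by (simp add: powr_divide flip: sum_distrib_left)
        (simp add: sum.distrib sum_divide_distrib sum_distrib_left mult_ac)
    also have "(\<Sum>k<n. cmod (z k) powr r) = a powr r"
      using 2 by (simp add: a_def lp_norm_powr)
    also have "(\<Sum>k<n. cmod (w k) powr r) = b powr r"
      using 2 by (simp add: b_def lp_norm_powr)
    also have "(a + b) powr r * (a / (a + b) * (a powr r / a powr r) + b / (a + b) * (b powr r / b powr r)) = (a + b) powr r"
      using 3 by (simp flip: add_divide_distrib)
    finally have "(\<Sum>k<n. cmod (z k + w k) powr r) powr (1/r) \<le> ((a + b) powr r) powr (1/r)"
      using 2 by (intro powr_mono2 sum_nonneg) auto
    then show ?thesis using 2 3 by (simp add: lp_norm_ereal powr_powr a_def b_def)
  qed
qed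

lemma lp_norm_le_sum:
  assumes "1 \<le> p" "0 < n"
  shows "lp_norm n p z \<le> (\<Sum>k<n. cmod (z k))"
  using assms(1)
proof (cases p rule: exponent_cases)
  case 1
  have "cmod (z k) \<le> (\<Sum>k<n. cmod (z k))" if "k < n" for k
    using that by (intro member_le_sum) auto
  then show ?thesis using 1 assms by (auto simp: lp_norm_inf intro!: Max.boundedI)
next
  case (2 r)
  have "lp_norm n p z \<le> ((\<Sum>k<n. cmod (z k)) powr r) powr (1/r)"
    unfolding 2 lp_norm_ereal
    using 2 by (intro powr_mono2 sum_powr_superadditive sum_nonneg) auto
  then show ?thesis using 2 by (simp add: powr_powr sum_nonneg)
qed

lemma lp_norm_zero: "1 \<le> p \<Longrightarrow> 0 < n \<Longrightarrow> lp_norm n p (\<lambda>_. 0) = 0"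
  using lp_norm_scale[of p n 0 "\<lambda>_. 0"] by simp

section \<open>Taylor expansion and Cauchy estimates\<close>

text \<open>
  Cauchy's estimate in one variable, by averaging over the roots of unity of order \<open>m + 1\<close>.
\<close>

lemma coeff_bound_circle:
  fixes h :: "nat \<Rightarrow> complex"
  assumes "j \<le> m" "s \<ge> 0" "\<And>l. cmod l = s \<Longrightarrow> cmod (\<Sum>k\<le>m. l ^ k * h k) \<le> B"
  shows "s ^ j * cmod (h j) \<le> B"
proof -
  define N where "N = Suc m"
  have N: "N > 0" by (simp add: N_def)
  define e where "e = unity_root N"
  have "(\<Sum>i<N. (\<Sum>k\<le>m. (of_real s * e i) ^ k * h k) * cnj (e i ^ j))
      = (\<Sum>i<N. \<Sum>k\<le>m. of_real s ^ k * h k * (e i ^ k * cnj (e i ^ j)))"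
    by (simp add: sum_distrib_left sum_distrib_right power_mult_distrib mult_ac)
  also have "\<dots> = (\<Sum>k\<le>m. of_real s ^ k * h k * (\<Sum>i<N. e i ^ k * cnj (e i ^ j)))"
    by (subst sum.swap) (simp add: sum_distrib_left)
  also have "\<dots> = (\<Sum>k\<le>m. of_real s ^ k * h k * (if k = j then of_nat N else 0))"
    unfolding e_def using assms(1) by (intro sum.cong refl arg_cong2[where f = "(*)"] roots_of_unity_orthogonal) (auto simp: N_def)
  also have "\<dots> = of_real s ^ j * h j * of_nat N"
    using assms(1) by (simp add: if_distrib[where f = "\<lambda>x. _ * x"] cong: if_cong)
  finally have "cmod (of_real s ^ j * h j * of_nat N) = cmod (\<Sum>i<N. (\<Sum>k\<le>m. (of_real s * e i) ^ k * h k) * cnj (e i ^ j))"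
    by simp
  also have "\<dots> \<le> (\<Sum>i<N. B)"
    using assms(2,3) by (intro sum_norm_le) (simp add: norm_mult norm_power e_def)
  finally have "s ^ j * cmod (h j) * real N \<le> real N * B"
    using assms(2) by (simp add: norm_mult norm_power)
  then show ?thesis using N by (simp add: mult.commute)
qed

text \<open>
  The coefficients, as a polynomial in \<open>z\<close>, of the factor of \<open>u\<^sup>\<beta>\<close> in the expansion of \<open>P (z + u)\<close>; that is,
  of the partial derivative \<open>\<partial>\<^sup>\<beta>P / \<beta>!\<close>.
\<close>

definition taylor_coeff :: "nat \<Rightarrow> ((nat \<Rightarrow> nat) \<Rightarrow> complex) \<Rightarrow> (nat \<Rightarrow> nat) \<Rightarrow> (nat \<Rightarrow> nat) \<Rightarrow> complex"
  where "taylor_coeff n c \<beta> \<gamma> = (\<Prod>k<n. of_nat (\<gamma> k + \<beta> k choose \<beta> k)) * c (\<lambda>k. \<gamma> k + \<beta> k)"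

text \<open>
  The part of degree \<open>k\<close> in \<open>u\<close> of \<open>P (z + u)\<close>.
\<close>

definition taylor_part :: "nat \<Rightarrow> nat \<Rightarrow> nat \<Rightarrow> ((nat \<Rightarrow> nat) \<Rightarrow> complex) \<Rightarrow> (nat \<Rightarrow> complex) \<Rightarrow> (nat \<Rightarrow> complex) \<Rightarrow> complex"
  where "taylor_part n m k c z u = (\<Sum>\<beta>\<in>MI n k. hpoly n (m - k) (taylor_coeff n c \<beta>) z * monomial n \<beta> u)"

text \<open>
  Expand every coordinate power by the binomial theorem and collect the terms by the degree \<open>k\<close> taken from \<open>u\<close>.
\<close>

lemma Taylor_hpoly:
  "hpoly n m c (\<lambda>i. z i + l * u i) = (\<Sum>k\<le>m. l ^ k * taylor_part n m k c z u)"
proof -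
  define G where "G = (\<lambda>\<alpha> \<beta>. (\<Prod>k<n. of_nat (\<alpha> k choose \<beta> k)) * c \<alpha> * monomial n (\<lambda>k. \<alpha> k - \<beta> k) z
      * monomial n \<beta> u * l ^ (\<Sum>k<n. \<beta> k))"
  have mon: "monomial n \<alpha> (\<lambda>i. z i + l * u i) * c \<alpha> = (\<Sum>\<beta>\<in>index_box n (\<lambda>k. {..\<alpha> k}). G \<alpha> \<beta>)" for \<alpha>
  proof -
    have "monomial n \<alpha> (\<lambda>i. z i + l * u i)
        = (\<Prod>k<n. \<Sum>b\<le>\<alpha> k. of_nat (\<alpha> k choose b) * (l * u k) ^ b * z k ^ (\<alpha> k - b))"
      unfolding monomial_def by (intro prod.cong refl, subst add.commute, rule binomial_ring)
    also have "\<dots> = (\<Sum>\<beta>\<in>index_box n (\<lambda>k. {..\<alpha> k}). \<Prod>k<n. of_nat (\<alpha> k choose \<beta> k) * (l * u k) ^ \<beta> k * z k ^ (\<alpha> k - \<beta> k))"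
      by (rule prod_sum_index_box)
    finally show ?thesis
      by (simp add: sum_distrib_right sum_distrib_left G_def monomial_def power_mult_distrib prod.distrib power_sum mult_ac)
  qed
  have "hpoly n m c (\<lambda>i. z i + l * u i) = (\<Sum>\<alpha>\<in>MI n m. \<Sum>\<beta>\<in>index_box n (\<lambda>k. {..\<alpha> k}). G \<alpha> \<beta>)"
    unfolding hpoly_def mon[symmetric] by (simp add: mult.commute)
  also have "\<dots> = (\<Sum>x\<in>(SIGMA \<alpha>:MI n m. index_box n (\<lambda>k. {..\<alpha> k})). G (fst x) (snd x))"
    by (subst sum.Sigma) (auto simp: finite_MI finite_index_box case_prod_beta)
  also have "\<dots> = (\<Sum>y\<in>(SIGMA k:{..m}. MI n k \<times> MI n (m - k)). G (\<lambda>k. snd (snd y) k + fst (snd y) k) (fst (snd y)))"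
  proof (rule sum.reindex_bij_witness[where
        j = "\<lambda>x. (\<Sum>k<n. snd x k, snd x, \<lambda>k. fst x k - snd x k)" and
        i = "\<lambda>y. (\<lambda>k. snd (snd y) k + fst (snd y) k, fst (snd y))"])
    fix x assume "x \<in> (SIGMA \<alpha>:MI n m. index_box n (\<lambda>k. {..\<alpha> k}))"
    then obtain \<alpha> \<beta> where x: "x = (\<alpha>, \<beta>)" "\<alpha> \<in> MI n m" "\<beta> \<in> index_box n (\<lambda>k. {..\<alpha> k})" by auto
    have le: "\<beta> k \<le> \<alpha> k" for k
      using x by (cases "k < n") (auto simp: index_box_def MI_def multi_indices_def)
    then have ab: "\<alpha> k - \<beta> k + \<beta> k = \<alpha> k" for k by simp
    have "(\<Sum>k<n. \<beta> k) \<le> (\<Sum>k<n. \<alpha> k)" using le by (intro sum_mono) auto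
    moreover have "(\<Sum>k<n. \<alpha> k - \<beta> k) = (\<Sum>k<n. \<alpha> k) - (\<Sum>k<n. \<beta> k)"
      using le by (intro sum_subtractf_nat) auto
    ultimately show "(\<Sum>k<n. snd x k, snd x, \<lambda>k. fst x k - snd x k) \<in> (SIGMA k:{..m}. MI n k \<times> MI n (m - k))"
      using x by (auto simp: MI_def multi_indices_def index_box_def)
    show "(\<lambda>y. (\<lambda>k. snd (snd y) k + fst (snd y) k, fst (snd y))) (\<Sum>k<n. snd x k, snd x, \<lambda>k. fst x k - snd x k) = x"
      by (simp add: x ab)
    show "G (\<lambda>k. snd (snd (\<Sum>k<n. snd x k, snd x, \<lambda>k. fst x k - snd x k)) k
             + fst (snd (\<Sum>k<n. snd x k, snd x, \<lambda>k. fst x k - snd x k)) k)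
            (fst (snd (\<Sum>k<n. snd x k, snd x, \<lambda>k. fst x k - snd x k))) = G (fst x) (snd x)"
      by (simp add: x ab)
  qed (auto simp: MI_def multi_indices_def index_box_def sum.distrib)
  also have "\<dots> = (\<Sum>k\<le>m. \<Sum>x\<in>MI n k \<times> MI n (m - k). G (\<lambda>k. snd x k + fst x k) (fst x))"
    by (subst sum.Sigma) (auto simp: finite_MI case_prod_beta)
  also have "\<dots> = (\<Sum>k\<le>m. l ^ k * taylor_part n m k c z u)"
  proof (rule sum.cong[OF refl])
    fix k
    have "l ^ k * taylor_part n m k c z u = (\<Sum>x\<in>MI n k \<times> MI n (m - k).
        l ^ k * (taylor_coeff n c (fst x) (snd x) * monomial n (snd x) z * monomial n (fst x) u))"
      by (simp add: taylor_part_def hpoly_def sum_distrib_left sum_distrib_right sum.cartesian_product case_prod_beta)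
    also have "\<dots> = (\<Sum>x\<in>MI n k \<times> MI n (m - k). G (\<lambda>k. snd x k + fst x k) (fst x))"
      by (intro sum.cong refl) (auto simp: G_def taylor_coeff_def MI_def mult_ac)
    finally show "(\<Sum>x\<in>MI n k \<times> MI n (m - k). G (\<lambda>k. snd x k + fst x k) (fst x)) = l ^ k * taylor_part n m k c z u" ..
  qed
  finally show ?thesis .
qed

text \<open>
  \<open>M\<close> bounds the polynomial on the unit ball. Stated homogeneously, the bound needs no supremum and applies
  to balls of every radius, open or closed.
\<close>

definition hom_bound :: "nat \<Rightarrow> ereal \<Rightarrow> nat \<Rightarrow> ((nat \<Rightarrow> nat) \<Rightarrow> complex) \<Rightarrow> real \<Rightarrow> bool"
  where "hom_bound n p d c M \<longleftrightarrow> (\<forall>z\<in>Cn n. cmod (hpoly n d c z) \<le> M * lp_norm n p z ^ d)"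

lemma hboundD: "hom_bound n p d c M \<Longrightarrow> z \<in> Cn n \<Longrightarrow> cmod (hpoly n d c z) \<le> M * lp_norm n p z ^ d"
  by (simp add: hom_bound_def)

lemma hom_bound_nonneg:
  assumes "hom_bound n p d c M" "1 \<le> p" "0 < n" shows "M \<ge> 0"
proof -
  define z where "z = (\<lambda>k::nat. if k = 0 then 1 else (0::complex))"
  have "1 \<le> lp_norm n p z"
    using component_le_lp_norm[OF assms(2,3), of z] by (simp add: z_def)
  then have p: "lp_norm n p z ^ d > 0" by simp
  have "z \<in> Cn n" using assms(3) by (auto simp: z_def Cn_def)
  then have "0 \<le> M * lp_norm n p z ^ d"
    using hboundD[OF assms(1), of z] norm_ge_zero[of "hpoly n d c z"] by linarith
  then show ?thesis using p by (simp add: zero_le_mult_iff)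
qed

lemma Cn_add_scale: "z \<in> Cn n \<Longrightarrow> u \<in> Cn n \<Longrightarrow> (\<lambda>i. z i + l * u i) \<in> Cn n"
  by (simp add: Cn_def)

lemma Cn_scale: "z \<in> Cn n \<Longrightarrow> (\<lambda>i. l * z i) \<in> Cn n"
  by (simp add: Cn_def)

lemma hom_bound_from_ball:
  assumes p: "1 \<le> p" "0 < n" and b: "\<And>z. z \<in> lp_ball n p 1 \<Longrightarrow> cmod (hpoly n d c z) \<le> M"
  shows "hom_bound n p d c M"
  unfolding hom_bound_def
proof
  fix z assume z: "z \<in> Cn n"
  define N where "N = lp_norm n p z"
  have N0: "N \<ge> 0" using lp_norm_nonneg[OF p] by (simp add: N_def)
  have *: "cmod (hpoly n d c z) \<le> M * t ^ d" if "t > N" for t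
  proof -
    have t: "t > 0" using that N0 by linarith
    have "lp_norm n p (\<lambda>k. complex_of_real (1 / t) * z k) = N / t"
      unfolding lp_norm_scale[OF p] N_def using t by (simp add: norm_divide)
    moreover have "(\<lambda>k. complex_of_real (1 / t) * z k) \<in> Cn n" by (rule Cn_scale[OF z])
    ultimately have "(\<lambda>k. complex_of_real (1 / t) * z k) \<in> lp_ball n p 1"
      using that t by (simp add: lp_ball_def)
    then have "cmod (hpoly n d c (\<lambda>k. complex_of_real (1 / t) * z k)) \<le> M" by (rule b)
    then show ?thesis
      unfolding hpoly_scale using t by (simp add: norm_mult norm_power norm_divide field_simps)
  qed
  have "((\<lambda>t. M * t ^ d) \<longlongrightarrow> M * N ^ d) (at_right N)"
    by (intro tendsto_intros)
  moreover have "\<forall>\<^sub>F t in at_right N. cmod (hpoly n d c z) \<le> M * t ^ d"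
    using * by (auto simp: eventually_at_right_field intro: gt_ex)
  ultimately show "cmod (hpoly n d c z) \<le> M * lp_norm n p z ^ d"
    unfolding N_def[symmetric] by (rule tendsto_lowerbound) simp
qed

text \<open>
  Cauchy's estimate for the polynomial \<open>P (z + l * u)\<close> in \<open>l\<close> on the circle of radius \<open>s\<close>. The free parameter
  \<open>s\<close> is taken about \<open>1/m\<close> for derivatives of low order, so that \<open>(1 + 1/m) ^ m \<le> e\<close> is the only loss in the norm.
\<close>

lemma taylor_part_bound:
  assumes h: "hom_bound n p m c M" and p: "1 \<le> p" "0 < n" and z: "z \<in> Cn n" "u \<in> Cn n"
    and s: "s > 0" "k \<le> m"
  shows "s ^ k * cmod (taylor_part n m k c z u) \<le> M * (lp_norm n p z + s * lp_norm n p u) ^ m"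
proof (rule coeff_bound_circle[OF s(2)])
  fix l :: complex assume l: "cmod l = s"
  have "cmod (\<Sum>k\<le>m. l ^ k * taylor_part n m k c z u) = cmod (hpoly n m c (\<lambda>i. z i + l * u i))"
    by (simp add: Taylor_hpoly)
  also have "\<dots> \<le> M * lp_norm n p (\<lambda>i. z i + l * u i) ^ m"
    by (rule hboundD[OF h Cn_add_scale[OF z]])
  also have "\<dots> \<le> M * (lp_norm n p z + s * lp_norm n p u) ^ m"
  proof (intro mult_left_mono power_mono)
    show "lp_norm n p (\<lambda>i. z i + l * u i) \<le> lp_norm n p z + s * lp_norm n p u"
      using lp_norm_triangle[OF p, of z "\<lambda>i. l * u i"] by (simp add: lp_norm_scale[OF p] l)
  qed (use hom_bound_nonneg[OF h p] lp_norm_nonneg[OF p] in auto)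
  finally show "cmod (\<Sum>k\<le>m. l ^ k * taylor_part n m k c z u) \<le> M * (lp_norm n p z + s * lp_norm n p u) ^ m" .
qed (use s in auto)

text \<open>
  The coefficients of the partial derivative in the direction \<open>j\<close>.
\<close>

definition partial_coeff :: "nat \<Rightarrow> ((nat \<Rightarrow> nat) \<Rightarrow> complex) \<Rightarrow> (nat \<Rightarrow> nat) \<Rightarrow> complex"
  where "partial_coeff j c \<gamma> = of_nat (Suc (\<gamma> j)) * c (\<gamma>(j := Suc (\<gamma> j)))"

lemma one_plus_inverse_power_le_exp: "m > 0 \<Longrightarrow> (1 + 1 / real m) ^ m \<le> exp 1"
  using exp_ge_one_plus_x_over_n_power_n[of m 1] by simp

lemma partial_derivatives_bound:
  assumes h: "hom_bound n p (Suc d) c M" and p: "1 \<le> p" "0 < n" and z: "w \<in> Cn n" "v \<in> Cn n"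
    and le: "lp_norm n p w \<le> 1" "lp_norm n p v \<le> 1"
  shows "cmod (\<Sum>j<n. v j * hpoly n d (partial_coeff j c) w) \<le> exp 1 * real (Suc d) * M"
proof -
  \<comment> \<open>the multi-indices of degree 1 are the unit vectors, so the sum is the part of degree 1 of the Taylor expansion\<close>
  define e where "e = (\<lambda>j k::nat. if k = j then 1 else 0 :: nat)"
  have eMI: "e j \<in> MI n 1" if "j < n" for j
    using that by (auto simp: e_def MI_def multi_indices_def)
  have MI1: "MI n 1 = e ` {..<n}"
  proof (intro equalityI subsetI)
    fix \<beta> assume b: "\<beta> \<in> MI n 1"
    then have s: "(\<Sum>k<n. \<beta> k) = Suc 0" by (simp add: MI_def)
    then obtain j where j: "j < n" "\<beta> j = Suc 0" "\<forall>k\<in>{..<n}. j \<noteq> k \<longrightarrow> \<beta> k = 0"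
      by (auto simp: sum_eq_Suc0_iff)
    have "\<beta> = e j"
    proof
      fix k show "\<beta> k = e j k"
        using j b by (cases "k < n") (auto simp: e_def MI_def multi_indices_def)
    qed
    then show "\<beta> \<in> e ` {..<n}" using j by auto
  qed (use eMI in auto)
  have inj: "inj_on e {..<n}" by (auto simp: inj_on_def e_def fun_eq_iff)
  have Te: "taylor_coeff n c (e j) = partial_coeff j c" if "j < n" for j
  proof
    fix \<gamma>
    have "(\<Prod>k<n. of_nat (\<gamma> k + e j k choose e j k)) = (\<Prod>k<n. if k = j then of_nat (Suc (\<gamma> j)) else 1 :: complex)"
      by (intro prod.cong) (auto simp: e_def)
    moreover have "(\<lambda>k. \<gamma> k + e j k) = \<gamma>(j := Suc (\<gamma> j))" by (auto simp: e_def)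
    ultimately show "taylor_coeff n c (e j) \<gamma> = partial_coeff j c \<gamma>" using that by (simp add: taylor_coeff_def partial_coeff_def)
  qed
  have me: "monomial n (e j) v = v j" if "j < n" for j
  proof -
    have "monomial n (e j) v = (\<Prod>k<n. if k = j then v j else 1)"
      unfolding monomial_def by (intro prod.cong) (auto simp: e_def)
    then show ?thesis using that by simp
  qed
  have "taylor_part n (Suc d) 1 c w v = (\<Sum>j<n. v j * hpoly n d (partial_coeff j c) w)"
    unfolding taylor_part_def MI1 sum.reindex[OF inj] by (auto intro!: sum.cong simp: Te me)
  moreover have "(1 / real (Suc d)) ^ 1 * cmod (taylor_part n (Suc d) 1 c w v)
      \<le> M * (lp_norm n p w + (1 / real (Suc d)) * lp_norm n p v) ^ Suc d"
    by (rule taylor_part_bound[OF h p z]) auto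
  moreover have "M * (lp_norm n p w + (1 / real (Suc d)) * lp_norm n p v) ^ Suc d \<le> M * exp 1"
  proof (rule mult_left_mono)
    have "(lp_norm n p w + (1 / real (Suc d)) * lp_norm n p v) ^ Suc d \<le> (1 + 1 / real (Suc d)) ^ Suc d"
      using le lp_norm_nonneg[OF p] by (intro power_mono add_mono add_nonneg_nonneg) (auto simp: divide_right_mono)
    also have "\<dots> \<le> exp 1" by (rule one_plus_inverse_power_le_exp) simp
    finally show "(lp_norm n p w + (1 / real (Suc d)) * lp_norm n p v) ^ Suc d \<le> exp 1" .
  qed (rule hom_bound_nonneg[OF h p])
  ultimately have "cmod (\<Sum>j<n. v j * hpoly n d (partial_coeff j c) w) / real (Suc d) \<le> M * exp 1"
    by simp
  then show ?thesis by (subst (asm) pos_divide_le_eq) (simp_all add: mult_ac)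
qed

text \<open>
  Rotating the coordinates of \<open>v\<close> turns a linear form into the sum of the moduli of its terms. As the norms depend
  only on the moduli of the coordinates, this upgrades a bound of a linear form to one of that sum.
\<close>

lemma exists_phases:
  fixes h :: "nat \<Rightarrow> complex" and v :: "nat \<Rightarrow> complex"
  assumes "v \<in> Cn n"
  shows "\<exists>u. u \<in> Cn n \<and> (\<forall>j. cmod (u j) \<le> cmod (v j)) \<and>
    (\<Sum>j<n. u j * h j) = of_real (\<Sum>j<n. cmod (v j) * cmod (h j))"
proof (intro exI conjI allI)
  define u where "u = (\<lambda>j. of_real (cmod (v j)) * cnj (sgn (h j)))"
  show "u \<in> Cn n" using assms by (simp add: u_def Cn_def)
  show "cmod (u j) \<le> cmod (v j)" for j
    by (simp add: u_def norm_mult norm_sgn)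
  have "cnj (sgn x) * x = of_real (cmod x)" for x :: complex
  proof (cases "x = 0")
    case False
    have "cnj (sgn x) * x = (x * cnj x) / of_real (cmod x)"
      by (simp add: sgn_div_norm scaleR_conv_of_real divide_inverse mult_ac)
    then show ?thesis using False by (simp add: complex_norm_square[symmetric] power2_eq_square)
  qed simp
  then have "u j * h j = of_real (cmod (v j) * cmod (h j))" for j
    unfolding u_def by (metis mult.assoc of_real_mult)
  then show "(\<Sum>j<n. u j * h j) = of_real (\<Sum>j<n. cmod (v j) * cmod (h j))"
    unfolding of_real_sum by (intro sum.cong refl)
qed

lemma partial_derivatives_sum_bound:
  assumes h: "hom_bound n p (Suc d) c M" and p: "1 \<le> p" "0 < n" and z: "w \<in> Cn n" "v \<in> Cn n"
    and le: "lp_norm n p w \<le> 1" "lp_norm n p v \<le> 1"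
  shows "(\<Sum>j<n. cmod (v j) * cmod (hpoly n d (partial_coeff j c) w)) \<le> exp 1 * real (Suc d) * M"
proof -
  obtain u where u: "u \<in> Cn n" "\<And>j. cmod (u j) \<le> cmod (v j)"
    "(\<Sum>j<n. u j * hpoly n d (partial_coeff j c) w) = of_real (\<Sum>j<n. cmod (v j) * cmod (hpoly n d (partial_coeff j c) w))"
    using exists_phases[OF z(2), of "\<lambda>j. hpoly n d (partial_coeff j c) w"] by metis
  have "lp_norm n p u \<le> lp_norm n p v" using u(2) by (intro lp_norm_mono[OF p])
  then have "cmod (\<Sum>j<n. u j * hpoly n d (partial_coeff j c) w) \<le> exp 1 * real (Suc d) * M"
    using partial_derivatives_bound[OF h p z(1) u(1) le(1)] le(2) by linarith
  then show ?thesis unfolding u(3) norm_of_real by simp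
qed

section \<open>Coefficients of partial derivatives\<close>

text \<open>
  For index sets where every \<open>a\<close> is represented by some \<open>x\<close>, possibly several times.
\<close>

lemma sum_le_sum_pairs:
  fixes f :: "'b \<Rightarrow> real" and g :: "'a \<Rightarrow> real"
  assumes "finite A" "finite X" "\<And>x. x \<in> X \<Longrightarrow> s x \<in> A"
    and "\<And>a. a \<in> A \<Longrightarrow> \<exists>x\<in>X. s x = a"
    and "\<And>x. x \<in> X \<Longrightarrow> f (s x) \<le> g x" "\<And>a. f a \<ge> 0"
  shows "(\<Sum>a\<in>A. f a) \<le> (\<Sum>x\<in>X. g x)"
proof -
  have "(\<Sum>a\<in>A. f a) \<le> (\<Sum>a\<in>A. \<Sum>x\<in>{x \<in> X. s x = a}. f (s x))"
  proof (rule sum_mono)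
    fix a assume "a \<in> A"
    then obtain x where x: "x \<in> X" "s x = a" using assms(4) by blast
    have "f (s x) \<le> (\<Sum>x\<in>{x \<in> X. s x = a}. f (s x))"
      using x assms(2,6) by (intro member_le_sum) auto
    then show "f a \<le> (\<Sum>x\<in>{x \<in> X. s x = a}. f (s x))" using x by simp
  qed
  also have "\<dots> = (\<Sum>x\<in>X. f (s x))"
    using assms by (intro sum.group) auto
  also have "\<dots> \<le> (\<Sum>x\<in>X. g x)" using assms(5) by (rule sum_mono)
  finally show ?thesis .
qed

lemma Suc_coord_MI:
  assumes "\<gamma> \<in> MI n d" "j < n" shows "\<gamma>(j := Suc (\<gamma> j)) \<in> MI n (Suc d)"
proof -
  have "(\<Sum>k<n. (\<gamma>(j := Suc (\<gamma> j))) k) = (\<Sum>k<n. \<gamma> k + (if k = j then 1 else 0))"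
    by (intro sum.cong) auto
  also have "\<dots> = Suc (\<Sum>k<n. \<gamma> k)" using assms by (simp add: sum.distrib)
  finally show ?thesis using assms by (auto simp: MI_def multi_indices_def)
qed

lemma minus_coord_MI:
  assumes "\<alpha> \<in> MI n (Suc d)" "\<alpha> j \<noteq> 0"
  shows "\<alpha>(j := \<alpha> j - 1) \<in> MI n d" "j < n"
proof -
  show j: "j < n" using assms by (auto simp: MI_def multi_indices_def intro: leI ccontr[of "j < n"])
  have "(\<Sum>k<n. \<alpha> k) = (\<Sum>k<n. (\<alpha>(j := \<alpha> j - 1)) k + (if k = j then 1 else 0))"
    using assms by (intro sum.cong) auto
  also have "\<dots> = Suc (\<Sum>k<n. (\<alpha>(j := \<alpha> j - 1)) k)" using j by (simp add: sum.distrib)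
  finally show "\<alpha>(j := \<alpha> j - 1) \<in> MI n d" using assms j by (auto simp: MI_def multi_indices_def)
qed

lemma MI_Suc_nonzero:
  assumes "\<alpha> \<in> MI n (Suc d)" obtains j where "j < n" "\<alpha> j \<noteq> 0"
proof -
  have "(\<Sum>k<n. \<alpha> k) \<noteq> 0" using assms by (simp add: MI_def)
  then show ?thesis using that by (metis lessThan_iff sum.neutral)
qed

lemma cmod_partial_coeff_ge: "cmod (c (\<gamma>(j := Suc (\<gamma> j)))) \<le> cmod (partial_coeff j c \<gamma>)"
proof -
  have "1 * cmod (c (\<gamma>(j := Suc (\<gamma> j)))) \<le> real (Suc (\<gamma> j)) * cmod (c (\<gamma>(j := Suc (\<gamma> j))))"
    by (intro mult_right_mono) auto
  then show ?thesis by (simp add: partial_coeff_def norm_mult del: of_nat_Suc)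
qed

section \<open>A Bohnenblust-Hille inequality on the polydisc\<close>

text \<open>
  With \<open>A\<close> the weighted mean, \<open>y/A \<le> exp (y/A - 1)\<close> for each factor; the exponents then add up to 0.
\<close>

lemma weighted_AM_GM:
  fixes y :: "nat \<Rightarrow> real"
  assumes "\<beta> \<in> MI n k" "\<And>j. j < n \<Longrightarrow> y j \<ge> 0" "k > 0"
  shows "(\<Prod>j<n. y j ^ \<beta> j) \<le> (\<Sum>j<n. real (\<beta> j) / real k * y j) ^ k"
proof -
  define A where "A = (\<Sum>j<n. real (\<beta> j) / real k * y j)"
  have A0: "A \<ge> 0" unfolding A_def using assms by (intro sum_nonneg) auto
  have sb: "(\<Sum>j<n. real (\<beta> j)) = real k" using assms(1) by (simp add: MI_def flip: of_nat_sum)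
  show ?thesis
  proof (cases "A = 0")
    case True
    then have z: "\<forall>j\<in>{..<n}. real (\<beta> j) / real k * y j = 0"
      unfolding A_def using assms by (subst (asm) sum_nonneg_eq_0_iff) auto
    have "(\<Sum>j<n. \<beta> j) \<noteq> 0" using assms by (simp add: MI_def)
    then obtain j where j: "j < n" "\<beta> j \<noteq> 0" by (metis lessThan_iff sum.neutral)
    then have "y j ^ \<beta> j = 0" using z[rule_format, of j] assms(3) by auto
    then have "(\<Prod>j<n. y j ^ \<beta> j) = 0" using j by (intro prod_zero) auto
    then show ?thesis using A0 by (simp only: A_def[symmetric] zero_le_power)
  next
    case False
    then have A: "A > 0" using A0 by simp
    have "(\<Prod>j<n. (y j / A) ^ \<beta> j) \<le> (\<Prod>j<n. exp (real (\<beta> j) * (y j / A - 1)))"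
    proof (intro prod_mono conjI)
      fix j assume j: "j \<in> {..<n}"
      show "0 \<le> (y j / A) ^ \<beta> j" using assms(2) j A by auto
      have "y j / A \<le> exp (y j / A - 1)" using exp_ge_add_one_self[of "y j / A - 1"] by simp
      then have "(y j / A) ^ \<beta> j \<le> exp (y j / A - 1) ^ \<beta> j"
        using assms(2) j A by (intro power_mono) auto
      then show "(y j / A) ^ \<beta> j \<le> exp (real (\<beta> j) * (y j / A - 1))"
        by (simp only: exp_of_nat_mult)
    qed
    also have "\<dots> = exp ((\<Sum>j<n. real (\<beta> j) * y j) / A - (\<Sum>j<n. real (\<beta> j)))"
      by (simp add: right_diff_distrib sum_subtractf sum_divide_distrib flip: exp_sum)
    also have "(\<Sum>j<n. real (\<beta> j) * y j) = real k * A"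
      using assms(3) by (simp add: A_def sum_distrib_left)
    also have "exp (real k * A / A - (\<Sum>j<n. real (\<beta> j))) = 1" using A by (simp add: sb)
    finally have "(\<Prod>j<n. y j ^ \<beta> j) / (\<Prod>j<n. A ^ \<beta> j) \<le> 1"
      by (simp add: power_divide prod_dividef)
    moreover have "(\<Prod>j<n. A ^ \<beta> j) = A ^ k" using assms(1) by (simp add: MI_def flip: power_sum)
    ultimately have "(\<Prod>j<n. y j ^ \<beta> j) \<le> A ^ k" using A by simp
    then show ?thesis by (simp only: A_def)
  qed
qed

lemma lp_norm_inf_torus:
  assumes "0 < n" "\<And>k. k < n \<Longrightarrow> cmod (w k) = 1" shows "lp_norm n \<infinity> w \<le> 1"
  using assms by (auto simp: lp_norm_inf intro!: Max.boundedI)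

text \<open>
  The inner sum is at most the squared \<open>L\<^sup>2\<close> norm of the \<open>j\<close>-th partial derivative, which hypercontractivity
  with \<open>q = 1\<close> compares with its \<open>L\<^sup>1\<close> norm. The sum over \<open>j\<close> of the moduli of the partial derivatives is bounded
  pointwise.
\<close>

lemma polydisc_mixed_norm:
  assumes h: "hom_bound n \<infinity> (Suc d) a M" and n: "0 < n"
  shows "(\<Sum>j<n. sqrt (\<Sum>\<beta>\<in>{\<beta> \<in> MI n (Suc d). \<beta> j \<noteq> 0}. (cmod (a \<beta>))\<^sup>2)) \<le> 2 ^ d * (exp 1 * real (Suc d) * M)"
proof -
  define N where "N = Suc (2 * d)"
  have one: "(\<lambda>k. if k < n then 1 else 0) \<in> Cn n" by (simp add: Cn_def)
  have "sqrt (\<Sum>\<beta>\<in>{\<beta> \<in> MI n (Suc d). \<beta> j \<noteq> 0}. (cmod (a \<beta>))\<^sup>2)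
      \<le> 2 ^ d * torus_avg n N (\<lambda>w. cmod (hpoly n d (partial_coeff j a) w))" for j
  proof -
    have "(\<Sum>\<beta>\<in>{\<beta> \<in> MI n (Suc d). \<beta> j \<noteq> 0}. (cmod (a \<beta>))\<^sup>2) \<le> (\<Sum>\<gamma>\<in>MI n d. (cmod (partial_coeff j a \<gamma>))\<^sup>2)"
    proof (cases "j < n")
      case True
      show ?thesis
      proof (rule sum_le_sum_pairs[where s = "\<lambda>\<gamma>. \<gamma>(j := Suc (\<gamma> j))"])
        fix \<alpha> assume "\<alpha> \<in> {\<beta> \<in> MI n (Suc d). \<beta> j \<noteq> 0}"
        then show "\<exists>\<gamma>\<in>MI n d. \<gamma>(j := Suc (\<gamma> j)) = \<alpha>"
          using minus_coord_MI(1)[of \<alpha> n d j] by (intro bexI[of _ "\<alpha>(j := \<alpha> j - 1)"]) (auto simp: fun_eq_iff)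
      qed (use True in \<open>auto simp: finite_MI Suc_coord_MI intro!: power_mono cmod_partial_coeff_ge\<close>)
    next
      case False
      then have "{\<beta> \<in> MI n (Suc d). \<beta> j \<noteq> 0} = {}" by (auto simp: MI_def multi_indices_def dest: leI)
      then show ?thesis by (simp only: sum.empty) (intro sum_nonneg zero_le_power2)
    qed
    then have "sqrt (\<Sum>\<beta>\<in>{\<beta> \<in> MI n (Suc d). \<beta> j \<noteq> 0}. (cmod (a \<beta>))\<^sup>2) \<le> (\<Sum>\<gamma>\<in>MI n d. (cmod (partial_coeff j a \<gamma>))\<^sup>2) powr (1/2)"
      by (simp add: powr_half_sqrt sum_nonneg)
    also have "\<dots> \<le> 2 powr (real d * (2 - 1)) * torus_avg n N (\<lambda>w. cmod (hpoly n d (partial_coeff j a) w) powr 1)"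
      by (rule hypercontractive_hpoly) (auto simp: N_def)
    finally show ?thesis by (simp add: powr_realpow)
  qed
  then have "(\<Sum>j<n. sqrt (\<Sum>\<beta>\<in>{\<beta> \<in> MI n (Suc d). \<beta> j \<noteq> 0}. (cmod (a \<beta>))\<^sup>2))
      \<le> (\<Sum>j<n. 2 ^ d * torus_avg n N (\<lambda>w. cmod (hpoly n d (partial_coeff j a) w)))"
    by (intro sum_mono) auto
  also have "\<dots> = 2 ^ d * torus_avg n N (\<lambda>w. \<Sum>j<n. cmod (hpoly n d (partial_coeff j a) w))"
    by (simp add: torus_avg_sum sum_distrib_left)
  also have "\<dots> \<le> 2 ^ d * torus_avg n N (\<lambda>w. exp 1 * real (Suc d) * M)"
  proof (intro mult_left_mono torus_avg_mono)
    fix w assume w: "w \<in> Cn n" "\<And>k. k < n \<Longrightarrow> cmod (w k) = 1"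
    have "(\<Sum>j<n. cmod (hpoly n d (partial_coeff j a) w)) = (\<Sum>j<n. cmod (if j < n then 1 else 0) * cmod (hpoly n d (partial_coeff j a) w))"
      by simp
    also have "\<dots> \<le> exp 1 * real (Suc d) * M"
      using n w by (intro partial_derivatives_sum_bound[OF h _ n w(1) one] lp_norm_inf_torus) auto
    finally show "(\<Sum>j<n. cmod (hpoly n d (partial_coeff j a) w)) \<le> exp 1 * real (Suc d) * M" .
  qed auto
  finally show ?thesis by (simp add: torus_avg_const N_def)
qed

text \<open>
  Blei's inequality in terms of monomials. Let \<open>S j\<close> be the inner square roots, \<open>T\<close> their sum and
  \<open>X \<beta> = \<Prod>j. S j ^ \<beta> j\<close>. Hoelder's inequality for the factorization
  \<open>a powr q = (a\<^sup>2 * X powr (-1/k)) powr s * X powr t\<close> leaves two sums. The sum of \<open>X\<close> is at most \<open>T ^ k\<close> by the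
  multinomial theorem, and \<open>X powr (-1/k)\<close> is at most the mean of the \<open>1 / S j\<close> with weights \<open>\<beta> j / k\<close>, so the other
  sum is at most \<open>\<Sum>j. (1 / S j) * (S j)\<^sup>2 = T\<close>.
\<close>

lemma Blei_inequality:
  fixes a :: "(nat \<Rightarrow> nat) \<Rightarrow> real"
  assumes k: "k > 0" and a0: "\<And>\<beta>. a \<beta> \<ge> 0"
  shows "(\<Sum>\<beta>\<in>MI n k. a \<beta> powr (2 * real k / (real k + 1)))
     \<le> (\<Sum>j<n. sqrt (\<Sum>\<beta>\<in>{\<beta> \<in> MI n k. \<beta> j \<noteq> 0}. (a \<beta>)\<^sup>2)) powr (2 * real k / (real k + 1))"
proof -
  define S where "S = (\<lambda>j. sqrt (\<Sum>\<beta>\<in>{\<beta> \<in> MI n k. \<beta> j \<noteq> 0}. (a \<beta>)\<^sup>2))"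
  define T where "T = (\<Sum>j<n. S j)"
  define X where "X = (\<lambda>\<beta>. \<Prod>j<n. S j ^ \<beta> j)"
  define s t q where "s = real k / (real k + 1)" and "t = 1 / (real k + 1)" and "q = 2 * real k / (real k + 1)"
  have S0: "S j \<ge> 0" for j by (simp add: S_def sum_nonneg)
  have T0: "T \<ge> 0" unfolding T_def using S0 by (intro sum_nonneg)
  have X0: "X \<beta> \<ge> 0" for \<beta> unfolding X_def using S0 by (intro prod_nonneg) auto
  have st: "s \<ge> 0" "t \<ge> 0" "s + t = 1" by (simp_all add: s_def t_def flip: add_divide_distrib)
  have q: "q = 2 * s" by (simp add: q_def s_def)
  define A where "A = (\<lambda>\<beta>. \<Sum>j<n. real (\<beta> j) / real k * (1 / S j))"
  have A0: "A \<beta> \<ge> 0" for \<beta> unfolding A_def using S0 by (intro sum_nonneg) auto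
  \<comment> \<open>where \<open>a \<beta>\<close> does not vanish, \<open>S j > 0\<close> for all \<open>j\<close> in the support of \<open>\<beta>\<close>, hence \<open>X \<beta> > 0\<close>\<close>
  have tm: "a \<beta> powr q \<le> ((a \<beta>)\<^sup>2 * A \<beta>) powr s * X \<beta> powr t" if b: "\<beta> \<in> MI n k" for \<beta>
  proof (cases "a \<beta> = 0")
    case False
    then have ap: "a \<beta> > 0" using a0[of \<beta>] by simp
    have Sp: "S j > 0" if "j < n" "\<beta> j \<noteq> 0" for j
    proof -
      have "(a \<beta>)\<^sup>2 \<le> (\<Sum>\<beta>\<in>{\<beta> \<in> MI n k. \<beta> j \<noteq> 0}. (a \<beta>)\<^sup>2)"
        using that b by (intro member_le_sum) (auto simp: finite_MI)
      then have "(\<Sum>\<beta>\<in>{\<beta> \<in> MI n k. \<beta> j \<noteq> 0}. (a \<beta>)\<^sup>2) > 0" using ap by (smt (verit) zero_less_power)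
      then show ?thesis by (simp add: S_def)
    qed
    have Xp: "X \<beta> > 0" unfolding X_def
    proof (rule prod_pos)
      fix j assume "j \<in> {..<n}"
      then show "0 < S j ^ \<beta> j" using Sp[of j] by (cases "\<beta> j = 0") auto
    qed
    have "1 / X \<beta> = (\<Prod>j<n. (1 / S j) ^ \<beta> j)" by (simp add: X_def power_divide prod_dividef)
    also have "\<dots> \<le> A \<beta> ^ k" unfolding A_def using b S0 k by (intro weighted_AM_GM) auto
    finally have "(1 / X \<beta>) powr (1 / real k) \<le> (A \<beta> ^ k) powr (1 / real k)"
      using Xp by (intro powr_mono2) auto
    moreover have "(A \<beta> ^ k) powr (1 / real k) = A \<beta>"
    proof (cases "A \<beta> = 0")
      case False
      then show ?thesis using A0[of \<beta>] k by (simp add: powr_powr flip: powr_realpow)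
    qed (use k in simp)
    ultimately have "(1 / X \<beta>) powr (1 / real k) \<le> A \<beta>" by simp
    then have "((a \<beta>)\<^sup>2 * (1 / X \<beta>) powr (1 / real k)) powr s \<le> ((a \<beta>)\<^sup>2 * A \<beta>) powr s"
      using st by (intro powr_mono2 mult_left_mono) auto
    moreover have "((a \<beta>)\<^sup>2 * (1 / X \<beta>) powr (1 / real k)) powr s = a \<beta> powr q * X \<beta> powr (- t)"
    proof -
      have "(a \<beta>)\<^sup>2 = a \<beta> powr 2" using ap by simp
      moreover have "1 / real k * s = t" using k by (simp add: s_def t_def)
      moreover have "((1 / X \<beta>) powr (1 / real k)) powr s = (1 / X \<beta>) powr t"
        unfolding powr_powr \<open>1 / real k * s = t\<close> ..
      ultimately show ?thesis using Xp ap by (simp add: powr_mult powr_powr q powr_divide powr_minus_divide del: powr_numeral)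
    qed
    ultimately have "a \<beta> powr q * X \<beta> powr (- t) * X \<beta> powr t \<le> ((a \<beta>)\<^sup>2 * A \<beta>) powr s * X \<beta> powr t"
      by (intro mult_right_mono) auto
    then show ?thesis using Xp by (simp add: mult.assoc flip: powr_add)
  qed simp
  have "(\<Sum>\<beta>\<in>MI n k. a \<beta> powr q) \<le> (\<Sum>\<beta>\<in>MI n k. ((a \<beta>)\<^sup>2 * A \<beta>) powr s * X \<beta> powr t)"
    by (intro sum_mono tm)
  also have "\<dots> \<le> (\<Sum>\<beta>\<in>MI n k. (a \<beta>)\<^sup>2 * A \<beta>) powr s * (\<Sum>\<beta>\<in>MI n k. X \<beta>) powr t"
    using st A0 X0 by (intro Holder_sum) auto
  also have "\<dots> \<le> T powr s * (T ^ k) powr t"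
  proof (intro mult_mono powr_mono2 st sum_nonneg)
    have "(\<Sum>\<beta>\<in>MI n k. (a \<beta>)\<^sup>2 * A \<beta>) = (\<Sum>j<n. 1 / S j * (\<Sum>\<beta>\<in>MI n k. real (\<beta> j) / real k * (a \<beta>)\<^sup>2))"
      unfolding A_def sum_distrib_left by (subst sum.swap) (simp add: mult_ac)
    also have "\<dots> \<le> (\<Sum>j<n. S j)"
    proof (rule sum_mono)
      fix j
      have "(\<Sum>\<beta>\<in>MI n k. real (\<beta> j) / real k * (a \<beta>)\<^sup>2) = (\<Sum>\<beta>\<in>{\<beta> \<in> MI n k. \<beta> j \<noteq> 0}. real (\<beta> j) / real k * (a \<beta>)\<^sup>2)"
        by (rule sum.mono_neutral_right) (auto simp: finite_MI)
      also have "\<dots> \<le> (\<Sum>\<beta>\<in>{\<beta> \<in> MI n k. \<beta> j \<noteq> 0}. 1 * (a \<beta>)\<^sup>2)"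
        using MI_le k by (intro sum_mono mult_right_mono) auto
      also have "\<dots> = (S j)\<^sup>2" by (simp add: S_def sum_nonneg)
      finally have "1 / S j * (\<Sum>\<beta>\<in>MI n k. real (\<beta> j) / real k * (a \<beta>)\<^sup>2) \<le> 1 / S j * (S j)\<^sup>2"
        using S0 by (intro mult_left_mono) auto
      then show "1 / S j * (\<Sum>\<beta>\<in>MI n k. real (\<beta> j) / real k * (a \<beta>)\<^sup>2) \<le> S j"
        using S0[of j] by (simp add: power2_eq_square)
    qed
    finally show "(\<Sum>\<beta>\<in>MI n k. (a \<beta>)\<^sup>2 * A \<beta>) \<le> T" by (simp add: T_def)
    have "(\<Sum>\<beta>\<in>MI n k. X \<beta>) \<le> (\<Sum>\<beta>\<in>MI n k. multinom n \<beta> * X \<beta>)"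
      using mult_right_mono[OF multinom_ge_1 X0] by (intro sum_mono) simp
    also have "\<dots> = T ^ k" unfolding X_def T_def by (rule multinomial_theorem)
    finally show "(\<Sum>\<beta>\<in>MI n k. X \<beta>) \<le> T ^ k" .
  qed (use A0 X0 T0 in auto)
  also have "\<dots> = T powr q"
  proof (cases "T = 0")
    case False
    then have "T > 0" using T0 by simp
    moreover have "s + real k * t = q" by (simp add: s_def t_def q_def flip: add_divide_distrib)
    ultimately show ?thesis by (simp add: powr_powr flip: powr_realpow powr_add)
  qed simp
  finally show ?thesis by (simp add: T_def S_def q_def)
qed

lemma polydisc_Bohnenblust_Hille:
  assumes h: "hom_bound n \<infinity> k a M" and n: "0 < n" and k: "k > 0"
  shows "(\<Sum>\<beta>\<in>MI n k. cmod (a \<beta>) powr (2 * real k / (real k + 1)))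
     \<le> (2 ^ (k - 1) * (exp 1 * real k * M)) powr (2 * real k / (real k + 1))"
proof -
  have "(\<Sum>\<beta>\<in>MI n k. cmod (a \<beta>) powr (2 * real k / (real k + 1)))
     \<le> (\<Sum>j<n. sqrt (\<Sum>\<beta>\<in>{\<beta> \<in> MI n k. \<beta> j \<noteq> 0}. (cmod (a \<beta>))\<^sup>2)) powr (2 * real k / (real k + 1))"
    using k by (intro Blei_inequality) auto
  also have "\<dots> \<le> (2 ^ (k - 1) * (exp 1 * real k * M)) powr (2 * real k / (real k + 1))"
    using polydisc_mixed_norm[of n "k - 1" a M] h n k
    by (intro powr_mono2 sum_nonneg) (auto simp: sum_nonneg)
  finally show ?thesis .
qed

section \<open>Coefficient sums on the polydisc\<close>

lemma MI_split:
  assumes "\<alpha> \<in> MI n m" "k \<le> m"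
  shows "\<exists>\<beta>\<in>MI n k. \<exists>\<gamma>\<in>MI n (m - k). \<alpha> = (\<lambda>i. \<gamma> i + \<beta> i)"
  using assms(2)
proof (induction k)
  case 0
  show ?case using assms(1) by (auto simp: MI_0)
next
  case (Suc k)
  then obtain \<beta> \<gamma> where bg: "\<beta> \<in> MI n k" "\<gamma> \<in> MI n (m - k)" "\<alpha> = (\<lambda>i. \<gamma> i + \<beta> i)" by auto
  have mk: "m - k = Suc (m - Suc k)" using Suc.prems by simp
  obtain j where j: "j < n" "\<gamma> j \<noteq> 0" using bg(2) unfolding mk by (rule MI_Suc_nonzero)
  have "\<beta>(j := Suc (\<beta> j)) \<in> MI n (Suc k)" using bg(1) j(1) by (rule Suc_coord_MI)
  moreover have "\<gamma>(j := \<gamma> j - 1) \<in> MI n (m - Suc k)" using bg(2) j unfolding mk by (intro minus_coord_MI)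
  moreover have "\<alpha> = (\<lambda>i. (\<gamma>(j := \<gamma> j - 1)) i + (\<beta>(j := Suc (\<beta> j))) i)" using j by (auto simp: bg(3))
  ultimately show ?case by blast
qed

lemma cmod_taylor_coeff_ge: "cmod (c (\<lambda>i. \<gamma> i + \<beta> i)) \<le> cmod (taylor_coeff n c \<beta> \<gamma>)"
proof -
  have "(1::real) \<le> (\<Prod>k<n. real (\<gamma> k + \<beta> k choose \<beta> k))"
  proof (rule prod_ge_1)
    fix k
    have "0 < (\<gamma> k + \<beta> k choose \<beta> k)" by simp
    then show "1 \<le> real (\<gamma> k + \<beta> k choose \<beta> k)" by linarith
  qed
  then have "1 * cmod (c (\<lambda>i. \<gamma> i + \<beta> i)) \<le> (\<Prod>k<n. real (\<gamma> k + \<beta> k choose \<beta> k)) * cmod (c (\<lambda>i. \<gamma> i + \<beta> i))"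
    by (intro mult_right_mono) auto
  then show ?thesis by (simp add: taylor_coeff_def norm_mult prod_norm[symmetric])
qed

text \<open>
  Every multi-index of degree \<open>m\<close> splits as \<open>\<gamma> + \<beta>\<close> with \<open>\<beta>\<close> of degree \<open>k\<close>, so \<open>\<bar>c\<bar>\<close> is dominated by the Taylor
  coefficients. For fixed \<open>\<beta>\<close>, Cauchy--Schwarz and hypercontractivity in \<open>\<gamma>\<close> lead to the \<open>L\<^sup>q\<close> norm over the torus
  of the factor of \<open>u\<^sup>\<beta>\<close>. For fixed \<open>z\<close> on the torus these factors are the coefficients of a \<open>k\<close>-homogeneous
  polynomial in \<open>u\<close> of norm at most \<open>e * m ^ k * M\<close>, so the Bohnenblust--Hille inequality bounds the sum of their
  \<open>q\<close>-th powers.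
\<close>

theorem polydisc_coefficient_sum:
  assumes h: "hom_bound n \<infinity> m c M" and n: "0 < n" and k: "0 < k" "k \<le> m"
  shows "(\<Sum>\<alpha>\<in>MI n m. cmod (c \<alpha>))
     \<le> sqrt (card (MI n (m - k))) * 2 powr (real (m - k) / real k) * real n powr ((real k - 1) / 2)
       * (2 ^ (k - 1) * exp 1 * real k * exp 1) * real m ^ k * M"
proof -
  define d where "d = m - k"
  define q where "q = 2 * real k / (real k + 1)"
  define N where "N = Suc (2 * d)"
  define B where "B = 2 ^ (k - 1) * (exp 1 * real k * (exp 1 * real m ^ k * M))"
  have M0: "M \<ge> 0" using hom_bound_nonneg[OF h _ n] by simp
  have m: "m > 0" using k by simp
  have q: "1 \<le> q" "q < 2" using k by (auto simp: q_def field_simps)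
  have B0: "B \<ge> 0" using M0 by (simp add: B_def)
  have hb: "hom_bound n \<infinity> k (\<lambda>\<beta>. hpoly n d (taylor_coeff n c \<beta>) z) (exp 1 * real m ^ k * M)"
    if z: "z \<in> Cn n" "\<And>i. i < n \<Longrightarrow> cmod (z i) = 1" for z
  proof (rule hom_bound_from_ball)
    fix u assume u: "u \<in> lp_ball n \<infinity> 1"
    then have uC: "u \<in> Cn n" and u1: "lp_norm n \<infinity> u < 1" by (auto simp: lp_ball_def)
    have "hpoly n k (\<lambda>\<beta>. hpoly n d (taylor_coeff n c \<beta>) z) u = taylor_part n m k c z u"
      by (simp add: hpoly_def[of n k] taylor_part_def d_def)
    moreover have "(1 / real m) ^ k * cmod (taylor_part n m k c z u) \<le> M * (lp_norm n \<infinity> z + 1 / real m * lp_norm n \<infinity> u) ^ m"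
      using m k by (intro taylor_part_bound[OF h _ n z(1) uC]) auto
    moreover have "M * (lp_norm n \<infinity> z + 1 / real m * lp_norm n \<infinity> u) ^ m \<le> M * exp 1"
    proof (intro mult_left_mono M0)
      have "(lp_norm n \<infinity> z + 1 / real m * lp_norm n \<infinity> u) ^ m \<le> (1 + 1 / real m) ^ m"
        using lp_norm_inf_torus[OF n z(2)] lp_norm_nonneg[of \<infinity> n z] lp_norm_nonneg[of \<infinity> n u] n u1 m
        by (intro power_mono add_mono add_nonneg_nonneg) (auto simp: divide_right_mono)
      also have "\<dots> \<le> exp 1" using m by (rule one_plus_inverse_power_le_exp)
      finally show "(lp_norm n \<infinity> z + 1 / real m * lp_norm n \<infinity> u) ^ m \<le> exp 1" .
    qed
    ultimately have "(1 / real m) ^ k * cmod (hpoly n k (\<lambda>\<beta>. hpoly n d (taylor_coeff n c \<beta>) z) u) \<le> M * exp 1" by simp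
    then show "cmod (hpoly n k (\<lambda>\<beta>. hpoly n d (taylor_coeff n c \<beta>) z) u) \<le> exp 1 * real m ^ k * M"
      using m by (simp add: power_divide field_simps)
  qed (use n in auto)
  define avg where "avg = (\<lambda>\<beta>. torus_avg n N (\<lambda>w. cmod (hpoly n d (taylor_coeff n c \<beta>) w) powr q))"
  have avg0: "avg \<beta> \<ge> 0" for \<beta> unfolding avg_def by (rule torus_avg_nonneg) simp
  have "(\<Sum>\<alpha>\<in>MI n m. cmod (c \<alpha>)) \<le> (\<Sum>x\<in>MI n k \<times> MI n d. cmod (taylor_coeff n c (fst x) (snd x)))"
  proof (rule sum_le_sum_pairs[where s = "\<lambda>x i. snd x i + fst x i"])
    fix \<alpha> assume "\<alpha> \<in> MI n m"
    then show "\<exists>x\<in>MI n k \<times> MI n d. (\<lambda>i. snd x i + fst x i) = \<alpha>"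
      using MI_split[of \<alpha> n m k] k by (fastforce simp: d_def)
  next
    fix x assume "x \<in> MI n k \<times> MI n d"
    then show "(\<lambda>i. snd x i + fst x i) \<in> MI n m"
      using k by (auto simp: MI_def multi_indices_def sum.distrib d_def)
  qed (auto simp: finite_MI cmod_taylor_coeff_ge)
  also have "\<dots> = (\<Sum>\<beta>\<in>MI n k. \<Sum>\<gamma>\<in>MI n d. cmod (taylor_coeff n c \<beta> \<gamma>))"
    by (simp add: sum.cartesian_product case_prod_beta)
  also have "\<dots> \<le> (\<Sum>\<beta>\<in>MI n k. sqrt (card (MI n d)) * (2 powr (real d / real k) * avg \<beta> powr (1/q)))"
  proof (rule sum_mono)
    fix \<beta>
    define V where "V = (\<Sum>\<gamma>\<in>MI n d. (cmod (taylor_coeff n c \<beta> \<gamma>))\<^sup>2)"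
    have V0: "V \<ge> 0" by (simp add: V_def sum_nonneg)
    have "(\<Sum>\<gamma>\<in>MI n d. cmod (taylor_coeff n c \<beta> \<gamma>)) \<le> card (MI n d) powr (1 - 1/2) * (\<Sum>\<gamma>\<in>MI n d. cmod (taylor_coeff n c \<beta> \<gamma>) powr 2) powr (1/2)"
      by (rule power_mean_sum) auto
    also have "\<dots> = sqrt (card (MI n d)) * V powr (1/2)"
      by (simp add: V_def powr_half_sqrt)
    also have "V powr (1/2) = (V powr (q/2)) powr (1/q)" using q by (simp add: powr_powr)
    also have "\<dots> \<le> (2 powr (real d * (2 - q)) * avg \<beta>) powr (1/q)"
      unfolding V_def avg_def using q by (intro powr_mono2 hypercontractive_hpoly) (auto simp: N_def)
    also have "\<dots> = 2 powr (real d * (2 - q) / q) * avg \<beta> powr (1/q)"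
      by (simp add: powr_mult powr_powr)
    also have "real d * (2 - q) / q = real d / real k"
    proof -
      have "q * (real k + 1) = 2 * real k" by (simp add: q_def)
      then have "(2 - q) * real k = q" by (simp add: algebra_simps)
      then have "(2 - q) / q = 1 / real k" using q k by (simp add: field_simps)
      then show ?thesis by (metis times_divide_eq_right mult.right_neutral)
    qed
    finally show "(\<Sum>\<gamma>\<in>MI n d. cmod (taylor_coeff n c \<beta> \<gamma>)) \<le> sqrt (card (MI n d)) * (2 powr (real d / real k) * avg \<beta> powr (1/q))"
      by (simp add: mult_left_mono)
  qed
  also have "\<dots> = sqrt (card (MI n d)) * (2 powr (real d / real k) * (\<Sum>\<beta>\<in>MI n k. avg \<beta> powr (1/q)))"
    by (simp add: sum_distrib_left)
  also have "\<dots> \<le> sqrt (card (MI n d)) * (2 powr (real d / real k) * (real n powr ((real k - 1) / 2) * B))"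
  proof (intro mult_left_mono)
    have "(\<Sum>\<beta>\<in>MI n k. avg \<beta> powr (1/q)) \<le> real (card (MI n k)) powr (1 - 1/q) * (\<Sum>\<beta>\<in>MI n k. (avg \<beta> powr (1/q)) powr q) powr (1/q)"
      using q by (intro power_mean_sum) auto
    also have "(\<Sum>\<beta>\<in>MI n k. (avg \<beta> powr (1/q)) powr q) = (\<Sum>\<beta>\<in>MI n k. avg \<beta>)"
      using q avg0 by (simp add: powr_powr)
    also have "\<dots> = torus_avg n N (\<lambda>w. \<Sum>\<beta>\<in>MI n k. cmod (hpoly n d (taylor_coeff n c \<beta>) w) powr q)"
      by (simp add: torus_avg_sum avg_def)
    also have "real (card (MI n k)) powr (1 - 1/q) * torus_avg n N (\<lambda>w. \<Sum>\<beta>\<in>MI n k. cmod (hpoly n d (taylor_coeff n c \<beta>) w) powr q) powr (1/q)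
        \<le> (real n ^ k) powr (1 - 1/q) * (B powr q) powr (1/q)"
    proof (intro mult_mono powr_mono2 card_MI_le_power)
      have "torus_avg n N (\<lambda>w. \<Sum>\<beta>\<in>MI n k. cmod (hpoly n d (taylor_coeff n c \<beta>) w) powr q) \<le> torus_avg n N (\<lambda>_. B powr q)"
        unfolding B_def q_def by (intro torus_avg_mono polydisc_Bohnenblust_Hille hb n k)
      then show "torus_avg n N (\<lambda>w. \<Sum>\<beta>\<in>MI n k. cmod (hpoly n d (taylor_coeff n c \<beta>) w) powr q) \<le> B powr q"
        by (simp add: torus_avg_const N_def)
    qed (use q in \<open>auto intro!: torus_avg_nonneg sum_nonneg\<close>)
    also have "(real n ^ k) powr (1 - 1/q) = real n powr ((real k - 1) / 2)"
    proof -
      have e: "real k * (1 - 1/q) = (real k - 1) / 2" using k by (simp add: q_def field_simps)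
      have "(real n ^ k) powr (1 - 1/q) = real n powr (real k * (1 - 1/q))"
        using n by (simp add: powr_powr flip: powr_realpow)
      then show ?thesis unfolding e .
    qed
    also have "(B powr q) powr (1/q) = B" using q B0 by (simp add: powr_powr)
    finally show "(\<Sum>\<beta>\<in>MI n k. avg \<beta> powr (1/q)) \<le> real n powr ((real k - 1) / 2) * B" .
  qed auto
  finally show ?thesis by (simp add: B_def d_def mult_ac)
qed

section \<open>Monomial sums on balls with finite exponent\<close>

lemma power_powr_commute: "(x ^ k) powr p = (x powr p) ^ k" for x p :: real
  by (induction k) (auto simp: powr_mult)

text \<open>
  For fixed \<open>v\<close> in the ball, the derivative \<open>\<Sum>j. v j * \<partial>\<^sub>jP\<close> is a polynomial of degree \<open>d\<close> with norm at most
  \<open>e * (d + 1) * M\<close>. Cauchy's estimate for its coefficient at \<open>\<beta>\<close> is best at the point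
  \<open>w \<beta>\<close> of the unit sphere where \<open>\<bar>w\<^sup>\<beta>\<bar>\<close> is maximal, with coordinates \<open>(\<beta> k / d) powr (1/p)\<close>; there
  \<open>1 / \<bar>w\<^sup>\<beta>\<bar> powr p\<close> is at most \<open>e\<^sup>d\<close> times the multinomial coefficient of \<open>\<beta>\<close>. The
  multinomial theorem then sums the \<open>p\<close>-th powers, and Hoelder's inequality passes to first powers.
\<close>

theorem lp_monomial_sum:
  assumes h: "hom_bound n (ereal p) (Suc d) c M" and n: "0 < n" and p: "1 \<le> p"
    and z: "z \<in> Cn n" "lp_norm n (ereal p) z \<le> 1"
  shows "(\<Sum>\<alpha>\<in>MI n (Suc d). cmod (c \<alpha> * monomial n \<alpha> z))
     \<le> exp 1 * real (Suc d) * exp 1 ^ d * real (card (MI n d)) powr (1 - 1/p) * M"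
proof -
  have p': "1 \<le> ereal p" using p by simp
  have M0: "M \<ge> 0" using hom_bound_nonneg[OF h p' n] .
  \<comment> \<open>for \<open>d = 0\<close> the quotient is \<open>0\<close>, but then \<open>\<beta> = 0\<close> and the monomial is \<open>1\<close>\<close>
  define w where "w = (\<lambda>\<beta> k. if k < n then complex_of_real ((real (\<beta> k) / real d) powr (1/p)) else 0)"
  define r where "r = (\<lambda>\<beta>. cmod (monomial n \<beta> (w \<beta>)))"
  have wC: "w \<beta> \<in> Cn n" for \<beta> by (simp add: w_def Cn_def)
  have wN: "lp_norm n (ereal p) (w \<beta>) \<le> 1" if "\<beta> \<in> MI n d" for \<beta>
  proof -
    have "(\<Sum>k<n. cmod (w \<beta> k) powr p) = (\<Sum>k<n. real (\<beta> k) / real d)"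
      using p by (intro sum.cong) (auto simp: w_def powr_powr)
    also have "\<dots> = (\<Sum>k<n. real (\<beta> k)) / real d" by (simp add: sum_divide_distrib)
    also have "(\<Sum>k<n. real (\<beta> k)) = real d" using that by (simp add: MI_def flip: of_nat_sum)
    also have "real d / real d \<le> 1" by simp
    finally show ?thesis using p by (simp add: lp_norm_ereal sum_nonneg powr_le1)
  qed
  have coef: "(\<Sum>j<n. cmod (z j) * cmod (partial_coeff j c \<beta>)) * r \<beta> \<le> exp 1 * real (Suc d) * M"
    if b: "\<beta> \<in> MI n d" for \<beta>
  proof -
    obtain u where u: "u \<in> Cn n" "\<And>j. cmod (u j) \<le> cmod (z j)"
      "(\<Sum>j<n. u j * partial_coeff j c \<beta>) = of_real (\<Sum>j<n. cmod (z j) * cmod (partial_coeff j c \<beta>))"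
      using exists_phases[OF z(1), of "\<lambda>j. partial_coeff j c \<beta>"] by metis
    have uN: "lp_norm n (ereal p) u \<le> 1"
      using lp_norm_mono[OF p' n u(2)] z(2) by (meson order_trans)
    have "cmod ((\<Sum>j<n. u j * partial_coeff j c \<beta>) * monomial n \<beta> (w \<beta>)) \<le> exp 1 * real (Suc d) * M"
    proof (rule hpoly_coeff_bound[OF b])
      fix x assume x: "x \<in> Cn n" "\<And>k. k < n \<Longrightarrow> cmod (x k) = 1"
      have "lp_norm n (ereal p) (\<lambda>k. w \<beta> k * x k) = lp_norm n (ereal p) (w \<beta>)"
        using x by (intro lp_norm_cong) (simp add: norm_mult)
      then have "cmod (\<Sum>j<n. u j * hpoly n d (partial_coeff j c) (\<lambda>k. w \<beta> k * x k)) \<le> exp 1 * real (Suc d) * M"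
        using wN[OF b] wC[of \<beta>] uN x by (intro partial_derivatives_bound[OF h p' n _ u(1)]) (auto simp: Cn_def)
      moreover have "(\<Sum>j<n. u j * hpoly n d (partial_coeff j c) (\<lambda>k. w \<beta> k * x k)) = hpoly n d (\<lambda>\<beta>. \<Sum>j<n. u j * partial_coeff j c \<beta>) (\<lambda>k. w \<beta> k * x k)"
        unfolding hpoly_def sum_distrib_left sum_distrib_right by (subst sum.swap) (simp add: mult_ac)
      ultimately show "cmod (hpoly n d (\<lambda>\<beta>. \<Sum>j<n. u j * partial_coeff j c \<beta>) (\<lambda>k. w \<beta> k * x k)) \<le> exp 1 * real (Suc d) * M"
        by simp
    qed
    then show ?thesis unfolding norm_mult u(3) norm_of_real r_def by (simp add: sum_nonneg)
  qed
  have rp: "1 / r \<beta> powr p \<le> exp 1 ^ d * multinom n \<beta>" and r0: "r \<beta> > 0" if b: "\<beta> \<in> MI n d" for \<beta>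
  proof -
    have sb: "(\<Sum>k<n. \<beta> k) = d" using b by (simp add: MI_def)
    have r: "r \<beta> = (\<Prod>k<n. ((real (\<beta> k) / real d) powr (1/p)) ^ \<beta> k)"
      unfolding r_def monomial_def prod_norm[symmetric] norm_power
      by (intro prod.cong refl arg_cong2[where f = "(^)"]) (auto simp: w_def)
    have d0: "d > 0" if "k < n" "\<beta> k \<noteq> 0" for k using MI_le[OF b, of k] that by simp
    have pos: "((real (\<beta> k) / real d) powr (1/p)) ^ \<beta> k > 0" if "k < n" for k
      using d0[OF that] by (cases "\<beta> k = 0") auto
    show r0: "r \<beta> > 0" unfolding r using pos by (intro prod_pos) auto
    have "r \<beta> powr p = (\<Prod>k<n. (((real (\<beta> k) / real d) powr (1/p)) ^ \<beta> k) powr p)"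
      unfolding r by (rule prod_powr_distrib)
    also have "\<dots> = (\<Prod>k<n. (real (\<beta> k) / real d) ^ \<beta> k)"
    proof (rule prod.cong[OF refl])
      fix k assume "k \<in> {..<n}"
      show "(((real (\<beta> k) / real d) powr (1/p)) ^ \<beta> k) powr p = (real (\<beta> k) / real d) ^ \<beta> k"
      proof (cases "\<beta> k = 0")
        case False
        then have "real (\<beta> k) / real d > 0" using d0[of k] \<open>k \<in> {..<n}\<close> by auto
        then show ?thesis using p unfolding power_powr_commute by (simp add: powr_powr)
      qed simp
    qed
    also have "\<dots> = (\<Prod>k<n. real (\<beta> k) ^ \<beta> k) / real d ^ d"
      by (simp add: power_divide prod_dividef sb flip: power_sum)
    finally have rp: "r \<beta> powr p = (\<Prod>k<n. real (\<beta> k) ^ \<beta> k) / real d ^ d" .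
    have P0: "(\<Prod>k<n. real (\<beta> k) ^ \<beta> k) > 0"
      by (intro prod_pos) auto
    have "(\<Prod>k<n. fact (\<beta> k)) \<le> (\<Prod>k<n. real (\<beta> k) ^ \<beta> k)"
      using fact_le_power[where 'a = real] by (intro prod_mono) auto
    moreover have "real d ^ d \<le> exp 1 ^ d * fact d"
    proof -
      have sm: "summable (\<lambda>i. real d ^ i /\<^sub>R fact i)" and ex: "(\<Sum>i. real d ^ i /\<^sub>R fact i) = exp (real d)"
        using exp_converges[of "real d"] by (auto simp: sums_iff)
      have "(\<Sum>i\<in>{d}. real d ^ i /\<^sub>R fact i) \<le> (\<Sum>i. real d ^ i /\<^sub>R fact i)"
        by (rule sum_le_suminf[OF sm]) auto
      also note ex
      finally have "real d ^ d \<le> exp (real d) * fact d" by (simp add: field_simps)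
      then show ?thesis by (simp add: exp_of_nat_mult[of d 1, simplified])
    qed
    ultimately have "real d ^ d / (\<Prod>k<n. real (\<beta> k) ^ \<beta> k) \<le> exp 1 ^ d * fact d / (\<Prod>k<n. fact (\<beta> k))"
      by (intro frac_le) (auto intro: prod_pos)
    then show "1 / r \<beta> powr p \<le> exp 1 ^ d * multinom n \<beta>"
      by (simp add: rp multinom_def sb)
  qed
  have "(\<Sum>\<alpha>\<in>MI n (Suc d). cmod (c \<alpha> * monomial n \<alpha> z))
      \<le> (\<Sum>x\<in>MI n d \<times> {..<n}. cmod (monomial n (fst x) z) * (cmod (z (snd x)) * cmod (partial_coeff (snd x) c (fst x))))"
  proof (rule sum_le_sum_pairs[where s = "\<lambda>x. (fst x)(snd x := Suc (fst x (snd x)))"])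
    fix \<alpha> assume a: "\<alpha> \<in> MI n (Suc d)"
    then obtain j where j: "j < n" "\<alpha> j \<noteq> 0" by (rule MI_Suc_nonzero)
    then show "\<exists>x\<in>MI n d \<times> {..<n}. (fst x)(snd x := Suc (fst x (snd x))) = \<alpha>"
      using minus_coord_MI[OF a j(2)] by (intro bexI[of _ "(\<alpha>(j := \<alpha> j - 1), j)"]) auto
  next
    fix x assume x: "x \<in> MI n d \<times> {..<n}"
    obtain \<gamma> j where xj: "x = (\<gamma>, j)" "j < n" using x by auto
    have "monomial n (\<gamma>(j := Suc (\<gamma> j))) z = (\<Prod>k<n. z k ^ \<gamma> k * (if k = j then z j else 1))"
      unfolding monomial_def by (intro prod.cong) auto
    also have "\<dots> = monomial n \<gamma> z * z j" using xj by (simp add: prod.distrib monomial_def)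
    finally have "cmod (c (\<gamma>(j := Suc (\<gamma> j))) * monomial n (\<gamma>(j := Suc (\<gamma> j))) z)
        = cmod (c (\<gamma>(j := Suc (\<gamma> j)))) * (cmod (monomial n \<gamma> z) * cmod (z j))"
      by (simp add: norm_mult)
    also have "\<dots> \<le> cmod (partial_coeff j c \<gamma>) * (cmod (monomial n \<gamma> z) * cmod (z j))"
      by (intro mult_right_mono cmod_partial_coeff_ge) auto
    finally show "cmod (c ((fst x)(snd x := Suc (fst x (snd x)))) * monomial n ((fst x)(snd x := Suc (fst x (snd x)))) z)
        \<le> cmod (monomial n (fst x) z) * (cmod (z (snd x)) * cmod (partial_coeff (snd x) c (fst x)))"
      by (simp add: xj mult_ac)
  qed (auto simp: finite_MI Suc_coord_MI)
  also have "\<dots> = (\<Sum>\<beta>\<in>MI n d. cmod (monomial n \<beta> z) * (\<Sum>j<n. cmod (z j) * cmod (partial_coeff j c \<beta>)))"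
    by (simp add: sum.cartesian_product sum_distrib_left case_prod_beta)
  also have "\<dots> \<le> (\<Sum>\<beta>\<in>MI n d. cmod (monomial n \<beta> z) * (exp 1 * real (Suc d) * M / r \<beta>))"
    using coef r0 by (intro sum_mono mult_left_mono) (simp_all only: pos_le_divide_eq norm_ge_zero)
  also have "\<dots> = exp 1 * real (Suc d) * M * (\<Sum>\<beta>\<in>MI n d. cmod (monomial n \<beta> z) / r \<beta>)"
    by (simp add: sum_distrib_left mult_ac)
  also have "\<dots> \<le> exp 1 * real (Suc d) * M * (real (card (MI n d)) powr (1 - 1/p) * exp 1 ^ d)"
  proof (intro mult_left_mono)
    have "(\<Sum>\<beta>\<in>MI n d. cmod (monomial n \<beta> z) / r \<beta>)
       \<le> real (card (MI n d)) powr (1 - 1/p) * (\<Sum>\<beta>\<in>MI n d. (cmod (monomial n \<beta> z) / r \<beta>) powr p) powr (1/p)"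
      using p by (intro power_mean_sum) (auto simp: r_def)
    also have "\<dots> \<le> real (card (MI n d)) powr (1 - 1/p) * (exp 1 ^ d) powr (1/p)"
    proof (intro mult_left_mono powr_mono2)
      have "(\<Sum>\<beta>\<in>MI n d. (cmod (monomial n \<beta> z) / r \<beta>) powr p)
          \<le> (\<Sum>\<beta>\<in>MI n d. exp 1 ^ d * (multinom n \<beta> * (\<Prod>k<n. (cmod (z k) powr p) ^ \<beta> k)))"
      proof (rule sum_mono)
        fix \<beta> assume b: "\<beta> \<in> MI n d"
        have "cmod (monomial n \<beta> z) powr p = (\<Prod>k<n. (cmod (z k) ^ \<beta> k) powr p)"
          unfolding monomial_def prod_norm[symmetric] norm_power by (rule prod_powr_distrib)
        also have "\<dots> = (\<Prod>k<n. (cmod (z k) powr p) ^ \<beta> k)"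
          by (simp add: power_powr_commute)
        finally have e: "cmod (monomial n \<beta> z) powr p = (\<Prod>k<n. (cmod (z k) powr p) ^ \<beta> k)" .
        have "(cmod (monomial n \<beta> z) / r \<beta>) powr p = cmod (monomial n \<beta> z) powr p * (1 / r \<beta> powr p)"
          by (simp add: powr_divide r_def)
        also have "\<dots> \<le> cmod (monomial n \<beta> z) powr p * (exp 1 ^ d * multinom n \<beta>)"
          using rp[OF b] by (intro mult_left_mono) auto
        finally show "(cmod (monomial n \<beta> z) / r \<beta>) powr p \<le> exp 1 ^ d * (multinom n \<beta> * (\<Prod>k<n. (cmod (z k) powr p) ^ \<beta> k))"
          by (simp add: e mult_ac)
      qed
      also have "\<dots> = exp 1 ^ d * (\<Sum>k<n. cmod (z k) powr p) ^ d"
        by (simp add: multinomial_theorem flip: sum_distrib_left)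
      also have "\<dots> \<le> exp 1 ^ d * 1"
        using z(2) p lp_norm_nonneg[OF p' n, of z]
        by (intro mult_left_mono power_le_one) (auto simp: lp_norm_powr[symmetric] powr_le1 sum_nonneg)
      finally show "(\<Sum>\<beta>\<in>MI n d. (cmod (monomial n \<beta> z) / r \<beta>) powr p) \<le> exp 1 ^ d" by simp
    qed (use p in \<open>auto intro: sum_nonneg\<close>)
    also have "(exp 1 ^ d) powr (1/p) \<le> (exp 1 ^ d :: real)"
      using p powr_mono[of "1/p" 1 "exp 1 ^ d :: real"] by (simp add: one_le_power)
    finally show "(\<Sum>\<beta>\<in>MI n d. cmod (monomial n \<beta> z) / r \<beta>) \<le> real (card (MI n d)) powr (1 - 1/p) * exp 1 ^ d"
      by (simp add: mult_left_mono)
  qed (use M0 in auto)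
  finally show ?thesis by (simp add: mult_ac)
qed

section \<open>From homogeneous polynomials to the Bohr property\<close>

text \<open>
  For \<open>m \<ge> 1\<close> the coefficient \<open>h m\<close> is \<open>-2\<close> times the corresponding Fourier coefficient of the nonnegative function
  \<open>C - Re G\<close> on the circle, hence in modulus at most twice its mean \<open>C - Re (h 0)\<close>.
\<close>

lemma Caratheodory_polynomial:
  fixes h :: "nat \<Rightarrow> complex"
  assumes re: "\<And>l. cmod l = 1 \<Longrightarrow> Re (\<Sum>k\<le>K. l ^ k * h k) \<le> C" and m: "0 < m" "m \<le> K"
  shows "cmod (h m) \<le> 2 * (C - Re (h 0))"
proof -
  \<comment> \<open>an order exceeding \<open>2 * K\<close> also separates the frequencies of \<open>G\<close> from those of \<open>cnj G\<close>\<close>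
  define N where "N = Suc (2 * K)"
  have N: "N > 0" by (simp add: N_def)
  define e where "e = unity_root N"
  define G where "G = (\<lambda>i. \<Sum>k\<le>K. e i ^ k * h k)"
  have e1: "cmod (e i) = 1" for i by (simp add: e_def)
  have se: "(\<Sum>i<N. e i ^ k * cnj (e i ^ j)) = (if k = j then of_nat N else 0)" if "k \<le> K" "j \<le> K" for k j
    unfolding e_def using that by (intro roots_of_unity_orthogonal) (auto simp: N_def)
  have sm: "(\<Sum>i<N. cnj (e i ^ k) * cnj (e i ^ m)) = 0" if "k \<le> K" for k
  proof -
    have "(\<Sum>i<N. e i ^ (k + m) * cnj (e i ^ 0)) = 0"
      unfolding e_def using that m by (subst roots_of_unity_orthogonal) (auto simp: N_def)
    then have "cnj (\<Sum>i<N. e i ^ k * e i ^ m) = 0" by (simp add: power_add)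
    then show ?thesis by simp
  qed
  have G1: "(\<Sum>i<N. G i * cnj (e i ^ j)) = of_nat N * h j" if "j \<le> K" for j
  proof -
    have "(\<Sum>i<N. G i * cnj (e i ^ j)) = (\<Sum>k\<le>K. h k * (\<Sum>i<N. e i ^ k * cnj (e i ^ j)))"
      unfolding G_def sum_distrib_right sum_distrib_left by (subst sum.swap) (simp add: mult_ac)
    also have "\<dots> = (\<Sum>k\<le>K. h k * (if k = j then of_nat N else 0))"
      using that by (intro sum.cong refl arg_cong2[where f = "(*)"] se) auto
    finally show ?thesis using that by (simp add: if_distrib[where f = "\<lambda>x. _ * x"] cong: if_cong)
  qed
  have G2: "(\<Sum>i<N. cnj (G i) * cnj (e i ^ m)) = 0"
  proof -
    have "(\<Sum>i<N. cnj (G i) * cnj (e i ^ m)) = (\<Sum>k\<le>K. cnj (h k) * (\<Sum>i<N. cnj (e i ^ k) * cnj (e i ^ m)))"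
      unfolding G_def cnj_sum complex_cnj_mult sum_distrib_right sum_distrib_left by (subst sum.swap) (simp add: mult_ac)
    then show ?thesis using sm by simp
  qed
  have G0: "(\<Sum>i<N. G i) = of_nat N * h 0" using G1[of 0] by simp
  have c0: "(\<Sum>i<N. cnj (e i ^ m)) = 0" using sm[of 0] by simp
  have "(\<Sum>i<N. of_real (C - Re (G i)) * cnj (e i ^ m))
      = of_real C * (\<Sum>i<N. cnj (e i ^ m)) - ((\<Sum>i<N. G i * cnj (e i ^ m)) + (\<Sum>i<N. cnj (G i) * cnj (e i ^ m))) / 2"
  proof -
    have "of_real (C - Re (G i)) * cnj (e i ^ m)
        = of_real C * cnj (e i ^ m) - (G i * cnj (e i ^ m) + cnj (G i) * cnj (e i ^ m)) / 2" for i
    proof -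
      have "of_real (C - Re (G i)) = of_real C - (G i + cnj (G i)) / 2"
        by (simp add: complex_add_cnj)
      then show ?thesis by (simp only: left_diff_distrib distrib_right times_divide_eq_left)
    qed
    then show ?thesis
      by (simp only: sum_distrib_left sum_subtractf sum.distrib[symmetric] sum_divide_distrib)
  qed
  also have "\<dots> = - (of_nat N * h m) / 2" using c0 G1[OF m(2)] G2 by simp
  finally have "real N * cmod (h m) / 2 = cmod (\<Sum>i<N. of_real (C - Re (G i)) * cnj (e i ^ m))"
    by (simp add: norm_divide norm_mult)
  also have "\<dots> \<le> (\<Sum>i<N. C - Re (G i))"
  proof (rule sum_norm_le)
    fix i
    have "Re (G i) \<le> C" unfolding G_def by (rule re[OF e1])
    then show "cmod (of_real (C - Re (G i)) * cnj (e i ^ m)) \<le> C - Re (G i)"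
      by (simp add: norm_mult norm_power e1 del: of_real_diff)
  qed
  also have "\<dots> = real N * (C - Re (h 0))"
    using arg_cong[OF G0, of Re] by (simp add: sum_subtractf algebra_simps)
  finally have "real N * cmod (h m) \<le> real N * (2 * (C - Re (h 0)))" by (simp add: algebra_simps)
  then show ?thesis using N by (subst (asm) mult_le_cancel_left_pos) auto
qed

lemma monomial_0: "monomial n (\<lambda>_. 0) z = 1"
  by (simp add: monomial_def)

lemma hpoly_0: "hpoly n 0 c z = c (\<lambda>_. 0)"
  by (simp add: hpoly_def MI_0 monomial_0)

lemma disjoint_MI: "d \<noteq> e \<Longrightarrow> MI n d \<inter> MI n e = {}"
  by (auto simp: MI_def)

lemma finite_multi_indices_degree:
  assumes "finite S" "S \<subseteq> multi_indices n"
  obtains K where "S \<subseteq> (\<Union>m\<le>K. MI n m)"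
proof
  show "S \<subseteq> (\<Union>m\<le>Max (insert 0 ((\<lambda>\<alpha>. \<Sum>k<n. \<alpha> k) ` S)). MI n m)"
  proof
    fix \<alpha> assume a: "\<alpha> \<in> S"
    then have "(\<Sum>k<n. \<alpha> k) \<le> Max (insert 0 ((\<lambda>\<alpha>. \<Sum>k<n. \<alpha> k) ` S))" using assms by (intro Max_ge) auto
    moreover have "\<alpha> \<in> MI n (\<Sum>k<n. \<alpha> k)" using a assms by (auto simp: MI_def)
    ultimately show "\<alpha> \<in> (\<Union>m\<le>Max (insert 0 ((\<lambda>\<alpha>. \<Sum>k<n. \<alpha> k) ` S)). MI n m)" by blast
  qed
qed

lemma sum_degree_union: "(\<Sum>\<alpha>\<in>(\<Union>m\<le>K. MI n m). F \<alpha>) = (\<Sum>m\<le>K. \<Sum>\<alpha>\<in>MI n m. F \<alpha>)"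
  by (rule sum.UNION_disjoint) (use finite_MI disjoint_MI in auto)

text \<open>
  On the complex line through \<open>z\<close>, the homogeneous parts are the Taylor coefficients of a function with real part at
  most 1. Absolute convergence at \<open>z\<close> makes the error of truncation at a degree \<open>K\<close> uniformly small on the circle, so
  the polynomial case applies with \<open>C = 1 + \<epsilon>/2\<close>.
\<close>

lemma homogeneous_part_bound:
  fixes c :: "(nat \<Rightarrow> nat) \<Rightarrow> complex"
  assumes p: "1 \<le> p" "0 < n"
    and sm: "\<And>z. z \<in> lp_ball n p 1 \<Longrightarrow> (\<lambda>\<alpha>. c \<alpha> * monomial n \<alpha> z) summable_on multi_indices n"
    and re: "\<And>z. z \<in> lp_ball n p 1 \<Longrightarrow> Re (\<Sum>\<^sub>\<infinity>\<alpha>\<in>multi_indices n. c \<alpha> * monomial n \<alpha> z) \<le> 1"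
    and m: "0 < m"
  shows "hom_bound n p m c (2 * (1 - Re (c (\<lambda>_. 0))))"
proof (rule hom_bound_from_ball[OF p])
  fix z assume z: "z \<in> lp_ball n p 1"
  define A where "A = (\<lambda>\<alpha>. cmod (c \<alpha> * monomial n \<alpha> z))"
  have As: "A summable_on multi_indices n"
    using sm[OF z] unfolding A_def by (simp add: summable_on_iff_abs_summable_on_complex)
  show "cmod (hpoly n m c z) \<le> 2 * (1 - Re (c (\<lambda>_. 0)))"
  proof (rule field_le_epsilon)
    fix \<epsilon> :: real assume eps: "\<epsilon> > 0"
    have "(A has_sum infsum A (multi_indices n)) (multi_indices n)" using As by simp
    then have "\<forall>\<^sub>F S in finite_subsets_at_top (multi_indices n). dist (sum A S) (infsum A (multi_indices n)) < \<epsilon> / 2"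
      unfolding has_sum_def using eps by (intro tendstoD) auto
    then obtain S where S: "finite S" "S \<subseteq> multi_indices n"
      "\<And>T. finite T \<Longrightarrow> S \<subseteq> T \<Longrightarrow> T \<subseteq> multi_indices n \<Longrightarrow> dist (sum A T) (infsum A (multi_indices n)) < \<epsilon> / 2"
      unfolding eventually_finite_subsets_at_top by metis
    obtain K0 where K0: "S \<subseteq> (\<Union>m\<le>K0. MI n m)" using finite_multi_indices_degree[OF S(1,2)] .
    define K where "K = max K0 m"
    define T where "T = (\<Union>m\<le>K. MI n m)"
    have T: "finite T" "S \<subseteq> T" "T \<subseteq> multi_indices n"
      using K0 by (force simp: T_def finite_MI K_def, force simp: T_def K_def, force simp: T_def MI_def)
    define R where "R = multi_indices n - T"
    have RU: "multi_indices n = T \<union> R" "T \<inter> R = {}" using T by (auto simp: R_def)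
    have AR: "A summable_on R" by (rule summable_on_subset_banach[OF As]) (auto simp: R_def)
    have "infsum A (multi_indices n) = sum A T + infsum A R"
      unfolding RU(1) using T AR RU(2) by (subst infsum_Un_disjoint) auto
    then have tail: "infsum A R < \<epsilon> / 2" using S(3)[OF T] by (auto simp: dist_real_def)
    have "cmod (hpoly n m c z) \<le> 2 * ((1 + \<epsilon> / 2) - Re (hpoly n 0 c z))"
    proof (rule Caratheodory_polynomial)
      fix l :: complex assume l: "cmod l = 1"
      define w where "w = (\<lambda>k. l * z k)"
      have w: "w \<in> lp_ball n p 1" using z by (simp add: w_def lp_ball_def lp_norm_scale[OF p] l Cn_def)
      define B where "B = (\<lambda>\<alpha>. c \<alpha> * monomial n \<alpha> w)"
      have BA: "cmod (B \<alpha>) = A \<alpha>" for \<alpha>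
        by (simp add: B_def A_def w_def monomial_mult norm_mult) (simp add: monomial_def prod_norm[symmetric] norm_power l)
      have Bs: "B summable_on multi_indices n" using sm[OF w] by (simp add: B_def)
      have BR: "B summable_on R" by (rule summable_on_subset_banach[OF Bs]) (auto simp: R_def)
      have "infsum B (multi_indices n) = sum B T + infsum B R"
        unfolding RU(1) using T BR RU(2) by (subst infsum_Un_disjoint) auto
      moreover have "sum B T = (\<Sum>k\<le>K. l ^ k * hpoly n k c z)"
        unfolding T_def sum_degree_union B_def w_def hpoly_scale[symmetric] by (simp add: hpoly_def)
      moreover have "cmod (infsum B R) \<le> infsum A R"
        using norm_infsum_bound[of B R] AR by (simp add: BA)
      then have "- Re (infsum B R) \<le> \<epsilon> / 2" using tail abs_Re_le_cmod[of "infsum B R"] by linarith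
      moreover have "Re (infsum B (multi_indices n)) \<le> 1" using re[OF w] by (simp add: B_def)
      ultimately show "Re (\<Sum>k\<le>K. l ^ k * hpoly n k c z) \<le> 1 + \<epsilon> / 2" by simp
    qed (use m in \<open>auto simp: K_def\<close>)
    then show "cmod (hpoly n m c z) \<le> 2 * (1 - Re (c (\<lambda>_. 0))) + \<epsilon>" by (simp add: hpoly_0)
  qed
qed

lemma zero_in_ball: "1 \<le> p \<Longrightarrow> 0 < n \<Longrightarrow> 0 < r \<Longrightarrow> (\<lambda>_. 0) \<in> lp_ball n p r"
  by (simp add: lp_ball_def Cn_def lp_norm_zero)

lemma lp_ball_empty: "1 \<le> p \<Longrightarrow> 0 < n \<Longrightarrow> r \<le> 0 \<Longrightarrow> lp_ball n p r = {}"
proof -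
  assume a: "1 \<le> p" "0 < n" "r \<le> 0"
  have "\<not> lp_norm n p z < r" for z using lp_norm_nonneg[OF a(1,2), of z] a(3) by linarith
  then show ?thesis by (auto simp: lp_ball_def)
qed

text \<open>
  The coefficients \<open>c = a + b\<close> belong to a holomorphic function with the same real part as \<open>f\<close>. With \<open>t = c 0\<close>, each
  homogeneous part contributes at most \<open>\<kappa> m * \<rho> ^ m * 2 * (1 - t)\<close> on the ball of radius \<open>\<rho>\<close>, in total at most
  \<open>1 - t\<close>.
\<close>

theorem bohr_property_from_homogeneous:
  assumes p: "1 \<le> p" "0 < n" and rho: "0 < \<rho>" "\<rho> \<le> 1"
    and hom: "\<And>m c M z. 0 < m \<Longrightarrow> hom_bound n p m c M \<Longrightarrow> z \<in> Cn n \<Longrightarrow> lp_norm n p z \<le> 1 \<Longrightarrow>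
      (\<Sum>\<alpha>\<in>MI n m. cmod (c \<alpha> * monomial n \<alpha> z)) \<le> \<kappa> m * M"
    and small: "\<And>K. (\<Sum>m\<in>{1..K}. \<kappa> m * \<rho> ^ m) \<le> 1 / 2"
  shows "bohr_property n p \<rho>"
  unfolding bohr_property_def
proof (intro allI impI ballI)
  fix f a b z
  assume asm: "f \<in> PH_plus n p \<and> has_pluriharmonic_expansion n p f a b \<and> b (\<lambda>_. 0) = 0"
    and z: "z \<in> lp_ball n p \<rho>"
  define c where "c = (\<lambda>\<alpha>. a \<alpha> + b \<alpha>)"
  define I where "I = multi_indices n"
  have ex: "(\<lambda>\<alpha>. a \<alpha> * monomial n \<alpha> w) summable_on I"
      "(\<lambda>\<alpha>. cnj (b \<alpha>) * monomial n \<alpha> (\<lambda>k. cnj (w k))) summable_on I"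
      "f w = (\<Sum>\<^sub>\<infinity>\<alpha>\<in>I. a \<alpha> * monomial n \<alpha> w) + (\<Sum>\<^sub>\<infinity>\<alpha>\<in>I. cnj (b \<alpha>) * monomial n \<alpha> (\<lambda>k. cnj (w k)))"
    if "w \<in> lp_ball n p 1" for w
    using asm that unfolding has_pluriharmonic_expansion_def I_def by blast+
  have cb: "cnj (b \<alpha>) * monomial n \<alpha> (\<lambda>k. cnj (w k)) = cnj (b \<alpha> * monomial n \<alpha> w)" for \<alpha> w
    by (simp add: monomial_def)
  have bs: "(\<lambda>\<alpha>. b \<alpha> * monomial n \<alpha> w) summable_on I" if "w \<in> lp_ball n p 1" for w
    using ex(2)[OF that] unfolding cb summable_on_cnj_iff .
  have cs: "(\<lambda>\<alpha>. c \<alpha> * monomial n \<alpha> w) summable_on I" if "w \<in> lp_ball n p 1" for w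
    using summable_on_add[OF ex(1)[OF that] bs[OF that]] by (simp add: c_def distrib_right)
  have csum: "Re (\<Sum>\<^sub>\<infinity>\<alpha>\<in>I. c \<alpha> * monomial n \<alpha> w) = Re (f w)" if "w \<in> lp_ball n p 1" for w
  proof -
    have "(\<Sum>\<^sub>\<infinity>\<alpha>\<in>I. c \<alpha> * monomial n \<alpha> w) = (\<Sum>\<^sub>\<infinity>\<alpha>\<in>I. a \<alpha> * monomial n \<alpha> w) + (\<Sum>\<^sub>\<infinity>\<alpha>\<in>I. b \<alpha> * monomial n \<alpha> w)"
      using infsum_add[OF ex(1)[OF that] bs[OF that]] by (simp add: c_def distrib_right)
    moreover have "f w = (\<Sum>\<^sub>\<infinity>\<alpha>\<in>I. a \<alpha> * monomial n \<alpha> w) + cnj (\<Sum>\<^sub>\<infinity>\<alpha>\<in>I. b \<alpha> * monomial n \<alpha> w)"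
      using ex(3)[OF that] unfolding cb infsum_cnj .
    ultimately show ?thesis by simp
  qed
  have re1: "Re (f w) \<le> 1" if "w \<in> lp_ball n p 1" for w
  proof -
    have "(SUP z \<in> lp_ball n p 1. ereal (Re (f z))) \<le> 1" using asm by (simp add: PH_plus_def)
    then have "ereal (Re (f w)) \<le> 1" using that by (auto simp: SUP_le_iff)
    then show ?thesis by simp
  qed
  have z0: "(\<lambda>_. 0) \<in> lp_ball n p 1" using p by (intro zero_in_ball) auto
  have c0: "c (\<lambda>_. 0) = f (\<lambda>_. 0)"
  proof -
    have m0: "monomial n \<alpha> (\<lambda>_. 0) = 0" if "\<alpha> \<in> I - {\<lambda>_. 0}" for \<alpha>
    proof -
      have "\<exists>k<n. \<alpha> k \<noteq> 0"
      proof (rule ccontr)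
        assume "\<not> ?thesis"
        then have "\<alpha> = (\<lambda>_. 0)" using that by (auto simp: I_def multi_indices_def fun_eq_iff) (metis not_le)
        then show False using that by simp
      qed
      then show ?thesis by (auto simp: monomial_def)
    qed
    have "(\<Sum>\<^sub>\<infinity>\<alpha>\<in>I. a \<alpha> * monomial n \<alpha> (\<lambda>_. 0)) = (\<Sum>\<^sub>\<infinity>\<alpha>\<in>{\<lambda>_. 0}. a \<alpha> * monomial n \<alpha> (\<lambda>_. 0))"
      using m0 by (intro infsum_cong_neutral) (auto simp: I_def multi_indices_def)
    moreover have "(\<Sum>\<^sub>\<infinity>\<alpha>\<in>I. cnj (b \<alpha>) * monomial n \<alpha> (\<lambda>k. cnj 0)) = (\<Sum>\<^sub>\<infinity>\<alpha>\<in>{\<lambda>_. 0}. cnj (b \<alpha>) * monomial n \<alpha> (\<lambda>_. 0))"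
      using m0 by (intro infsum_cong_neutral) (auto simp: I_def multi_indices_def)
    ultimately show ?thesis using ex(3)[OF z0] asm by (simp add: c_def monomial_0)
  qed
  define t where "t = Re (c (\<lambda>_. 0))"
  have ct: "c (\<lambda>_. 0) = of_real t" "t \<ge> 0"
  proof -
    have "f (\<lambda>_. 0) \<in> \<real>\<^sub>\<ge>\<^sub>0" using asm by (simp add: PH_plus_def)
    then show "c (\<lambda>_. 0) = of_real t" "t \<ge> 0" unfolding c0 t_def
      by (auto simp: nonneg_Reals_def)
  qed
  have t1: "t \<le> 1" using re1[OF z0] by (simp add: t_def c0)
  have hb: "hom_bound n p m c (2 * (1 - t))" if "0 < m" for m
    unfolding t_def using cs csum re1 that by (intro homogeneous_part_bound[OF p]) (auto simp: I_def)
  define z' where "z' = (\<lambda>k. complex_of_real (1 / \<rho>) * z k)"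
  have zC: "z \<in> Cn n" and zN: "lp_norm n p z < \<rho>" using z by (auto simp: lp_ball_def)
  have z'C: "z' \<in> Cn n" unfolding z'_def by (rule Cn_scale[OF zC])
  have z'N: "lp_norm n p z' \<le> 1"
    unfolding z'_def lp_norm_scale[OF p] using rho zN by (simp add: norm_divide field_simps)
  have zz': "z = (\<lambda>k. of_real \<rho> * z' k)" using rho by (simp add: z'_def)
  have tm: "(\<Sum>\<alpha>\<in>MI n m. cmod (c \<alpha> * monomial n \<alpha> z)) \<le> \<kappa> m * \<rho> ^ m * (2 * (1 - t))" if m: "0 < m" for m
  proof -
    have "(\<Sum>\<alpha>\<in>MI n m. cmod (c \<alpha> * monomial n \<alpha> z)) = \<rho> ^ m * (\<Sum>\<alpha>\<in>MI n m. cmod (c \<alpha> * monomial n \<alpha> z'))"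
      unfolding sum_distrib_left
    proof (rule sum.cong[OF refl])
      fix \<alpha> assume "\<alpha> \<in> MI n m"
      then have "monomial n \<alpha> z = of_real \<rho> ^ m * monomial n \<alpha> z'"
        by (subst zz') (rule monomial_scale)
      then show "cmod (c \<alpha> * monomial n \<alpha> z) = \<rho> ^ m * cmod (c \<alpha> * monomial n \<alpha> z')"
        using rho by (simp add: norm_mult norm_power)
    qed
    also have "\<dots> \<le> \<rho> ^ m * (\<kappa> m * (2 * (1 - t)))"
      using rho by (intro mult_left_mono hom[OF m hb[OF m] z'C z'N]) auto
    finally show ?thesis by (simp add: mult_ac)
  qed
  have fin: "(\<Sum>\<alpha>\<in>S. cmod (c \<alpha> * monomial n \<alpha> z)) \<le> 1" if S: "finite S" "S \<subseteq> I" for S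
  proof -
    obtain K where K: "S \<subseteq> (\<Union>m\<le>K. MI n m)"
      using finite_multi_indices_degree S unfolding I_def by metis
    have "(\<Sum>\<alpha>\<in>S. cmod (c \<alpha> * monomial n \<alpha> z)) \<le> (\<Sum>\<alpha>\<in>(\<Union>m\<le>K. MI n m). cmod (c \<alpha> * monomial n \<alpha> z))"
      using K by (intro sum_mono2) (auto simp: finite_MI)
    also have "\<dots> = (\<Sum>m\<le>K. \<Sum>\<alpha>\<in>MI n m. cmod (c \<alpha> * monomial n \<alpha> z))"
      by (rule sum_degree_union)
    also have "\<dots> = (\<Sum>\<alpha>\<in>MI n 0. cmod (c \<alpha> * monomial n \<alpha> z)) + (\<Sum>m\<in>{1..K}. \<Sum>\<alpha>\<in>MI n m. cmod (c \<alpha> * monomial n \<alpha> z))"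
    proof -
      have "{..K} = insert 0 {1..K}" by auto
      then show ?thesis by simp
    qed
    also have "(\<Sum>\<alpha>\<in>MI n 0. cmod (c \<alpha> * monomial n \<alpha> z)) = t"
      using ct by (simp add: MI_0 monomial_0)
    also have "(\<Sum>m\<in>{1..K}. \<Sum>\<alpha>\<in>MI n m. cmod (c \<alpha> * monomial n \<alpha> z)) \<le> (\<Sum>m\<in>{1..K}. \<kappa> m * \<rho> ^ m * (2 * (1 - t)))"
      by (intro sum_mono tm) auto
    also have "\<dots> = (\<Sum>m\<in>{1..K}. \<kappa> m * \<rho> ^ m) * (2 * (1 - t))" by (simp add: sum_distrib_right)
    also have "\<dots> \<le> 1 / 2 * (2 * (1 - t))" using small t1 by (intro mult_right_mono) auto
    also have "t + 1 / 2 * (2 * (1 - t)) = 1" by (simp add: field_simps)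
    finally show ?thesis by simp
  qed
  have "(\<lambda>\<alpha>. cmod (c \<alpha> * monomial n \<alpha> z)) summable_on I"
    using fin by (intro nonneg_bdd_above_summable_on bdd_aboveI2[where M = 1]) auto
  moreover from this have "(\<Sum>\<^sub>\<infinity>\<alpha>\<in>I. cmod (c \<alpha> * monomial n \<alpha> z)) \<le> 1"
    using fin by (intro infsum_le_finite_sums) auto
  ultimately show "(\<lambda>\<alpha>. cmod ((a \<alpha> + b \<alpha>) * monomial n \<alpha> z)) summable_on multi_indices n \<and>
      (\<Sum>\<^sub>\<infinity>\<alpha>\<in>multi_indices n. cmod ((a \<alpha> + b \<alpha>) * monomial n \<alpha> z)) \<le> 1"
    by (simp add: c_def I_def)
qed

section \<open>Polynomials as test functions\<close>

text \<open>
  Closure under the ring operations makes all regularity properties of polynomials short inductions.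
\<close>

inductive coord_poly :: "nat \<Rightarrow> ((nat \<Rightarrow> complex) \<Rightarrow> complex) \<Rightarrow> bool" for n where
  const: "coord_poly n (\<lambda>_. c)"
| coord: "k < n \<Longrightarrow> coord_poly n (\<lambda>z. z k)"
| add: "coord_poly n f \<Longrightarrow> coord_poly n g \<Longrightarrow> coord_poly n (\<lambda>z. f z + g z)"
| mult: "coord_poly n f \<Longrightarrow> coord_poly n g \<Longrightarrow> coord_poly n (\<lambda>z. f z * g z)"

lemma coord_poly_sum: "finite A \<Longrightarrow> (\<And>a. a \<in> A \<Longrightarrow> coord_poly n (f a)) \<Longrightarrow> coord_poly n (\<lambda>z. \<Sum>a\<in>A. f a z)"
  by (induction A rule: finite_induct) (auto intro: coord_poly.intros)

lemma coord_poly_prod: "finite A \<Longrightarrow> (\<And>a. a \<in> A \<Longrightarrow> coord_poly n (f a)) \<Longrightarrow> coord_poly n (\<lambda>z. \<Prod>a\<in>A. f a z)"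
  by (induction A rule: finite_induct) (auto intro: coord_poly.intros)

lemma coord_poly_power: "coord_poly n f \<Longrightarrow> coord_poly n (\<lambda>z. f z ^ m)"
  by (induction m) (auto intro: coord_poly.intros)

lemma coord_poly_monomial: "coord_poly n (\<lambda>z. c * monomial n \<alpha> z)"
  unfolding monomial_def by (intro coord_poly.intros coord_poly_prod coord_poly_power) auto

lemma coord_poly_continuous: "coord_poly n f \<Longrightarrow> continuous_on \<Omega> f"
proof (induction rule: coord_poly.induct)
  case (coord k)
  show ?case
    by (rule continuous_on_subset[OF continuous_on_product_coordinates]) auto
qed (auto intro: continuous_intros)

lemma coord_poly_directional_derivative:
  assumes "coord_poly n f"
  shows "\<exists>g. coord_poly n g \<and> (\<forall>z. ((\<lambda>t. f (z(k := z k + d * of_real t))) has_vector_derivative g z) (at 0))"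
  using assms
proof (induction rule: coord_poly.induct)
  case (const c)
  show ?case by (intro exI[of _ "\<lambda>_. 0"] conjI coord_poly.intros allI) simp
next
  case (coord j)
  show ?case
  proof (intro exI[of _ "\<lambda>_. if j = k then d else 0"] conjI coord_poly.intros allI)
    fix z :: "nat \<Rightarrow> complex"
    have "((\<lambda>t. z k + d * of_real t) has_vector_derivative d) (at 0)"
      by (auto intro!: derivative_eq_intros)
    then show "((\<lambda>t. (z(k := z k + d * of_real t)) j) has_vector_derivative (if j = k then d else 0)) (at 0)"
      by auto
  qed
next
  case (add f g)
  then obtain f' g' where fg: "coord_poly n f'" "coord_poly n g'"
    "\<And>z. ((\<lambda>t. f (z(k := z k + d * of_real t))) has_vector_derivative f' z) (at 0)"
    "\<And>z. ((\<lambda>t. g (z(k := z k + d * of_real t))) has_vector_derivative g' z) (at 0)" by blast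
  then show ?case
    using has_vector_derivative_add[OF fg(3,4)]
    by (intro exI[of _ "\<lambda>z. f' z + g' z"] conjI allI coord_poly.add fg)
next
  case (mult f g)
  then obtain f' g' where fg: "coord_poly n f'" "coord_poly n g'"
    "\<And>z. ((\<lambda>t. f (z(k := z k + d * of_real t))) has_vector_derivative f' z) (at 0)"
    "\<And>z. ((\<lambda>t. g (z(k := z k + d * of_real t))) has_vector_derivative g' z) (at 0)" by blast
  have "((\<lambda>t. f (z(k := z k + d * of_real t)) * g (z(k := z k + d * of_real t))) has_vector_derivative (f z * g' z + f' z * g z)) (at 0)" for z
    using has_vector_derivative_mult[OF fg(3,4), of z z] by simp
  then show ?case
    by (intro exI[of _ "\<lambda>z. f z * g' z + f' z * g z"] conjI allI coord_poly.add coord_poly.mult fg mult.hyps)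
qed

lemma coord_poly_partial_deriv:
  assumes f: "coord_poly n f" and s: "s \<in> coord_shifts n"
  shows "coord_poly n (partial_deriv s f)" "(\<lambda>t. f (s z t)) differentiable at 0"
proof -
  obtain k d where s: "s = (\<lambda>z t. z(k := z k + d * of_real t))"
  proof -
    from s consider k where "s = (\<lambda>z t. z(k := shift_re (z k) t))" | k where "s = (\<lambda>z t. z(k := shift_im (z k) t))"
      by (auto simp: coord_shifts_def)
    then show ?thesis
    proof cases
      case (1 k)
      then show ?thesis using that[of k 1] by (simp add: shift_re_def)
    next
      case (2 k)
      then show ?thesis using that[of k \<i>] by (simp add: shift_im_def)
    qed
  qed
  obtain g where g: "coord_poly n g" "\<And>z. ((\<lambda>t. f (s z t)) has_vector_derivative g z) (at 0)"
    using coord_poly_directional_derivative[OF f, of k d] unfolding s by blast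
  have "partial_deriv s f = g"
    unfolding partial_deriv_def using vector_derivative_at[OF g(2)] by auto
  then show "coord_poly n (partial_deriv s f)" using g by simp
  show "(\<lambda>t. f (s z t)) differentiable at 0" using g(2) by (rule differentiableI_vector)
qed

lemma coord_poly_C2: "coord_poly n f \<Longrightarrow> C2_on (coord_shifts n) \<Omega> f"
  unfolding C2_on_def C1_on_def using coord_poly_partial_deriv coord_poly_continuous by blast

lemma poly_shift_derivative:
  fixes q :: "complex poly"
  shows "((\<lambda>t. poly q (w + d * of_real t)) has_vector_derivative d * poly (pderiv q) w) (at 0)"
proof -
  have "((\<lambda>t. w + d * complex_of_real t) has_vector_derivative d) (at 0)"
    by (auto intro!: derivative_eq_intros)
  then have "((poly q \<circ> (\<lambda>t. w + d * complex_of_real t)) has_vector_derivative d * poly (pderiv q) (w + d * of_real 0)) (at 0)"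
    by (rule field_vector_diff_chain_at) (rule poly_DERIV)
  then show ?thesis by (simp add: o_def)
qed

lemma poly_partial_deriv:
  fixes q :: "complex poly"
  shows "partial_deriv shift_re (poly q) = poly (pderiv q)" "partial_deriv shift_im (poly q) = poly (smult \<i> (pderiv q))"
    "(\<lambda>t. poly q (shift_re w t)) differentiable at 0" "(\<lambda>t. poly q (shift_im w t)) differentiable at 0"
  using poly_shift_derivative[of q _ 1] poly_shift_derivative[of q _ \<i>]
  by (auto simp: partial_deriv_def shift_re_def shift_im_def fun_eq_iff intro: vector_derivative_at differentiableI_vector)

text \<open>
  The second derivatives in the real and in the imaginary direction are \<open>q''\<close> and \<open>\<i>\<^sup>2 * q''\<close>.
\<close>

lemma poly_harmonic: "harmonic_on U (poly q)"
  unfolding harmonic_on_def C2_on_def C1_on_def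
  by (simp add: poly_partial_deriv pderiv_smult continuous_intros del: poly_smult)

lemma coord_poly_line:
  assumes "coord_poly n f" shows "\<exists>q. (\<lambda>\<zeta>. f (\<lambda>k. z k + \<zeta> * \<theta> k)) = poly q"
  using assms
proof (induction rule: coord_poly.induct)
  case (const c)
  show ?case by (intro exI[of _ "[:c:]"]) auto
next
  case (coord k)
  show ?case by (intro exI[of _ "[:z k, \<theta> k:]"]) auto
next
  case (add f g)
  then obtain p q where "(\<lambda>\<zeta>. f (\<lambda>k. z k + \<zeta> * \<theta> k)) = poly p" "(\<lambda>\<zeta>. g (\<lambda>k. z k + \<zeta> * \<theta> k)) = poly q" by blast
  then show ?case by (intro exI[of _ "p + q"]) (auto simp: fun_eq_iff)
next
  case (mult f g)
  then obtain p q where "(\<lambda>\<zeta>. f (\<lambda>k. z k + \<zeta> * \<theta> k)) = poly p" "(\<lambda>\<zeta>. g (\<lambda>k. z k + \<zeta> * \<theta> k)) = poly q" by blast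
  then show ?case by (intro exI[of _ "p * q"]) (auto simp: fun_eq_iff)
qed

lemma coord_poly_pluriharmonic: "coord_poly n f \<Longrightarrow> pluriharmonic_on n \<Omega> f"
proof -
  assume f: "coord_poly n f"
  have "harmonic_on U (\<lambda>\<zeta>. f (\<lambda>k. z k + \<zeta> * \<theta> k))" for U z \<theta>
  proof -
    obtain q where "(\<lambda>\<zeta>. f (\<lambda>k. z k + \<zeta> * \<theta> k)) = poly q" using coord_poly_line[OF f] by blast
    then show ?thesis by (simp only: poly_harmonic)
  qed
  then show ?thesis unfolding pluriharmonic_on_def using coord_poly_C2[OF f] by blast
qed

text \<open>
  A holomorphic polynomial is pluriharmonic, with \<open>b = 0\<close>; without constant term, its value at the origin is the
  admissible value \<open>0\<close>.
\<close>

theorem bohr_property_polynomial: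
  fixes c :: "(nat \<Rightarrow> nat) \<Rightarrow> complex"
  assumes bohr: "bohr_property n p \<rho>" and p: "1 \<le> p" "0 < n" and A: "finite A" "A \<subseteq> multi_indices n"
    and re: "\<And>z. z \<in> lp_ball n p 1 \<Longrightarrow> Re (\<Sum>\<alpha>\<in>A. c \<alpha> * monomial n \<alpha> z) \<le> 1"
    and nz: "(\<lambda>_. 0) \<notin> A"
    and z: "z \<in> lp_ball n p \<rho>"
  shows "(\<Sum>\<alpha>\<in>A. cmod (c \<alpha> * monomial n \<alpha> z)) \<le> 1"
proof -
  define f where "f = (\<lambda>z. \<Sum>\<alpha>\<in>A. c \<alpha> * monomial n \<alpha> z)"
  define a where "a = (\<lambda>\<alpha>. if \<alpha> \<in> A then c \<alpha> else 0)"
  have hs: "((\<lambda>\<alpha>. g (a \<alpha>) * h \<alpha>) has_sum (\<Sum>\<alpha>\<in>A. g (c \<alpha>) * h \<alpha>)) (multi_indices n)"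
    if "g 0 = 0" for g :: "complex \<Rightarrow> 'b::{real_normed_algebra, t2_space}" and h
  proof -
    have "((\<lambda>\<alpha>. g (a \<alpha>) * h \<alpha>) has_sum (\<Sum>\<alpha>\<in>A. g (a \<alpha>) * h \<alpha>)) A" using A by (intro has_sum_finite)
    then have "((\<lambda>\<alpha>. g (a \<alpha>) * h \<alpha>) has_sum (\<Sum>\<alpha>\<in>A. g (a \<alpha>) * h \<alpha>)) (multi_indices n)"
      using A that by (subst (asm) has_sum_cong_neutral[where T = "multi_indices n" and g = "\<lambda>\<alpha>. g (a \<alpha>) * h \<alpha>"]) (auto simp: a_def)
    moreover have "(\<Sum>\<alpha>\<in>A. g (a \<alpha>) * h \<alpha>) = (\<Sum>\<alpha>\<in>A. g (c \<alpha>) * h \<alpha>)"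
      by (intro sum.cong) (auto simp: a_def)
    ultimately show ?thesis by simp
  qed
  have f0: "f (\<lambda>_. 0) = 0"
    unfolding f_def
  proof (intro sum.neutral ballI)
    fix \<alpha> assume a: "\<alpha> \<in> A"
    then have "\<alpha> \<noteq> (\<lambda>_. 0)" "\<alpha> \<in> multi_indices n" using nz A by auto
    then obtain k where "\<alpha> k \<noteq> 0" "k < n" unfolding multi_indices_def fun_eq_iff by (metis (mono_tags) mem_Collect_eq not_le)
    then have "monomial n \<alpha> (\<lambda>_. 0) = 0" by (auto simp: monomial_def)
    then show "c \<alpha> * monomial n \<alpha> (\<lambda>_. 0) = 0" by simp
  qed
  have "coord_poly n f" unfolding f_def using A by (intro coord_poly_sum coord_poly_monomial)
  then have "f \<in> PH_plus n p"
    using re f0 by (auto simp: PH_plus_def coord_poly_pluriharmonic SUP_le_iff f_def)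
  moreover have "has_pluriharmonic_expansion n p f a (\<lambda>_. 0)"
    unfolding has_pluriharmonic_expansion_def
  proof (intro ballI conjI)
    fix z
    have h: "((\<lambda>\<alpha>. a \<alpha> * monomial n \<alpha> z) has_sum f z) (multi_indices n)"
      using hs[of "\<lambda>x. x" "\<lambda>\<alpha>. monomial n \<alpha> z"] by (simp add: f_def)
    show "(\<lambda>\<alpha>. a \<alpha> * monomial n \<alpha> z) summable_on multi_indices n"
      using h by (auto simp: summable_on_def)
    show "f z = (\<Sum>\<^sub>\<infinity>\<alpha>\<in>multi_indices n. a \<alpha> * monomial n \<alpha> z) +
        (\<Sum>\<^sub>\<infinity>\<alpha>\<in>multi_indices n. cnj 0 * monomial n \<alpha> (\<lambda>k. cnj (z k)))"
      using infsumI[OF h] by simp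
  qed simp
  ultimately have "(\<Sum>\<^sub>\<infinity>\<alpha>\<in>multi_indices n. cmod (a \<alpha> * monomial n \<alpha> z)) \<le> 1"
    using bohr z unfolding bohr_property_def by (metis (no_types, lifting) add.right_neutral infsum_cong)
  moreover have "((\<lambda>\<alpha>. cmod (a \<alpha> * monomial n \<alpha> z)) has_sum (\<Sum>\<alpha>\<in>A. cmod (c \<alpha> * monomial n \<alpha> z))) (multi_indices n)"
    using hs[of cmod "\<lambda>\<alpha>. cmod (monomial n \<alpha> z)"] by (simp add: norm_mult)
  ultimately show ?thesis by (simp add: infsumI)
qed

corollary bohr_property_hpoly:
  assumes "bohr_property n p \<rho>" "1 \<le> p" "0 < n" "0 < m" "hom_bound n p m c 1" "z \<in> lp_ball n p \<rho>"
  shows "(\<Sum>\<alpha>\<in>MI n m. cmod (c \<alpha> * monomial n \<alpha> z)) \<le> 1"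
proof (rule bohr_property_polynomial[OF assms(1-3) finite_MI _ _ _ assms(6)])
  show "(\<lambda>_. 0) \<notin> MI n m" using assms(4) by (auto simp: MI_def)
  fix z assume z: "z \<in> lp_ball n p 1"
  have "Re (hpoly n m c z) \<le> cmod (hpoly n m c z)" by (rule complex_Re_le_cmod)
  also have "\<dots> \<le> 1 * lp_norm n p z ^ m" using z by (intro hboundD[OF assms(5)]) (simp add: lp_ball_def)
  also have "\<dots> \<le> 1" using z lp_norm_nonneg[OF assms(2,3)] by (simp add: lp_ball_def power_le_one)
  finally show "Re (\<Sum>\<alpha>\<in>MI n m. c \<alpha> * monomial n \<alpha> z) \<le> 1" by (simp add: hpoly_def)
qed (auto simp: MI_def)

section \<open>The Bohr radius as a maximum\<close>

text \<open>
  Test with the first coordinate function. This makes the set of radii with the Bohr property bounded.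
\<close>

lemma bohr_property_le_1:
  assumes b: "bohr_property n p \<rho>" and p: "1 \<le> p" "0 < n"
  shows "\<rho> \<le> 1"
proof (rule ccontr)
  assume "\<not> \<rho> \<le> 1"
  define e :: "nat \<Rightarrow> nat" where "e = (\<lambda>k. if k = 0 then 1 else 0)"
  define s where "s = (1 + \<rho>) / 2"
  have s: "1 < s" "s < \<rho>" using \<open>\<not> \<rho> \<le> 1\<close> by (auto simp: s_def)
  define w where "w = (\<lambda>k::nat. if k = 0 then complex_of_real s else 0)"
  have mono: "monomial n e z = z 0" for z
  proof -
    have "monomial n e z = (\<Prod>k<n. if k = 0 then z 0 else 1)"
      unfolding monomial_def by (intro prod.cong) (auto simp: e_def)
    then show ?thesis using p by simp
  qed
  have "lp_norm n p w \<le> (\<Sum>k<n. cmod (w k))" by (rule lp_norm_le_sum[OF p])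
  also have "\<dots> = (\<Sum>k<n. if k = 0 then s else 0)" using s by (intro sum.cong) (auto simp: w_def)
  also have "\<dots> = s" using p by simp
  finally have w: "w \<in> lp_ball n p \<rho>" using s p by (auto simp: lp_ball_def Cn_def w_def)
  have "(\<Sum>\<alpha>\<in>{e}. cmod (1 * monomial n \<alpha> w)) \<le> 1"
  proof (rule bohr_property_polynomial[OF b p _ _ _ _ w])
    fix z assume z: "z \<in> lp_ball n p 1"
    have "Re (z 0) \<le> cmod (z 0)" by (rule complex_Re_le_cmod)
    also have "\<dots> \<le> lp_norm n p z" using p by (rule component_le_lp_norm)
    finally show "Re (\<Sum>\<alpha>\<in>{e}. 1 * monomial n \<alpha> z) \<le> 1" using z by (simp add: mono lp_ball_def)
  qed (use p in \<open>auto simp: e_def multi_indices_def fun_eq_iff\<close>)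
  then show False using s by (simp add: mono w_def)
qed

text \<open>
  The balls are open, so a ball of radius \<open>Sup S\<close> is the union of the balls with radius in \<open>S\<close>: the supremum of the
  radii with the Bohr property is attained.
\<close>

lemma bohr_radius_greatest:
  assumes p: "1 \<le> p" "0 < n"
  shows "bohr_property n p (bohr_radius n p)" "bohr_property n p \<rho> \<Longrightarrow> \<rho> \<le> bohr_radius n p"
proof -
  define S where "S = {\<rho>. bohr_property n p \<rho>}"
  have S0: "0 \<in> S" by (simp add: S_def bohr_property_def lp_ball_empty[OF p])
  have bdd: "bdd_above S" using bohr_property_le_1[OF _ p] by (auto simp: S_def intro!: bdd_aboveI)
  have SS: "bohr_property n p (Sup S)"
    unfolding bohr_property_def
  proof (intro allI impI)
    fix f a b
    assume asm: "f \<in> PH_plus n p \<and> has_pluriharmonic_expansion n p f a b \<and> b (\<lambda>_. 0) = 0"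
    show "\<forall>z\<in>lp_ball n p (Sup S). (\<lambda>\<alpha>. cmod ((a \<alpha> + b \<alpha>) * monomial n \<alpha> z)) summable_on multi_indices n \<and>
          (\<Sum>\<^sub>\<infinity>\<alpha>\<in>multi_indices n. cmod ((a \<alpha> + b \<alpha>) * monomial n \<alpha> z)) \<le> 1"
    proof
      fix z assume z: "z \<in> lp_ball n p (Sup S)"
      then have "lp_norm n p z < Sup S" by (simp add: lp_ball_def)
      then obtain r where "r \<in> S" "lp_norm n p z < r" using less_cSup_iff[OF _ bdd] S0 by blast
      then have "bohr_property n p r" "z \<in> lp_ball n p r" using z by (auto simp: S_def lp_ball_def)
      then show "(\<lambda>\<alpha>. cmod ((a \<alpha> + b \<alpha>) * monomial n \<alpha> z)) summable_on multi_indices n \<and>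
          (\<Sum>\<^sub>\<infinity>\<alpha>\<in>multi_indices n. cmod ((a \<alpha> + b \<alpha>) * monomial n \<alpha> z)) \<le> 1"
        using asm unfolding bohr_property_def by blast
    qed
  qed
  have "bohr_radius n p = Sup S"
    unfolding bohr_radius_def
    by (rule Greatest_equality, rule SS) (rule cSup_upper[OF _ bdd], simp add: S_def)
  then show "bohr_property n p (bohr_radius n p)" "bohr_property n p \<rho> \<Longrightarrow> \<rho> \<le> bohr_radius n p"
    using SS cSup_upper[OF _ bdd, of \<rho>] by (auto simp: S_def)
qed

section \<open>Dimension one\<close>

lemma geometric_sum_from_1:
  fixes x :: "'a::field"
  assumes "x \<noteq> 1" shows "(\<Sum>k\<in>{1..K}. x ^ k) = x * (1 - x ^ K) / (1 - x)"
proof (induction K)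
  case (Suc K)
  have "(\<Sum>k\<in>{1..Suc K}. x ^ k) = x * (1 - x ^ K) / (1 - x) + x ^ Suc K" using Suc by simp
  also have "\<dots> = x * (1 - x ^ Suc K) / (1 - x)" using assms by (simp add: field_simps)
  finally show ?case .
qed simp

lemma sum_powers_third_le: "(\<Sum>m\<in>{1..K}. (1/3::real) ^ m) \<le> 1 / 2"
  by (subst geometric_sum_from_1) auto

lemma MI_1: "MI 1 m = {\<lambda>k. if k = 0 then m else 0}"
  by (auto simp: MI_def multi_indices_def fun_eq_iff)

text \<open>
  In one variable a homogeneous polynomial is a single monomial, so \<open>\<kappa> m = 1\<close>, and the powers of \<open>1/3\<close> sum to
  \<open>1/2\<close>.
\<close>

theorem bohr_radius_1_ge:
  assumes p: "1 \<le> p" shows "1 / 3 \<le> bohr_radius 1 p"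
proof (rule bohr_radius_greatest(2)[OF p])
  show "bohr_property 1 p (1 / 3)"
  proof (rule bohr_property_from_homogeneous[OF p, where \<kappa> = "\<lambda>_. 1"])
    fix m c M z
    assume hyp: "hom_bound 1 p m c M" "z \<in> Cn 1" "lp_norm 1 p z \<le> 1"
    have "(\<Sum>\<alpha>\<in>MI 1 m. cmod (c \<alpha> * monomial 1 \<alpha> z)) = cmod (hpoly 1 m c z)"
      unfolding hpoly_def MI_1 by simp
    also have "\<dots> \<le> M * lp_norm 1 p z ^ m" using hyp by (intro hboundD)
    also have "\<dots> \<le> M * 1"
      using hyp lp_norm_nonneg[OF p] hom_bound_nonneg[OF hyp(1) p]
      by (intro mult_left_mono power_le_one) auto
    finally show "(\<Sum>\<alpha>\<in>MI 1 m. cmod (c \<alpha> * monomial 1 \<alpha> z)) \<le> 1 * M" by simp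
  qed (use sum_powers_third_le in auto)
qed simp

text \<open>
  The untruncated series is \<open>-2w/(1-w) = 1 - (1+w)/(1-w)\<close>, a map onto the half plane \<open>Re < 1\<close>. For \<open>\<bar>w\<bar> \<le> s < 1\<close>
  its real part stays below 1 by at least \<open>(1-s)/(1+s)\<close>, which absorbs the tail of the series.
\<close>

lemma truncated_half_plane_map_le_1:
  fixes w :: complex
  assumes s: "0 < s" "s < 1" and w: "cmod w \<le> s" and K: "2 * s ^ Suc K * (1 + s) \<le> (1 - s)\<^sup>2"
  shows "Re (\<Sum>k\<in>{1..K}. - 2 * w ^ k) \<le> 1"
proof -
  have w1: "w \<noteq> 1" using w s by auto
  define D where "D = cmod (1 - w)"
  have D: "1 - s \<le> D" "D \<le> 1 + s"
    using norm_triangle_ineq2[of 1 w] norm_triangle_ineq4[of 1 w] w by (auto simp: D_def)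
  have "1 + (\<Sum>k\<in>{1..K}. 2 * w ^ k) = 1 + 2 * (w * (1 - w ^ K) / (1 - w))"
    unfolding geometric_sum_from_1[OF w1, symmetric] by (simp add: sum_distrib_left)
  also have "\<dots> = (1 + w - 2 * w ^ Suc K) / (1 - w)"
    using w1 by (simp add: field_simps)
  finally have "1 + (\<Sum>k\<in>{1..K}. 2 * w ^ k) = (1 + w - 2 * w ^ Suc K) / (1 - w)" .
  then have "1 + (\<Sum>k\<in>{1..K}. 2 * w ^ k) = (1 + w) / (1 - w) - 2 * w ^ Suc K / (1 - w)"
    by (simp add: diff_divide_distrib)
  then have "Re (1 + (\<Sum>k\<in>{1..K}. 2 * w ^ k)) = Re ((1 + w) / (1 - w)) - Re (2 * w ^ Suc K / (1 - w))"
    by (metis minus_complex.sel(1))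
  moreover have "Re ((1 + w) / (1 - w)) = (1 - (cmod w)\<^sup>2) / D\<^sup>2"
  proof -
    have "Re ((1 + w) / (1 - w)) = Re ((1 + w) * cnj (1 - w)) / D\<^sup>2"
      by (subst complex_div_cnj) (simp add: D_def flip: of_real_power)
    also have "Re ((1 + w) * cnj (1 - w)) = 1 - (cmod w)\<^sup>2"
      by (simp add: cmod_power2) (simp add: algebra_simps power2_eq_square)
    finally show ?thesis .
  qed
  moreover have "(1 - (cmod w)\<^sup>2) / D\<^sup>2 \<ge> (1 - s\<^sup>2) / (1 + s)\<^sup>2"
    using w s D by (intro frac_le diff_left_mono power_mono) (auto simp: power_le_one)
  moreover have "(1 - s\<^sup>2) / (1 + s)\<^sup>2 = (1 - s) / (1 + s)"
  proof -
    have "(1 - s\<^sup>2) = (1 - s) * (1 + s)" by (simp add: algebra_simps power2_eq_square)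
    then show ?thesis using s by (simp add: power2_eq_square)
  qed
  moreover have "Re (2 * w ^ Suc K / (1 - w)) \<le> 2 * s ^ Suc K / (1 - s)"
  proof -
    have "Re (2 * w ^ Suc K / (1 - w)) \<le> cmod (2 * w ^ Suc K / (1 - w))" by (rule complex_Re_le_cmod)
    also have "\<dots> = 2 * cmod w ^ Suc K / D" by (simp add: norm_divide norm_mult norm_power D_def)
    also have "\<dots> \<le> 2 * s ^ Suc K / (1 - s)"
      using w s D by (intro frac_le mult_left_mono power_mono) auto
    finally show ?thesis .
  qed
  moreover have "2 * s ^ Suc K / (1 - s) \<le> (1 - s) / (1 + s)"
    using K s by (simp add: field_simps power2_eq_square)
  ultimately have "0 \<le> Re (1 + (\<Sum>k\<in>{1..K}. 2 * w ^ k))" by linarith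
  then show ?thesis by (simp add: sum_negf)
qed

theorem bohr_radius_1_le:
  assumes p: "1 \<le> p" shows "bohr_radius 1 p \<le> 1 / 3"
proof (rule ccontr)
  assume neg: "\<not> bohr_radius 1 p \<le> 1 / 3"
  define \<rho> where "\<rho> = bohr_radius 1 p"
  have b: "bohr_property 1 p \<rho>" unfolding \<rho>_def by (rule bohr_radius_greatest(1)[OF p]) simp
  have \<rho>: "1 / 3 < \<rho>" "\<rho> \<le> 1" using neg bohr_property_le_1[OF b p] by (auto simp: \<rho>_def)
  \<comment> \<open>the point \<open>r\<close> lies in the ball of radius \<open>\<rho>\<close>, and the contraction \<open>s\<close> keeps \<open>s * r\<close> above \<open>1/3\<close>\<close>
  define r where "r = (1/3 + \<rho>) / 2"
  have r: "1/3 < r" "r < \<rho>" "r < 1" using \<rho> by (auto simp: r_def)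
  define s where "s = (1 / (3 * r) + 1) / 2"
  have s: "0 < s" "s < 1" "1/3 < s * r" using r by (auto simp: s_def field_simps)
  define x where "x = s * r"
  have x: "1/3 < x" "x < 1" using s r mult_strict_mono[of s 1 r 1] by (auto simp: x_def)
  have t1: "(\<lambda>K. 2 * s ^ Suc K * (1 + s)) \<longlonglongrightarrow> 2 * 0 * (1 + s)"
    using s by (intro tendsto_intros LIMSEQ_Suc LIMSEQ_realpow_zero) auto
  then have e1: "\<forall>\<^sub>F K in sequentially. 2 * s ^ Suc K * (1 + s) < (1 - s)\<^sup>2"
    using order_tendstoD(2)[OF t1, of "(1 - s)\<^sup>2"] s by simp
  have "(\<lambda>K. 2 * x * (1 - x ^ K) / (1 - x)) \<longlonglongrightarrow> 2 * x * (1 - 0) / (1 - x)"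
    using x by (intro tendsto_intros LIMSEQ_realpow_zero) auto
  moreover have "2 * x * (1 - 0) / (1 - x) > 1" using x by (simp add: field_simps)
  ultimately have e2: "\<forall>\<^sub>F K in sequentially. 2 * x * (1 - x ^ K) / (1 - x) > 1"
    by (intro order_tendstoD)
  obtain K where K: "2 * s ^ Suc K * (1 + s) < (1 - s)\<^sup>2" "2 * x * (1 - x ^ K) / (1 - x) > 1"
    using eventually_happens'[OF _ eventually_conj[OF e1 e2]] by auto
  define e :: "nat \<Rightarrow> nat \<Rightarrow> nat" where "e = (\<lambda>m k. if k = 0 then m else 0)"
  have inj: "inj_on e {1..K}" by (auto simp: inj_on_def e_def fun_eq_iff)
  have mono: "monomial 1 (e k) z = z 0 ^ k" for k z by (simp add: monomial_def e_def)
  define w where "w = (\<lambda>k::nat. if k = 0 then complex_of_real r else 0)"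
  have "lp_norm 1 p w \<le> (\<Sum>k<1. cmod (w k))" using p by (intro lp_norm_le_sum) auto
  then have w: "w \<in> lp_ball 1 p \<rho>" using r by (auto simp: lp_ball_def Cn_def w_def)
  have "(\<Sum>\<alpha>\<in>e ` {1..K}. cmod (- 2 * of_real (s ^ \<alpha> 0) * monomial 1 \<alpha> w)) \<le> 1"
  proof (rule bohr_property_polynomial[OF b p _ _ _ _ _ w])
    fix z assume z: "z \<in> lp_ball 1 p 1"
    have "cmod (z 0) \<le> lp_norm 1 p z" using p by (intro component_le_lp_norm) auto
    then have z1: "cmod (of_real s * z 0) \<le> s" using z s by (simp add: lp_ball_def norm_mult)
    have "(\<Sum>\<alpha>\<in>e ` {1..K}. - 2 * of_real (s ^ \<alpha> 0) * monomial 1 \<alpha> z) = (\<Sum>k\<in>{1..K}. - 2 * (of_real s * z 0) ^ k)"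
      unfolding sum.reindex[OF inj] o_def mono by (simp add: e_def power_mult_distrib mult_ac)
    then show "Re (\<Sum>\<alpha>\<in>e ` {1..K}. - 2 * of_real (s ^ \<alpha> 0) * monomial 1 \<alpha> z) \<le> 1"
      using truncated_half_plane_map_le_1[OF s(1,2) z1] K(1) by simp
  next
    show "(\<lambda>_. 0) \<notin> e ` {1..K}"
    proof
      assume "(\<lambda>_. 0) \<in> e ` {1..K}"
      then obtain k where k: "k \<ge> 1" "(\<lambda>_. 0) = e k" by auto
      then show False using fun_cong[OF k(2), of 0] by (simp add: e_def)
    qed
  qed (auto simp: e_def multi_indices_def)
  moreover have "(\<Sum>\<alpha>\<in>e ` {1..K}. cmod (- 2 * of_real (s ^ \<alpha> 0) * monomial 1 \<alpha> w)) = (\<Sum>k\<in>{1..K}. 2 * x ^ k)"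
    unfolding sum.reindex[OF inj] o_def mono using s r
    by (auto simp: e_def w_def x_def norm_mult norm_power power_mult_distrib intro!: sum.cong)
  moreover have "(\<Sum>k\<in>{1..K}. 2 * x ^ k) = 2 * x * (1 - x ^ K) / (1 - x)"
    using x geometric_sum_from_1[of x K] by (simp flip: sum_distrib_left)
  ultimately show False using K(2) by simp
qed

section \<open>Lower bounds of logarithmic order\<close>

lemma inverse_one_minus_le_exp:
  fixes x :: real
  assumes "0 \<le> x" "x < 1"
  shows "1 / (1 - x) \<le> exp (x / (1 - x))"
proof -
  have "1 / (1 - x) = 1 + x / (1 - x)" using assms by (simp add: field_simps)
  then show ?thesis using exp_ge_add_one_self[of "x / (1 - x)"] by simp
qed

lemma ln_le_sqrt:
  assumes "n > 0" shows "ln (real n) \<le> sqrt (real n)"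
proof -
  have "ln (sqrt (real n) / exp 1) \<le> sqrt (real n) / exp 1 - 1"
    using assms by (intro ln_le_minus_one) auto
  then have "ln (sqrt (real n)) \<le> sqrt (real n) / exp 1"
    using assms by (simp add: ln_div)
  moreover have "ln (sqrt (real n)) = ln (real n) / 2" using assms by (simp add: ln_sqrt)
  moreover have "sqrt (real n) / exp 1 \<le> sqrt (real n) / 2"
    using exp_ge_add_one_self[of 1] by (intro divide_left_mono) auto
  ultimately show ?thesis by linarith
qed

text \<open>
  The generating function bound at \<open>x = ln n / (4n)\<close>, where \<open>(1 - x) powr (-n)\<close> is at most \<open>exp (2nx) = sqrt n\<close>.
\<close>

lemma card_MI_log_bound:
  assumes n: "n \<ge> 2"
  shows "real (card (MI n d)) * (ln (real n) / real n) ^ d \<le> 4 ^ d * sqrt (real n)"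
proof -
  define x where "x = ln (real n) / (4 * real n)"
  have L: "0 \<le> ln (real n)" "ln (real n) \<le> real n" using n ln_bound[of "real n"] by auto
  have x: "0 \<le> x" "x \<le> 1/4" using n L by (auto simp: x_def field_simps)
  have "real (card (MI n d)) * x ^ d \<le> (1 / (1 - x)) ^ n"
    using x by (intro card_MI_generating) auto
  also have "\<dots> \<le> exp (2 * x) ^ n"
  proof (intro power_mono)
    have "1 / (1 - x) \<le> exp (x / (1 - x))" using x by (intro inverse_one_minus_le_exp) auto
    also have "x / (1 - x) \<le> x / (1/2)" using x by (intro divide_left_mono) auto
    finally show "1 / (1 - x) \<le> exp (2 * x)" by (simp add: mult.commute)
  qed (use x in auto)
  also have "\<dots> = exp (ln (real n) / 2)"
    using n by (simp add: x_def flip: exp_of_nat_mult)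
  also have "\<dots> = sqrt (real n)" using n by (simp add: ln_sqrt[symmetric])
  finally have "real (card (MI n d)) * x ^ d \<le> sqrt (real n)" .
  moreover have "ln (real n) / real n = 4 * x" by (simp add: x_def)
  ultimately show ?thesis by (simp add: power_mult_distrib mult_ac)
qed

text \<open>
  In degree \<open>d + 1\<close> the number of monomials of degree \<open>d\<close> costs \<open>(4 ^ d * sqrt n) powr s\<close> against
  the factor \<open>(ln n / n) powr (s * d)\<close>. One further factor \<open>(ln n / n) powr s\<close> of the radius compensates
  \<open>sqrt n powr s\<close>, because \<open>ln n \<le> sqrt n\<close>. The remaining series is geometric and small by the choice of the
  constant.
\<close>

lemma bohr_property_log:
  assumes n: "n \<ge> 2" and p: "1 \<le> p" and s: "0 \<le> s" "s \<le> 1/2" and K: "K0 \<ge> 1" "b \<ge> 1"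
    and hom: "\<And>d c M z. hom_bound n p (Suc d) c M \<Longrightarrow> z \<in> Cn n \<Longrightarrow> lp_norm n p z \<le> 1 \<Longrightarrow>
      (\<Sum>\<alpha>\<in>MI n (Suc d). cmod (c \<alpha> * monomial n \<alpha> z)) \<le> K0 * real (Suc d) * b ^ d * real (card (MI n d)) powr s * M"
  shows "bohr_property n p (1 / (16 * K0 * b) * (ln (real n) / real n) powr s)"
proof -
  define y where "y = ln (real n) / real n"
  define c where "c = 1 / (16 * K0 * b)"
  have L: "0 < ln (real n)" "ln (real n) \<le> real n" using n ln_bound[of "real n"] by auto
  have y: "0 < y" "y \<le> 1" using L n by (auto simp: y_def)
  have n0: "0 < n" using n by simp
  have Kb: "K0 * b \<ge> 1" using K mult_mono[of 1 K0 1 b] by simp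
  have c: "0 < c" "c \<le> 1" "b * c \<le> 1 / 16" "K0 * c \<le> 1/16"
    using K Kb by (auto simp: c_def field_simps)
  define \<rho> where "\<rho> = c * y powr s"
  have ys: "0 < y powr s" "y powr s \<le> 1" using y s by (auto simp: powr_le1)
  have \<rho>: "0 < \<rho>" "\<rho> \<le> 1" using c ys mult_mono[of c 1 "y powr s" 1] by (auto simp: \<rho>_def)
  define \<kappa> where "\<kappa> = (\<lambda>m. K0 * real m * b ^ (m - 1) * real (card (MI n (m - 1))) powr s)"
  have tm: "\<kappa> (Suc d) * \<rho> ^ Suc d \<le> 1/16 * (1/2) ^ d" for d
  proof -
    have pw: "(y powr s) ^ d = (y ^ d) powr s" by (simp add: power_powr_commute)
    have "real (card (MI n d)) powr s * (y powr s) ^ Suc d = (real (card (MI n d)) * y ^ d) powr s * y powr s"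
      using y by (simp add: powr_mult pw mult_ac)
    also have "\<dots> \<le> (4 ^ d * sqrt (real n)) powr s * y powr s"
      using card_MI_log_bound[OF n, of d] y s
      by (intro mult_right_mono powr_mono2) (auto simp: y_def)
    also have "\<dots> = (4 ^ d) powr s * (sqrt (real n) * y) powr s"
      using y by (simp add: powr_mult)
    also have "\<dots> \<le> (4 ^ d) powr 1 * 1"
    proof (intro mult_mono)
      have "sqrt (real n) * y = ln (real n) / sqrt (real n)"
        using n by (simp add: y_def field_simps)
      also have "\<dots> \<le> 1" using ln_le_sqrt[OF n0] n by simp
      finally show "(sqrt (real n) * y) powr s \<le> 1" using s y by (intro powr_le1) auto
      show "(4 ^ d) powr s \<le> (4 ^ d) powr (1::real)" using s by (intro powr_mono) auto
    qed auto
    finally have A: "real (card (MI n d)) powr s * (y powr s) ^ Suc d \<le> 4 ^ d" by simp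
    have d2: "real (Suc d) \<le> 2 ^ d" by (induction d) auto
    have "\<kappa> (Suc d) * \<rho> ^ Suc d = (K0 * c) * (real (Suc d) * (b * c) ^ d) * (real (card (MI n d)) powr s * (y powr s) ^ Suc d)"
      by (simp add: \<kappa>_def \<rho>_def power_mult_distrib mult_ac)
    also have "\<dots> \<le> (1/16) * (2 ^ d * (1/16) ^ d) * 4 ^ d"
      using A c K d2 by (intro mult_mono power_mono mult_nonneg_nonneg) auto
    also have "\<dots> = 1/16 * (1/2) ^ d" by (simp flip: power_mult_distrib)
    finally show ?thesis .
  qed
  have "bohr_property n p \<rho>"
  proof (rule bohr_property_from_homogeneous[OF p n0 \<rho>, where \<kappa> = \<kappa>])
    fix m c M z
    assume "0 < m" "hom_bound n p m c M" "z \<in> Cn n" "lp_norm n p z \<le> 1"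
    then show "(\<Sum>\<alpha>\<in>MI n m. cmod (c \<alpha> * monomial n \<alpha> z)) \<le> \<kappa> m * M"
      using hom[of "m - 1" c M z] by (simp add: \<kappa>_def)
  next
    fix K
    have "(\<Sum>m\<in>{1..K}. \<kappa> m * \<rho> ^ m) = (\<Sum>d<K. \<kappa> (Suc d) * \<rho> ^ Suc d)"
      by (rule sum.reindex_bij_witness[where i = Suc and j = "\<lambda>m. m - 1"]) auto
    also have "\<dots> \<le> (\<Sum>d<K. 1/16 * (1/2) ^ d)" by (intro sum_mono tm)
    also have "\<dots> = 1/16 * (2 * (1 - (1/2) ^ K))"
    proof -
      have g: "(\<Sum>d<K. (1/2::real) ^ d) = 2 * (1 - (1/2) ^ K)" by (simp add: sum_gp_strict)
      show ?thesis unfolding sum_distrib_left[symmetric] g ..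
    qed
    also have "\<dots> \<le> 1 / 2" by (simp add: order_trans[of _ 0])
    finally show "(\<Sum>m\<in>{1..K}. \<kappa> m * \<rho> ^ m) \<le> 1 / 2" .
  qed
  then show ?thesis by (simp add: \<rho>_def c_def y_def)
qed

text \<open>
  Multiplication by a point of the unit ball maps the polydisc into the ball, so estimates of coefficient sums on the
  polydisc imply estimates of monomial sums on every ball.
\<close>

lemma hom_bound_polydisc:
  assumes h: "hom_bound n p m c M" and p: "1 \<le> p" "0 < n" and z: "z \<in> Cn n" "lp_norm n p z \<le> 1"
  shows "hom_bound n \<infinity> m (\<lambda>\<alpha>. c \<alpha> * monomial n \<alpha> z) M"
  unfolding hom_bound_def
proof
  fix w assume w: "w \<in> Cn n"
  define R where "R = lp_norm n \<infinity> w"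
  have R: "R \<ge> 0" unfolding R_def using p by (intro lp_norm_nonneg) auto
  have "lp_norm n p (\<lambda>k. z k * w k) \<le> lp_norm n p (\<lambda>k. of_real R * z k)"
  proof (rule lp_norm_mono[OF p])
    fix k assume "k < n"
    then have "cmod (w k) \<le> R" unfolding R_def by (intro component_le_lp_norm) auto
    then show "cmod (z k * w k) \<le> cmod (of_real R * z k)"
      using R by (simp add: norm_mult mult.commute mult_right_mono)
  qed
  also have "\<dots> \<le> R" using lp_norm_scale[OF p, of "of_real R" z] R z(2) by (simp add: mult_left_le)
  finally have le: "lp_norm n p (\<lambda>k. z k * w k) \<le> R" .
  have "cmod (hpoly n m (\<lambda>\<alpha>. c \<alpha> * monomial n \<alpha> z) w) = cmod (hpoly n m c (\<lambda>k. z k * w k))"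
    by (simp add: hpoly_def monomial_mult mult_ac)
  also have "\<dots> \<le> M * lp_norm n p (\<lambda>k. z k * w k) ^ m"
    using z w by (intro hboundD[OF h]) (auto simp: Cn_def)
  also have "\<dots> \<le> M * R ^ m"
    using le lp_norm_nonneg[OF p] hom_bound_nonneg[OF h p] by (intro mult_left_mono power_mono) auto
  finally show "cmod (hpoly n m (\<lambda>\<alpha>. c \<alpha> * monomial n \<alpha> z) w) \<le> M * lp_norm n \<infinity> w ^ m"
    by (simp add: R_def)
qed

theorem bohr_radius_ge_sqrt:
  assumes n: "n \<ge> 2" and p: "1 \<le> p"
  shows "1 / (16 * exp 2 * 2) * (ln (real n) / real n) powr (1/2) \<le> bohr_radius n p"
proof (rule bohr_radius_greatest(2)[OF p])
  have n0: "0 < n" using n by simp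
  show "bohr_property n p (1 / (16 * exp 2 * 2) * (ln (real n) / real n) powr (1/2))"
  proof (rule bohr_property_log[OF n p])
    fix d c M z
    assume h: "hom_bound n p (Suc d) c M" "z \<in> Cn n" "lp_norm n p z \<le> 1"
    have "(\<Sum>\<alpha>\<in>MI n (Suc d). cmod (c \<alpha> * monomial n \<alpha> z)) \<le>
      sqrt (card (MI n (Suc d - 1))) * 2 powr (real (Suc d - 1) / real 1) * real n powr ((real 1 - 1) / 2)
       * (2 ^ (1 - 1) * exp 1 * real 1 * exp 1) * real (Suc d) ^ 1 * M"
      by (rule polydisc_coefficient_sum[OF hom_bound_polydisc[OF h(1) p n0 h(2,3)] n0]) auto
    also have "\<dots> = exp 2 * real (Suc d) * 2 ^ d * real (card (MI n d)) powr (1/2) * M"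
      using n by (simp add: powr_half_sqrt powr_realpow mult_exp_exp)
    finally show "(\<Sum>\<alpha>\<in>MI n (Suc d). cmod (c \<alpha> * monomial n \<alpha> z)) \<le> exp 2 * real (Suc d) * 2 ^ d * real (card (MI n d)) powr (1/2) * M" .
  qed auto
qed (use n in simp)

theorem bohr_radius_ge_lp:
  assumes n: "n \<ge> 2" and p: "1 \<le> p" "p \<le> 2"
  shows "1 / (16 * exp 1 * exp 1) * (ln (real n) / real n) powr (1 - 1/p) \<le> bohr_radius n (ereal p)"
proof (rule bohr_radius_greatest(2))
  have n0: "0 < n" using n by simp
  show "bohr_property n (ereal p) (1 / (16 * exp 1 * exp 1) * (ln (real n) / real n) powr (1 - 1/p))"
  proof (rule bohr_property_log[OF n])
    fix d c M z
    assume "hom_bound n (ereal p) (Suc d) c M" "z \<in> Cn n" "lp_norm n (ereal p) z \<le> 1"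
    then show "(\<Sum>\<alpha>\<in>MI n (Suc d). cmod (c \<alpha> * monomial n \<alpha> z)) \<le> exp 1 * real (Suc d) * exp 1 ^ d * real (card (MI n d)) powr (1 - 1/p) * M"
      using p n0 by (intro lp_monomial_sum)
  qed (use p in \<open>auto simp: field_simps\<close>)
qed (use n p in auto)

section \<open>The sharp lower bound for the polydisc\<close>

text \<open>
  The bound of the coefficient sums with \<open>k\<close> variables split off is used for degrees \<open>m \<ge> k\<close>, and the one with a
  single variable for \<open>m < k\<close>. In degree \<open>d + k\<close>, the hypercontractive loss \<open>2 powr (d/k)\<close> and a convergence factor
  \<open>\<tau> ^ d\<close> are absorbed in \<open>x\<close>, to which the generating function bound applies.
\<close>

lemma polydisc_uniform_bound:
  assumes n: "n \<ge> 2" and k: "k > 0" and \<tau>: "\<tau> > 1"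
    and L: "1 \<le> ln (real n)" and \<rho>0: "0 < \<rho>" "\<rho> \<le> sqrt (ln (real n) / real n)" "\<rho> \<le> 1"
    and x: "x = \<rho>\<^sup>2 * 4 powr (1 / real k) * \<tau>\<^sup>2" "x < 1"
    and G: "\<And>D. (\<Sum>d<D. (real d + real k) ^ k * (1 / \<tau>) ^ d) \<le> G"
    and small: "ln (real n) powr (real k / 2) * real n powr (-1/2) *
      (real k * (real k * 2 ^ k * exp 2) + (2 ^ k * exp 2 * real k) * G * (1 / (1 - x)) powr (real n / 2)) \<le> 1 / 2"
  shows "bohr_property n \<infinity> \<rho>"
proof -
  have n0: "0 < n" using n by simp
  define Q where "Q = ln (real n) powr (real k / 2) * real n powr (-1/2)"
  define y where "y = ln (real n) / real n"
  have y0: "y > 0" using L n by (auto simp: y_def)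
  have Q0: "Q \<ge> 0" by (simp add: Q_def)
  define low where "low = (\<lambda>m. sqrt (card (MI n (m - 1))) * 2 powr real (m - 1) * exp 2 * real m)"
  define high where "high = (\<lambda>m. sqrt (card (MI n (m - k))) * 2 powr (real (m - k) / real k) * real n powr ((real k - 1) / 2)
       * (2 ^ (k - 1) * exp 1 * real k * exp 1) * real m ^ k)"
  define \<kappa> where "\<kappa> = (\<lambda>m. if m < k then low m else high m)"
  have lowt: "low m * \<rho> ^ m \<le> real k * 2 ^ k * exp 2 * Q" if m: "0 < m" "m < k" for m
  proof -
    obtain d where d: "m = Suc d" using m by (cases m) auto
    have "sqrt (card (MI n d)) \<le> sqrt (real n ^ d)" using card_MI_le_power by simp
    also have "\<dots> = sqrt (real n) ^ d" by (simp add: real_sqrt_power)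
    finally have c: "sqrt (card (MI n d)) \<le> sqrt (real n) ^ d" .
    have r: "\<rho> ^ m \<le> sqrt y ^ m" using \<rho>0 by (intro power_mono) (auto simp: y_def)
    have "sqrt (real n) ^ d * sqrt y ^ m = (sqrt (real n) * sqrt y) ^ m / sqrt (real n)"
      using n by (simp add: d power_mult_distrib)
    also have "sqrt (real n) * sqrt y = sqrt (ln (real n))"
      using n by (simp add: y_def flip: real_sqrt_mult)
    also have "sqrt (ln (real n)) ^ m \<le> sqrt (ln (real n)) ^ k"
      using L m by (intro power_increasing) auto
    also have "sqrt (ln (real n)) ^ k / sqrt (real n) = Q"
      using L n by (simp add: Q_def powr_half_sqrt[symmetric] powr_power powr_minus_divide)
    finally have "sqrt (real n) ^ d * sqrt y ^ m \<le> Q" using n by (simp add: divide_right_mono)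
    then have A: "sqrt (card (MI n d)) * \<rho> ^ m \<le> Q"
      using mult_mono[OF c r] \<rho>0 y0 by simp
    have "low m * \<rho> ^ m = (sqrt (card (MI n d)) * \<rho> ^ m) * (2 ^ d * exp 2 * real m)"
      by (simp add: low_def d powr_realpow mult_ac)
    also have "\<dots> \<le> Q * (2 ^ k * exp 2 * real k)"
      using A m d Q0 \<rho>0 by (intro mult_mono power_increasing) auto
    finally show ?thesis by (simp add: mult_ac)
  qed
  have hight: "high (d + k) * \<rho> ^ (d + k) \<le> Q * (2 ^ k * exp 2 * real k) * (1 / (1 - x)) powr (real n / 2) * ((real d + real k) ^ k * (1 / \<tau>) ^ d)" for d
  proof -
    have x0: "0 < x" using \<rho>0 \<tau> by (simp add: x(1))
    have "sqrt (card (MI n d)) * (2 powr (real d / real k) * \<rho> ^ d) = sqrt (card (MI n d) * x ^ d) * (1 / \<tau>) ^ d"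
    proof -
      have "(2 powr (1 / real k))\<^sup>2 = 4 powr (1 / real k)"
        by (simp add: power2_eq_square powr_mult[symmetric])
      then have "x = (\<rho> * 2 powr (1 / real k) * \<tau>)\<^sup>2" by (simp add: x(1) power_mult_distrib)
      then have "sqrt x = \<rho> * 2 powr (1 / real k) * \<tau>" using \<rho>0 \<tau> by simp
      then have "sqrt (x ^ d) = (\<rho> * 2 powr (1 / real k) * \<tau>) ^ d" by (simp add: real_sqrt_power)
      moreover have "(2 powr (1 / real k)) ^ d = 2 powr (real d / real k)" by (simp add: powr_power)
      ultimately show ?thesis using \<tau> by (simp add: real_sqrt_mult power_mult_distrib power_divide)
    qed
    also have "\<dots> \<le> (1 / (1 - x)) powr (real n / 2) * (1 / \<tau>) ^ d"
    proof (intro mult_right_mono)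
      have "sqrt (card (MI n d) * x ^ d) \<le> sqrt ((1 / (1 - x)) ^ n)"
        using card_MI_generating[of x n d] x x0 by simp
      also have "\<dots> = (1 / (1 - x)) powr (real n / 2)"
        using x by (simp add: powr_half_sqrt[symmetric] powr_powr flip: powr_realpow)
      finally show "sqrt (card (MI n d) * x ^ d) \<le> (1 / (1 - x)) powr (real n / 2)" .
    qed (use \<tau> in auto)
    finally have A: "sqrt (card (MI n d)) * (2 powr (real d / real k) * \<rho> ^ d) \<le> (1 / (1 - x)) powr (real n / 2) * (1 / \<tau>) ^ d" .
    have "\<rho> ^ k \<le> sqrt y ^ k" using \<rho>0 by (intro power_mono) (auto simp: y_def)
    also have "\<dots> = y powr (real k / 2)" using y0 by (simp add: powr_half_sqrt[symmetric] powr_power)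
    finally have "real n powr ((real k - 1) / 2) * \<rho> ^ k \<le> real n powr ((real k - 1) / 2) * y powr (real k / 2)"
      by (intro mult_left_mono) auto
    also have "\<dots> = Q"
      using n L by (simp add: y_def Q_def powr_divide diff_divide_distrib powr_diff powr_minus_divide)
    finally have B: "real n powr ((real k - 1) / 2) * \<rho> ^ k \<le> Q" .
    have k2: "(2::real) ^ (k - 1) \<le> 2 ^ k" by (intro power_increasing) auto
    have "high (d + k) * \<rho> ^ (d + k) = (sqrt (card (MI n d)) * (2 powr (real d / real k) * \<rho> ^ d)) *
        (real n powr ((real k - 1) / 2) * \<rho> ^ k) * (2 ^ (k - 1) * (exp 2 * real k)) * (real d + real k) ^ k"
      by (simp add: high_def power_add mult_ac flip: mult_exp_exp[of 1 1, simplified])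
    also have "\<dots> \<le> ((1 / (1 - x)) powr (real n / 2) * (1 / \<tau>) ^ d) * Q * (2 ^ k * (exp 2 * real k)) * (real d + real k) ^ k"
    proof -
      have AB: "(sqrt (card (MI n d)) * (2 powr (real d / real k) * \<rho> ^ d)) * (real n powr ((real k - 1) / 2) * \<rho> ^ k)
          \<le> ((1 / (1 - x)) powr (real n / 2) * (1 / \<tau>) ^ d) * Q"
        by (rule mult_mono[OF A B]) (use \<rho>0 \<tau> in auto)
      show ?thesis
        by (intro mult_right_mono mult_mono[OF AB]) (use k2 \<rho>0 Q0 \<tau> in auto)
    qed
    finally show ?thesis by (simp add: mult_ac)
  qed
  show ?thesis
  proof (rule bohr_property_from_homogeneous[OF _ n0 \<rho>0(1,3), where \<kappa> = \<kappa>])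
    fix m c M z
    assume m: "0 < m" and h: "hom_bound n \<infinity> m c M" "z \<in> Cn n" "lp_norm n \<infinity> z \<le> 1"
    have h': "hom_bound n \<infinity> m (\<lambda>\<alpha>. c \<alpha> * monomial n \<alpha> z) M"
      by (rule hom_bound_polydisc[OF h(1) _ n0 h(2,3)]) simp
    show "(\<Sum>\<alpha>\<in>MI n m. cmod (c \<alpha> * monomial n \<alpha> z)) \<le> \<kappa> m * M"
    proof (cases "m < k")
      case True
      show ?thesis
        using polydisc_coefficient_sum[OF h' n0, of 1] m True n
        by (simp add: \<kappa>_def low_def mult_exp_exp mult_ac)
    next
      case False
      then show ?thesis using polydisc_coefficient_sum[OF h' n0 k] by (simp add: \<kappa>_def high_def)
    qed
  next
    fix K
    define C1 where "C1 = real k * 2 ^ k * exp 2 * Q"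
    define C2 where "C2 = Q * (2 ^ k * exp 2 * real k) * (1 / (1 - x)) powr (real n / 2)"
    have k0: "\<kappa> m * \<rho> ^ m \<ge> 0" for m using \<rho>0 by (simp add: \<kappa>_def low_def high_def)
    have "(\<Sum>m\<in>{1..K}. \<kappa> m * \<rho> ^ m) \<le> (\<Sum>m\<in>{1..<k} \<union> {k..<K + 1 + k}. \<kappa> m * \<rho> ^ m)"
      using k0 by (intro sum_mono2) auto
    also have "\<dots> = (\<Sum>m\<in>{1..<k}. \<kappa> m * \<rho> ^ m) + (\<Sum>m\<in>{k..<K + 1 + k}. \<kappa> m * \<rho> ^ m)"
      by (rule sum.union_disjoint) auto
    also have "(\<Sum>m\<in>{1..<k}. \<kappa> m * \<rho> ^ m) \<le> (\<Sum>m\<in>{1..<k}. C1)"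
      using lowt by (intro sum_mono) (auto simp: \<kappa>_def C1_def)
    also have "\<dots> \<le> real k * C1" using Q0 by (auto simp: C1_def intro!: mult_right_mono)
    also have "(\<Sum>m\<in>{k..<K + 1 + k}. \<kappa> m * \<rho> ^ m) = (\<Sum>d<K + 1. high (d + k) * \<rho> ^ (d + k))"
      by (rule sum.reindex_bij_witness[where i = "\<lambda>d. d + k" and j = "\<lambda>m. m - k"]) (auto simp: \<kappa>_def)
    also have "\<dots> \<le> (\<Sum>d<K + 1. C2 * ((real d + real k) ^ k * (1 / \<tau>) ^ d))"
      unfolding C2_def by (intro sum_mono hight)
    also have "\<dots> \<le> C2 * G"
      unfolding sum_distrib_left[symmetric] using G[of "K + 1"] Q0 by (intro mult_left_mono) (simp_all add: C2_def)
    finally have "(\<Sum>m\<in>{1..K}. \<kappa> m * \<rho> ^ m) \<le> real k * C1 + C2 * G" by simp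
    also have "\<dots> = Q * (real k * (real k * 2 ^ k * exp 2) + (2 ^ k * exp 2 * real k) * G * (1 / (1 - x)) powr (real n / 2))"
      by (simp add: C1_def C2_def algebra_simps)
    also have "\<dots> \<le> 1 / 2" using small by (simp add: Q_def)
    finally show "(\<Sum>m\<in>{1..K}. \<kappa> m * \<rho> ^ m) \<le> 1 / 2" .
  qed simp
qed

lemma summable_poly_geometric:
  fixes t :: real
  assumes "0 < t" "t < 1"
  shows "summable (\<lambda>d. (real d + real k) ^ k * t ^ d)"
proof -
  obtain s where s: "t < s" "s < 1" using dense[OF assms(2)] by auto
  have sm: "summable (\<lambda>d. norm (s ^ d))" using s assms by (simp add: summable_geometric)
  have "((\<lambda>d. (real d + real k) ^ k * t ^ d) \<in> O(\<lambda>d. s ^ d))"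
    using s assms by real_asymp
  with sm show ?thesis by (rule summable_comparison_test_bigo)
qed

text \<open>
  The factor \<open>(1 - \<epsilon>)\<^sup>2\<close> in the square of the radius leaves room for the choices \<open>\<tau>\<^sup>2 = 1/(1 - \<epsilon>)\<close> and \<open>k\<close> so large
  that \<open>\<theta> = 4 powr (1/k) * (1 - \<epsilon>) < 1\<close>. Then \<open>x = \<theta> * ln n / n\<close>, and \<open>(1 - x) powr (-n/2)\<close> is at most
  \<open>n powr (\<eta>/2)\<close> with \<open>\<eta> < 1\<close>; this loses against \<open>n powr (-1/2)\<close>.
\<close>

theorem bohr_radius_polydisc_eventually_ge:
  assumes \<epsilon>: "0 < \<epsilon>" "\<epsilon> < 1"
  shows "\<forall>\<^sub>F n in sequentially. (1 - \<epsilon>) * sqrt (ln (real n) / real n) \<le> bohr_radius n \<infinity>"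
proof -
  define \<tau> where "\<tau> = (1 / (1 - \<epsilon>)) powr (1/2)"
  have \<tau>: "\<tau> > 1" "\<tau>\<^sup>2 = 1 / (1 - \<epsilon>)" using \<epsilon> by (auto simp: \<tau>_def powr_half_sqrt)
  have t1: "(\<lambda>k. 4 powr (1 / real k) * (1 - \<epsilon>)) \<longlonglongrightarrow> 4 powr 0 * (1 - \<epsilon>)"
    by (intro tendsto_intros lim_1_over_n) auto
  then have "\<forall>\<^sub>F k in sequentially. 4 powr (1 / real k) * (1 - \<epsilon>) < 1"
    using \<epsilon> order_tendstoD(2)[OF t1, of 1] by simp
  then have "\<forall>\<^sub>F k in sequentially. 0 < k \<and> 4 powr (1 / real k) * (1 - \<epsilon>) < 1"
    by (intro eventually_conj eventually_gt_at_top)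
  then obtain k where k: "k > 0" "4 powr (1 / real k) * (1 - \<epsilon>) < 1"
    using eventually_happens'[OF sequentially_bot] by blast
  define \<theta> where "\<theta> = 4 powr (1 / real k) * (1 - \<epsilon>)"
  have \<theta>: "0 < \<theta>" "\<theta> < 1" using k \<epsilon> by (auto simp: \<theta>_def)
  define \<eta> where "\<eta> = (1 + \<theta>) / 2"
  have \<eta>: "\<theta> < \<eta>" "\<eta> < 1" using \<theta> by (auto simp: \<eta>_def)
  define G where "G = (\<Sum>d. (real d + real k) ^ k * (1 / \<tau>) ^ d)"
  have Gs: "summable (\<lambda>d. (real d + real k) ^ k * (1 / \<tau>) ^ d)"
    using \<tau> by (intro summable_poly_geometric) auto
  have G: "(\<Sum>d<D. (real d + real k) ^ k * (1 / \<tau>) ^ d) \<le> G" for D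
    unfolding G_def using \<tau> by (intro sum_le_suminf[OF Gs]) auto
  have G0: "G \<ge> 0" using G[of 0] by simp
  define C where "C = real k * (real k * 2 ^ k * exp 2) + (2 ^ k * exp 2 * real k) * G"
  define x where "x = (\<lambda>n::nat. \<theta> * ln (real n) / real n)"
  have "(\<lambda>n::nat. \<theta> * ln (real n) / real n) \<longlonglongrightarrow> 0" by real_asymp
  then have xl: "x \<longlonglongrightarrow> 0" by (simp add: x_def)
  have "(\<lambda>n. \<theta> / (1 - x n)) \<longlonglongrightarrow> \<theta> / (1 - 0)" by (intro tendsto_intros xl) auto
  then have e1: "\<forall>\<^sub>F n in sequentially. \<theta> / (1 - x n) < \<eta>" using \<eta> by (intro order_tendstoD(2)) auto
  have e2: "\<forall>\<^sub>F n in sequentially. x n < 1" using xl by (intro order_tendstoD(2)) auto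
  have e3: "\<forall>\<^sub>F n in sequentially. ln (real n) \<ge> 1" by real_asymp
  have "(\<lambda>n::nat. ln (real n) powr (real k / 2) * real n powr ((\<eta> - 1) / 2) * C) \<longlonglongrightarrow> 0"
    using \<eta> by real_asymp
  then have e4: "\<forall>\<^sub>F n in sequentially. ln (real n) powr (real k / 2) * real n powr ((\<eta> - 1) / 2) * C < 1/2"
    by (intro order_tendstoD(2)) auto
  have e5: "\<forall>\<^sub>F n::nat in sequentially. n \<ge> 2" by (rule eventually_ge_at_top)
  from e1 e2 e3 e4 e5 show ?thesis
  proof eventually_elim
    case (elim n)
    define L where "L = ln (real n)"
    have L: "L \<ge> 1" "L \<le> real n" using elim ln_bound[of "real n"] by (auto simp: L_def)
    have q: "0 < sqrt (L / real n)" "sqrt (L / real n) \<le> 1" using L elim by auto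
    define \<rho> where "\<rho> = (1 - \<epsilon>) * sqrt (L / real n)"
    have \<rho>: "0 < \<rho>" "\<rho> \<le> sqrt (L / real n)" "\<rho> \<le> 1"
      using q \<epsilon> mult_mono[of "1 - \<epsilon>" 1 "sqrt (L / real n)" 1] by (auto simp: \<rho>_def mult_le_cancel_right1)
    have x: "x n = \<rho>\<^sup>2 * 4 powr (1 / real k) * \<tau>\<^sup>2"
    proof -
      have r2: "\<rho>\<^sup>2 = (1 - \<epsilon>)\<^sup>2 * (L / real n)" using L by (simp add: \<rho>_def power_mult_distrib)
      show ?thesis unfolding x_def \<theta>_def \<tau>(2) r2 L_def[symmetric] using \<epsilon> by (simp add: power2_eq_square)
    qed
    have x0: "x n \<ge> 0" using L \<theta> by (simp add: x_def L_def[symmetric])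
    have "(1 / (1 - x n)) powr (real n / 2) \<le> exp (x n / (1 - x n)) powr (real n / 2)"
      using inverse_one_minus_le_exp[OF x0 elim(2)] x0 elim(2) by (intro powr_mono2) auto
    also have "\<dots> = exp (real n / 2 * (x n / (1 - x n)))" by (simp add: powr_def)
    also have "real n / 2 * (x n / (1 - x n)) = L / 2 * (\<theta> / (1 - x n))"
      using elim by (simp add: x_def L_def)
    also have "exp (L / 2 * (\<theta> / (1 - x n))) \<le> exp (L / 2 * \<eta>)"
      unfolding exp_le_cancel_iff using L elim(1) by (intro mult_left_mono) auto
    also have "\<dots> = real n powr (\<eta> / 2)" using elim by (simp add: powr_def L_def mult_ac)
    finally have P: "(1 / (1 - x n)) powr (real n / 2) \<le> real n powr (\<eta> / 2)" .
    have n1: "1 \<le> real n powr (\<eta> / 2)" using elim \<eta> \<theta> by (intro ge_one_powr_ge_zero) auto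
    have "bohr_property n \<infinity> \<rho>"
    proof (rule polydisc_uniform_bound[OF _ k(1) \<tau>(1) _ _ _ _ x _ G])
      have "real k * (real k * 2 ^ k * exp 2) + (2 ^ k * exp 2 * real k) * G * (1 / (1 - x n)) powr (real n / 2)
          \<le> real k * (real k * 2 ^ k * exp 2) * real n powr (\<eta> / 2) + (2 ^ k * exp 2 * real k) * G * real n powr (\<eta> / 2)"
      proof (intro add_mono)
        show "real k * (real k * 2 ^ k * exp 2) \<le> real k * (real k * 2 ^ k * exp 2) * real n powr (\<eta> / 2)"
          using mult_left_mono[OF n1, of "real k * (real k * 2 ^ k * exp 2)"] by simp
      qed (use P G0 in \<open>auto intro: mult_left_mono\<close>)
      also have "\<dots> = C * real n powr (\<eta> / 2)" by (simp add: C_def distrib_right)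
      finally have "L powr (real k / 2) * real n powr (-1/2) * (real k * (real k * 2 ^ k * exp 2) + (2 ^ k * exp 2 * real k) * G * (1 / (1 - x n)) powr (real n / 2))
         \<le> L powr (real k / 2) * real n powr (-1/2) * (C * real n powr (\<eta> / 2))"
        by (intro mult_left_mono) auto
      also have "\<dots> = L powr (real k / 2) * real n powr ((\<eta> - 1) / 2) * C"
        by (simp add: diff_divide_distrib powr_diff powr_minus_divide)
      finally show "ln (real n) powr (real k / 2) * real n powr (-1/2) * (real k * (real k * 2 ^ k * exp 2) + (2 ^ k * exp 2 * real k) * G * (1 / (1 - x n)) powr (real n / 2)) \<le> 1/2"
        using elim(4) by (simp add: L_def)
    qed (use elim \<rho> in \<open>auto simp: L_def\<close>)
    then have "\<rho> \<le> bohr_radius n \<infinity>" using elim(5) by (intro bohr_radius_greatest(2)) auto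
    then show ?case by (simp add: \<rho>_def L_def)
  qed
qed

section \<open>Polynomials with random signs\<close>

lemma cosh_le_exp_square: "cosh t \<le> exp (t\<^sup>2)" for t :: real
proof -
  have *: "cosh t \<le> exp (t\<^sup>2)" if t: "t \<ge> 0" for t :: real
  proof (cases "t \<le> 1")
    case True
    have "exp t \<le> 1 + t + t\<^sup>2" using t True by (rule exp_bound)
    moreover have "exp (- t) \<le> 1 - t + t\<^sup>2"
    proof -
      have "exp (- t) \<le> 1 / (1 + t)"
        using exp_ge_add_one_self[of t] t by (simp add: exp_minus divide_inverse le_imp_inverse_le)
      also have "\<dots> \<le> 1 - t + t\<^sup>2"
      proof -
        have "1 \<le> (1 - t + t\<^sup>2) * (1 + t)" using t by (simp add: algebra_simps power2_eq_square)
        then show ?thesis using t by (simp add: pos_divide_le_eq)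
      qed
      finally show ?thesis .
    qed
    ultimately have "cosh t \<le> 1 + t\<^sup>2" by (simp add: cosh_field_def)
    then show ?thesis using exp_ge_add_one_self[of "t\<^sup>2"] by linarith
  next
    case False
    have "exp (- t) \<le> exp t" using t by simp
    then have "cosh t \<le> exp t" by (simp add: cosh_field_def)
    moreover have "exp t \<le> exp (t\<^sup>2)" using False by (simp add: power2_eq_square)
    ultimately show ?thesis by linarith
  qed
  show ?thesis using *[of t] *[of "- t"] by (cases "t \<ge> 0") auto
qed

text \<open>
  The signs are chosen one at a time: averaged over both choices of a sign, each term of the
  potential is multiplied by a hyperbolic cosine, so one of the two choices does not exceed the bound.
\<close>

lemma exists_signs_potential:
  fixes x :: "'j \<Rightarrow> 'a \<Rightarrow> real"
  assumes "finite A"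
  shows "\<exists>e. (\<forall>a. e a = 1 \<or> e a = -1) \<and>
    (\<Sum>j\<in>J. cosh (l * (S j + (\<Sum>a\<in>A. e a * x j a)))) \<le> (\<Sum>j\<in>J. cosh (l * S j) * exp (l\<^sup>2 * (\<Sum>a\<in>A. (x j a)\<^sup>2)))"
  using assms
proof (induction A arbitrary: S rule: finite_induct)
  case empty
  show ?case by (intro exI[of _ "\<lambda>_. 1"]) simp
next
  case (insert a A)
  define E where "E = (\<lambda>j. exp (l\<^sup>2 * (\<Sum>a\<in>A. (x j a)\<^sup>2)))"
  define F where "F = (\<lambda>s. \<Sum>j\<in>J. cosh (l * (S j + s * x j a)) * E j)"
  \<comment> \<open>\<open>F s\<close> bounds the final potential, by the induction hypothesis, if the sign of \<open>a\<close> is \<open>s\<close>\<close>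
  define B where "B = (\<Sum>j\<in>J. cosh (l * S j) * exp (l\<^sup>2 * (\<Sum>a\<in>insert a A. (x j a)\<^sup>2)))"
  have "F 1 + F (-1) \<le> 2 * B"
  proof -
    have "F 1 + F (-1) = (\<Sum>j\<in>J. 2 * (cosh (l * S j) * cosh (l * x j a) * E j))"
      unfolding F_def sum.distrib[symmetric]
      by (intro sum.cong refl) (simp add: distrib_left right_diff_distrib cosh_add cosh_diff algebra_simps)
    also have "\<dots> \<le> (\<Sum>j\<in>J. 2 * (cosh (l * S j) * exp ((l * x j a)\<^sup>2) * E j))"
      by (intro sum_mono mult_left_mono mult_right_mono cosh_le_exp_square) (auto simp: E_def)
    also have "\<dots> = 2 * B"
      using insert.hyps by (simp add: B_def E_def sum_distrib_left power_mult_distrib distrib_left exp_add mult_ac)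
    finally show ?thesis .
  qed
  then have "F 1 \<le> B \<or> F (-1) \<le> B" by linarith
  then obtain s where s: "s = 1 \<or> s = -1" "F s \<le> B" by blast
  obtain e where e: "\<forall>a. e a = 1 \<or> e a = -1"
    "(\<Sum>j\<in>J. cosh (l * ((S j + s * x j a) + (\<Sum>a\<in>A. e a * x j a)))) \<le> F s"
    using insert.IH[of "\<lambda>j. S j + s * x j a"] unfolding F_def E_def by blast
  have "(\<Sum>b\<in>insert a A. (e(a := s)) b * x j b) = s * x j a + (\<Sum>a\<in>A. e a * x j a)" for j
    using insert.hyps by (auto intro: sum.cong)
  then have "(\<Sum>j\<in>J. cosh (l * (S j + (\<Sum>b\<in>insert a A. (e(a := s)) b * x j b)))) \<le> B"
    using e(2) s(2) by (simp add: add.assoc)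
  then show ?case unfolding B_def using e(1) s(1) by (intro exI[of _ "e(a := s)"]) auto
qed

text \<open>
  The potential bound with \<open>S = 0\<close>; the parameter \<open>l\<close> balances \<open>l\<^sup>2 * \<sigma>\<^sup>2\<close> with \<open>ln (2 * K)\<close>.
\<close>

lemma exists_signs_uniform:
  fixes x :: "'j \<Rightarrow> 'a \<Rightarrow> real"
  assumes A: "finite A" and J: "finite J" and K: "real (card J) \<le> K" "1 \<le> K" and \<sigma>: "\<sigma> > 0"
    and v: "\<And>j. j \<in> J \<Longrightarrow> (\<Sum>a\<in>A. (x j a)\<^sup>2) \<le> \<sigma>\<^sup>2"
  shows "\<exists>e. (\<forall>a. e a = 1 \<or> e a = -1) \<and> (\<forall>j\<in>J. \<bar>\<Sum>a\<in>A. e a * x j a\<bar> \<le> 2 * \<sigma> * sqrt (ln (2 * K)))"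
proof -
  define l where "l = sqrt (ln (2 * K)) / \<sigma>"
  have lk: "ln (2 * K) > 0" using K by simp
  have l: "l > 0" "l\<^sup>2 * \<sigma>\<^sup>2 = ln (2 * K)" using lk \<sigma> by (auto simp: l_def power_divide)
  obtain e where e: "\<forall>a. e a = 1 \<or> e a = -1"
    "(\<Sum>j\<in>J. cosh (l * (0 + (\<Sum>a\<in>A. e a * x j a)))) \<le> (\<Sum>j\<in>J. cosh (l * 0) * exp (l\<^sup>2 * (\<Sum>a\<in>A. (x j a)\<^sup>2)))"
    using exists_signs_potential[OF A, where S = "\<lambda>_. 0" and l = l and x = x and J = J]
    by (elim exE conjE) (rule that)
  have "(\<Sum>j\<in>J. cosh (l * 0) * exp (l\<^sup>2 * (\<Sum>a\<in>A. (x j a)\<^sup>2))) \<le> (\<Sum>j\<in>J. exp (l\<^sup>2 * \<sigma>\<^sup>2))"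
    using v by (intro sum_mono) (simp add: mult_left_mono)
  also have "\<dots> = real (card J) * (2 * K)" using K by (simp add: l(2))
  also have "\<dots> \<le> K * (2 * K)" using K by (intro mult_right_mono) auto
  finally have b: "(\<Sum>j\<in>J. cosh (l * (\<Sum>a\<in>A. e a * x j a))) \<le> 2 * K\<^sup>2"
    using e(2) by (simp add: power2_eq_square)
  have "\<bar>\<Sum>a\<in>A. e a * x j a\<bar> \<le> 2 * \<sigma> * sqrt (ln (2 * K))" if j: "j \<in> J" for j
  proof -
    define Y where "Y = (\<Sum>a\<in>A. e a * x j a)"
    have "exp (l * \<bar>Y\<bar>) / 2 \<le> cosh (l * \<bar>Y\<bar>)" by (simp add: cosh_field_def)
    also have "\<dots> = cosh (l * Y)" by (cases "Y \<ge> 0") auto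
    also have "\<dots> \<le> (\<Sum>j\<in>J. cosh (l * (\<Sum>a\<in>A. e a * x j a)))"
      unfolding Y_def using j J by (intro member_le_sum) auto
    finally have "exp (l * \<bar>Y\<bar>) \<le> (2 * K)\<^sup>2" using b by (simp add: power_mult_distrib)
    then have "l * \<bar>Y\<bar> \<le> ln ((2 * K)\<^sup>2)" using K by (subst ln_ge_iff) auto
    also have "\<dots> = 2 * ln (2 * K)" using K using ln_realpow[of "2 * K" 2] by simp
    finally have "\<bar>Y\<bar> \<le> 2 * ln (2 * K) / l" using l by (simp add: pos_le_divide_eq mult.commute)
    also have "\<dots> = 2 * \<sigma> * sqrt (ln (2 * K))"
    proof -
      have "ln (2 * K) = sqrt (ln (2 * K)) * sqrt (ln (2 * K))" using lk by simp
      then show ?thesis unfolding l_def using lk \<sigma> by (simp add: field_simps)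
    qed
    finally show ?thesis by (simp add: Y_def)
  qed
  then show ?thesis using e(1) by blast
qed

text \<open>
  The coordinates of \<open>x\<close> range over \<open>{..2 * T}\<close>, so the grid fills the square \<open>[-1, 1]\<^sup>2\<close> in every coordinate with
  mesh \<open>1/T\<close>.
\<close>

definition grid_point :: "nat \<Rightarrow> nat \<Rightarrow> (nat \<Rightarrow> nat) \<times> (nat \<Rightarrow> nat) \<Rightarrow> nat \<Rightarrow> complex"
  where "grid_point n T x k = (if k < n then Complex ((real (fst x k) - real T) / real T) ((real (snd x k) - real T) / real T) else 0)"

lemma grid_approximation:
  assumes T: "T > 0" and z: "z \<in> Cn n" "\<And>k. k < n \<Longrightarrow> cmod (z k) \<le> 1"
  shows "\<exists>x\<in>index_box n (\<lambda>_. {..2 * T}) \<times> index_box n (\<lambda>_. {..2 * T}).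
    \<forall>k. cmod (grid_point n T x k - z k) \<le> 2 / real T"
proof -
  define rd where "rd = (\<lambda>t::real. nat \<lfloor>real T * (t + 1)\<rfloor>)"
  have rd: "rd t \<le> 2 * T" "\<bar>(real (rd t) - real T) / real T - t\<bar> \<le> 1 / real T" if "\<bar>t\<bar> \<le> 1" for t
  proof -
    have nn: "0 \<le> real T * (t + 1)" using that by (intro mult_nonneg_nonneg) auto
    have f: "real (rd t) \<le> real T * (t + 1)" "real T * (t + 1) < real (rd t) + 1"
      using nn by (auto simp: rd_def)
    have "real T * (t + 1) \<le> real T * 2" using that by (intro mult_left_mono) auto
    with f have "real (rd t) \<le> real (2 * T)" by simp
    then show "rd t \<le> 2 * T" by (simp only: of_nat_le_iff)
    have "(real (rd t) - real T) / real T - t = (real (rd t) - real T * (t + 1)) / real T"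
      using T by (simp add: field_simps)
    moreover have "\<bar>real (rd t) - real T * (t + 1)\<bar> \<le> 1" using f by linarith
    ultimately show "\<bar>(real (rd t) - real T) / real T - t\<bar> \<le> 1 / real T"
      using T by (simp add: abs_divide divide_right_mono)
  qed
  define x where "x = (\<lambda>k. if k < n then rd (Re (z k)) else 0, \<lambda>k. if k < n then rd (Im (z k)) else 0)"
  have ri: "\<bar>Re (z k)\<bar> \<le> 1" "\<bar>Im (z k)\<bar> \<le> 1" if "k < n" for k
    using z(2)[OF that] abs_Re_le_cmod[of "z k"] abs_Im_le_cmod[of "z k"] by auto
  have "x \<in> index_box n (\<lambda>_. {..2 * T}) \<times> index_box n (\<lambda>_. {..2 * T})"
    using ri rd(1) by (auto simp: x_def index_box_def multi_indices_def)
  moreover have "cmod (grid_point n T x k - z k) \<le> 2 / real T" for k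
  proof (cases "k < n")
    case True
    have "cmod (grid_point n T x k - z k) \<le> \<bar>Re (grid_point n T x k - z k)\<bar> + \<bar>Im (grid_point n T x k - z k)\<bar>"
      by (rule cmod_le)
    also have "\<dots> \<le> 1 / real T + 1 / real T"
      using ri[OF True] rd(2) True by (intro add_mono) (auto simp: grid_point_def x_def)
    finally show ?thesis by simp
  qed (use z in \<open>auto simp: grid_point_def Cn_def\<close>)
  ultimately show ?thesis by blast
qed

lemma monomial_le_1: "(\<And>k. k < n \<Longrightarrow> cmod (z k) \<le> 1) \<Longrightarrow> cmod (monomial n \<alpha> z) \<le> 1"
  unfolding monomial_def prod_norm[symmetric] norm_power by (intro prod_le_1) (auto intro: power_le_one)

text \<open>
  If \<open>M\<close> is the supremum on the ball, then the polynomial varies by at most \<open>M/2\<close> over distances \<open>1/(12m)\<close>: the parts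
  of degree \<open>k \<ge> 1\<close> of its Taylor expansion are at most \<open>e * M / 12 ^ k\<close>. Hence \<open>M \<le> B + M/2\<close>.
\<close>

lemma hom_bound_from_net:
  assumes p: "1 \<le> p" "0 < n" and m: "0 < m"
    and net: "\<And>z. z \<in> Cn n \<Longrightarrow> lp_norm n p z \<le> 1 \<Longrightarrow>
      \<exists>w\<in>Cn n. lp_norm n p (\<lambda>k. w k - z k) \<le> 1 / (12 * real m) \<and> cmod (hpoly n m c w) \<le> B"
  shows "hom_bound n p m c (2 * B)"
proof -
  define M where "M = Sup ((\<lambda>z. cmod (hpoly n m c z)) ` lp_ball n p 1)"
  have bdd: "bdd_above ((\<lambda>z. cmod (hpoly n m c z)) ` lp_ball n p 1)"
  proof (rule bdd_aboveI2)
    fix z assume z: "z \<in> lp_ball n p 1"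
    have "cmod (z k) \<le> 1" if "k < n" for k
      using component_le_lp_norm[OF p(1) that, of z] z by (simp add: lp_ball_def)
    then have "cmod (monomial n \<alpha> z) \<le> 1" for \<alpha> by (rule monomial_le_1)
    then show "cmod (hpoly n m c z) \<le> (\<Sum>\<alpha>\<in>MI n m. cmod (c \<alpha>))"
      unfolding hpoly_def by (intro sum_norm_le) (simp add: norm_mult mult_left_le)
  qed
  have h: "hom_bound n p m c M"
    unfolding M_def by (rule hom_bound_from_ball[OF p]) (use bdd in \<open>auto intro: cSup_upper\<close>)
  have M0: "M \<ge> 0" by (rule hom_bound_nonneg[OF h p])
  have "cmod (hpoly n m c z) \<le> B + M / 2" if z: "z \<in> lp_ball n p 1" for z
  proof -
    have zC: "z \<in> Cn n" and zN: "lp_norm n p z \<le> 1" using z by (auto simp: lp_ball_def)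
    obtain w where w: "w \<in> Cn n" "lp_norm n p (\<lambda>k. w k - z k) \<le> 1 / (12 * real m)" "cmod (hpoly n m c w) \<le> B"
      using net[OF zC zN] by blast
    define u where "u = (\<lambda>k. w k - z k)"
    have uC: "u \<in> Cn n" using w zC by (auto simp: u_def Cn_def)
    have uN: "lp_norm n p u \<le> 1 / (12 * real m)" using w by (simp add: u_def)
    have Hk: "cmod (taylor_part n m k c z u) \<le> (exp 1 * M) * (1/12) ^ k" if "k \<le> m" for k
    proof -
      have "12 ^ k * cmod (taylor_part n m k c z u) \<le> M * (lp_norm n p z + 12 * lp_norm n p u) ^ m"
        using that by (intro taylor_part_bound[OF h p zC uC]) auto
      also have "\<dots> \<le> M * (1 + 1 / real m) ^ m"
        using zN uN m lp_norm_nonneg[OF p] M0 by (intro mult_left_mono power_mono add_mono) (auto simp: field_simps)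
      also have "\<dots> \<le> M * exp 1" using one_plus_inverse_power_le_exp[OF m] M0 by (intro mult_left_mono)
      finally show ?thesis by (simp add: power_divide field_simps)
    qed
    have H0: "hpoly n m c z = taylor_part n m 0 c z u"
      using Taylor_hpoly[of n m c z 0 u] by (simp add: power_0_left if_distrib[where f = "\<lambda>x. x * _"] cong: if_cong)
    have "hpoly n m c w = (\<Sum>k\<le>m. taylor_part n m k c z u)"
      using Taylor_hpoly[of n m c z 1 u] by (simp add: u_def)
    also have "\<dots> = hpoly n m c z + (\<Sum>k\<in>{1..m}. taylor_part n m k c z u)"
    proof -
      have "{..m} = insert 0 {1..m}" by auto
      then show ?thesis by (simp add: H0)
    qed
    finally have "hpoly n m c z = hpoly n m c w - (\<Sum>k\<in>{1..m}. taylor_part n m k c z u)" by simp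
    then have "cmod (hpoly n m c z) \<le> cmod (hpoly n m c w) + cmod (\<Sum>k\<in>{1..m}. taylor_part n m k c z u)"
      by (metis norm_triangle_ineq4)
    also have "cmod (\<Sum>k\<in>{1..m}. taylor_part n m k c z u) \<le> (\<Sum>k\<in>{1..m}. (exp 1 * M) * (1/12) ^ k)"
      using Hk by (intro sum_norm_le) auto
    also have "\<dots> = (exp 1 * M) * ((1/12) * (1 - (1/12) ^ m) / (1 - 1/12))"
      by (simp only: sum_distrib_left[symmetric]) (subst geometric_sum_from_1, auto)
    also have "\<dots> \<le> (3 * M) * (1/6)"
    proof (intro mult_mono)
      have P: "1 - (1/12::real) ^ m \<le> 1" by simp
      have "(1/12) * (1 - (1/12) ^ m) / (1 - 1/12) = (1 - (1/12::real) ^ m) / 11" by simp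
      also have "\<dots> \<le> 1 / 11" by (intro divide_right_mono P) simp
      also have "\<dots> \<le> 1 / 6" by simp
      finally show "(1/12) * (1 - (1/12) ^ m) / (1 - 1/12) \<le> (1/6::real)" .
      show "0 \<le> (1/12) * (1 - (1/12) ^ m) / (1 - 1/12 :: real)"
        by (intro divide_nonneg_nonneg mult_nonneg_nonneg) (auto simp: power_le_one)
    qed (use M0 exp_le in auto)
    finally show ?thesis using w(3) by simp
  qed
  then have "M \<le> B + M / 2"
    unfolding M_def using zero_in_ball[OF p, of 1] by (intro cSup_least) auto
  then have "M \<le> 2 * B" by simp
  show ?thesis
    unfolding hom_bound_def
  proof
    fix z assume z: "z \<in> Cn n"
    have "cmod (hpoly n m c z) \<le> M * lp_norm n p z ^ m" by (rule hboundD[OF h z])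
    also have "\<dots> \<le> 2 * B * lp_norm n p z ^ m"
      using \<open>M \<le> 2 * B\<close> lp_norm_nonneg[OF p] by (intro mult_right_mono) auto
    finally show "cmod (hpoly n m c z) \<le> 2 * B * lp_norm n p z ^ m" .
  qed
qed

text \<open>
  Bound the \<open>\<l>\<^sub>2\<close> norm of the terms by their \<open>\<l>\<^sub>q\<close> norm. In the \<open>q\<close>-th powers, replace all but one factor
  of the multinomial coefficient by \<open>m!\<close> and apply the multinomial theorem.
\<close>

lemma multinomial_variance:
  assumes q: "1 \<le> q" "q \<le> 2"
  shows "(\<Sum>\<alpha>\<in>MI n m. (multinom n \<alpha> * cmod (monomial n \<alpha> w))\<^sup>2)
    \<le> ((fact m) powr (1 - 1/q) * lp_norm n (ereal q) w ^ m)\<^sup>2"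
proof -
  define y where "y = (\<lambda>\<alpha>. multinom n \<alpha> * cmod (monomial n \<alpha> w))"
  have mc0: "multinom n \<alpha> > 0" for \<alpha> using multinom_ge_1[of n \<alpha>] by linarith
  have y0: "y \<alpha> \<ge> 0" for \<alpha> using mc0[of \<alpha>] by (simp add: y_def)
  define S where "S = (\<Sum>\<alpha>\<in>MI n m. y \<alpha> powr q)"
  have S0: "S \<ge> 0" by (simp add: S_def sum_nonneg)
  have "S \<le> (\<Sum>\<alpha>\<in>MI n m. (fact m) powr (q - 1) * (multinom n \<alpha> * (\<Prod>k<n. (cmod (w k) powr q) ^ \<alpha> k)))"
    unfolding S_def
  proof (rule sum_mono)
    fix \<alpha> assume a: "\<alpha> \<in> MI n m"
    have "cmod (monomial n \<alpha> w) powr q = (\<Prod>k<n. (cmod (w k) powr q) ^ \<alpha> k)"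
      unfolding monomial_def prod_norm[symmetric] norm_power prod_powr_distrib by (simp add: power_powr_commute)
    moreover have "multinom n \<alpha> powr q = multinom n \<alpha> powr (q - 1) * multinom n \<alpha>"
      using mc0[of \<alpha>] by (simp add: powr_diff)
    moreover have "multinom n \<alpha> powr (q - 1) \<le> (fact m) powr (q - 1)"
      using multinom_le_fact[OF a] mc0[of \<alpha>] q by (intro powr_mono2) auto
    ultimately show "y \<alpha> powr q \<le> (fact m) powr (q - 1) * (multinom n \<alpha> * (\<Prod>k<n. (cmod (w k) powr q) ^ \<alpha> k))"
      using mc0[of \<alpha>] by (simp add: y_def powr_mult mult.assoc mult_right_mono prod_nonneg)
  qed
  also have "\<dots> = (fact m) powr (q - 1) * (\<Sum>k<n. cmod (w k) powr q) ^ m"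
    by (simp only: sum_distrib_left[symmetric] multinomial_theorem)
  also have "\<dots> = (fact m) powr (q - 1) * (lp_norm n (ereal q) w ^ m) powr q"
    using q by (simp add: lp_norm_powr[symmetric] power_powr_commute)
  finally have S: "S \<le> (fact m) powr (q - 1) * (lp_norm n (ereal q) w ^ m) powr q" .
  have "(\<Sum>\<alpha>\<in>MI n m. (y \<alpha>)\<^sup>2) = (\<Sum>\<alpha>\<in>MI n m. (y \<alpha> powr q) powr (2/q))"
    using y0 q by (intro sum.cong) (auto simp: powr_powr)
  also have "\<dots> \<le> S powr (2/q)"
    unfolding S_def using q by (intro sum_powr_superadditive finite_MI) auto
  also have "\<dots> \<le> ((fact m) powr (q - 1) * (lp_norm n (ereal q) w ^ m) powr q) powr (2/q)"
    using S S0 q by (intro powr_mono2) auto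
  also have "\<dots> = ((fact m) powr (1 - 1/q)) powr 2 * (lp_norm n (ereal q) w ^ m) powr 2"
  proof -
    have "(q - 1) * (2 / q) = (1 - 1/q) * 2" "q * (2 / q) = 2" using q by (auto simp: field_simps)
    then show ?thesis by (simp only: powr_mult powr_powr)
  qed
  also have "\<dots> = ((fact m) powr (1 - 1/q) * lp_norm n (ereal q) w ^ m)\<^sup>2"
    by (simp add: power_mult_distrib lp_norm_ereal)
  finally show ?thesis by (simp add: y_def)
qed

text \<open>
  By \<open>multinomial_variance\<close> the variance of the random polynomial at a point of the ball is at most
  \<open>(m!) powr (2 - 2/q)\<close>, up to a constant. Signs that are good at all points of a grid of mesh about \<open>1/(nm)\<close> exist, and the
  values on the grid control the polynomial on the ball. The grid has about \<open>(nm) powr (2n)\<close> points, so that taking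
  them all into account costs the factor \<open>sqrt (n * ln (98 * n * m))\<close>.
\<close>

theorem random_polynomial:
  assumes n: "0 < n" and m: "0 < m" and q: "1 \<le> q" "q \<le> 2"
  shows "\<exists>e. (\<forall>\<alpha>. e \<alpha> = 1 \<or> e \<alpha> = -1) \<and>
    hom_bound n (ereal q) m (\<lambda>\<alpha>. of_real (e \<alpha> * multinom n \<alpha>))
      (8 * exp 1 * (fact m) powr (1 - 1/q) * sqrt (2 * real n * ln (98 * real n * real m)))"
proof -
  have q': "1 \<le> ereal q" using q by simp
  \<comment> \<open>mesh \<open>1/T\<close> moves a point by at most \<open>n * (2/T) = 1/(12m)\<close> in norm\<close>
  define T where "T = 24 * n * m"
  have T: "T > 0" using n m by (simp add: T_def)
  define D where "D = index_box n (\<lambda>_. {..2 * T}) \<times> index_box n (\<lambda>_. {..2 * T})"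
  define V where "V = {x \<in> D. lp_norm n (ereal q) (grid_point n T x) \<le> 1 + 1 / real m}"
  define J where "J = V \<times> (UNIV :: bool set)"
  define val where "val = (\<lambda>x \<alpha>. of_real (multinom n \<alpha>) * monomial n \<alpha> (grid_point n T x))"
  define X where "X = (\<lambda>j \<alpha>. if snd j then Re (val (fst j) \<alpha>) else Im (val (fst j) \<alpha>))"
  define \<sigma> where "\<sigma> = exp 1 * (fact m) powr (1 - 1/q)"
  define K where "K = 2 * real (2 * T + 1) ^ (2 * n)"
  have finD: "finite D" by (simp add: D_def finite_index_box)
  have cD: "card D = (2 * T + 1) ^ (2 * n)"
    by (simp add: D_def card_index_box card_cartesian_product mult_2 power_add)
  have cJ: "real (card J) \<le> K"
  proof -
    have "card V \<le> card D" unfolding V_def using finD by (intro card_mono) auto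
    then have "card J \<le> 2 * (2 * T + 1) ^ (2 * n)" by (simp add: J_def card_cartesian_product cD)
    then have "real (card J) \<le> real (2 * (2 * T + 1) ^ (2 * n))" by (rule of_nat_mono)
    then show ?thesis by (simp add: K_def)
  qed
  have K1: "1 \<le> K"
  proof -
    have "1 \<le> real (2 * T + 1) ^ (2 * n)" by (intro one_le_power) simp
    then show ?thesis unfolding K_def by linarith
  qed
  have var: "(\<Sum>\<alpha>\<in>MI n m. (X j \<alpha>)\<^sup>2) \<le> \<sigma>\<^sup>2" if j: "j \<in> J" for j
  proof -
    define w where "w = grid_point n T (fst j)"
    have wN: "lp_norm n (ereal q) w \<le> 1 + 1 / real m" using j by (auto simp: J_def V_def w_def)
    have "(\<Sum>\<alpha>\<in>MI n m. (X j \<alpha>)\<^sup>2) \<le> (\<Sum>\<alpha>\<in>MI n m. (multinom n \<alpha> * cmod (monomial n \<alpha> w))\<^sup>2)"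
    proof (rule sum_mono)
      fix \<alpha>
      have "\<bar>X j \<alpha>\<bar> \<le> cmod (val (fst j) \<alpha>)" by (simp add: X_def abs_Re_le_cmod abs_Im_le_cmod)
      also have "\<dots> = \<bar>multinom n \<alpha> * cmod (monomial n \<alpha> w)\<bar>"
        by (simp add: val_def norm_mult w_def abs_mult)
      finally show "(X j \<alpha>)\<^sup>2 \<le> (multinom n \<alpha> * cmod (monomial n \<alpha> w))\<^sup>2" by (simp add: abs_le_square_iff)
    qed
    also have "\<dots> \<le> ((fact m) powr (1 - 1/q) * lp_norm n (ereal q) w ^ m)\<^sup>2"
      by (rule multinomial_variance[OF q])
    also have "\<dots> \<le> ((fact m) powr (1 - 1/q) * exp 1)\<^sup>2"
    proof (intro power_mono mult_left_mono)
      have "lp_norm n (ereal q) w ^ m \<le> (1 + 1 / real m) ^ m"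
        using wN lp_norm_nonneg[OF q' n] by (intro power_mono) auto
      also have "\<dots> \<le> exp 1" by (rule one_plus_inverse_power_le_exp[OF m])
      finally show "lp_norm n (ereal q) w ^ m \<le> exp 1" .
    qed (use lp_norm_nonneg[OF q' n, of w] in auto)
    finally show ?thesis by (simp add: \<sigma>_def mult.commute)
  qed
  have \<sigma>: "\<sigma> > 0" by (simp add: \<sigma>_def)
  have finJ: "finite J" unfolding J_def V_def using finD by auto
  have "\<exists>e. (\<forall>\<alpha>. e \<alpha> = 1 \<or> e \<alpha> = -1) \<and>
      (\<forall>j\<in>J. \<bar>\<Sum>\<alpha>\<in>MI n m. e \<alpha> * X j \<alpha>\<bar> \<le> 2 * \<sigma> * sqrt (ln (2 * K)))"
    by (rule exists_signs_uniform[OF finite_MI finJ cJ K1 \<sigma> var])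
  then obtain e where e: "\<forall>\<alpha>. e \<alpha> = 1 \<or> e \<alpha> = -1"
    "\<forall>j\<in>J. \<bar>\<Sum>\<alpha>\<in>MI n m. e \<alpha> * X j \<alpha>\<bar> \<le> 2 * \<sigma> * sqrt (ln (2 * K))"
    by (elim exE conjE) (rule that)
  define c where "c = (\<lambda>\<alpha>. complex_of_real (e \<alpha> * multinom n \<alpha>))"
  define B where "B = 4 * \<sigma> * sqrt (ln (2 * K))"
  have Pgrid: "cmod (hpoly n m c (grid_point n T x)) \<le> B" if "x \<in> V" for x
  proof -
    have h: "hpoly n m c (grid_point n T x) = (\<Sum>\<alpha>\<in>MI n m. of_real (e \<alpha>) * val x \<alpha>)"
      by (simp add: hpoly_def c_def val_def mult.assoc)
    have "Re (hpoly n m c (grid_point n T x)) = (\<Sum>\<alpha>\<in>MI n m. e \<alpha> * X (x, True) \<alpha>)"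
      "Im (hpoly n m c (grid_point n T x)) = (\<Sum>\<alpha>\<in>MI n m. e \<alpha> * X (x, False) \<alpha>)"
      unfolding h by (simp_all add: X_def)
    moreover have "(x, True) \<in> J" "(x, False) \<in> J" using that by (auto simp: J_def)
    ultimately have "\<bar>Re (hpoly n m c (grid_point n T x))\<bar> \<le> 2 * \<sigma> * sqrt (ln (2 * K))"
      "\<bar>Im (hpoly n m c (grid_point n T x))\<bar> \<le> 2 * \<sigma> * sqrt (ln (2 * K))"
      using e(2) by simp_all
    then show ?thesis
      using cmod_le[of "hpoly n m c (grid_point n T x)"] unfolding B_def by linarith
  qed
  have "hom_bound n (ereal q) m c (2 * B)"
  proof (rule hom_bound_from_net[OF q' n m])
    fix z assume z: "z \<in> Cn n" "lp_norm n (ereal q) z \<le> 1"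
    have "cmod (z k) \<le> 1" if "k < n" for k
      using component_le_lp_norm[OF q' that, of z] z by simp
    then obtain x where x: "x \<in> D" "\<And>k. cmod (grid_point n T x k - z k) \<le> 2 / real T"
      using grid_approximation[OF T z(1)] unfolding D_def by blast
    have "lp_norm n (ereal q) (\<lambda>k. grid_point n T x k - z k) \<le> (\<Sum>k<n. cmod (grid_point n T x k - z k))"
      by (rule lp_norm_le_sum[OF q' n])
    also have "\<dots> \<le> (\<Sum>k<n. 2 / real T)" by (intro sum_mono x)
    also have "\<dots> = 1 / (12 * real m)" using n m by (simp add: T_def field_simps)
    finally have d: "lp_norm n (ereal q) (\<lambda>k. grid_point n T x k - z k) \<le> 1 / (12 * real m)" .
    have "lp_norm n (ereal q) (\<lambda>k. z k + (grid_point n T x k - z k)) \<le> 1 + 1 / (12 * real m)"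
      using lp_norm_triangle[OF q' n, of z "\<lambda>k. grid_point n T x k - z k"] z d by linarith
    also have "\<dots> \<le> 1 + 1 / real m" using m by (simp add: field_simps)
    finally have "x \<in> V" using x by (simp add: V_def)
    then show "\<exists>w\<in>Cn n. lp_norm n (ereal q) (\<lambda>k. w k - z k) \<le> 1 / (12 * real m) \<and> cmod (hpoly n m c w) \<le> B"
      using d Pgrid by (intro bexI[of _ "grid_point n T x"]) (auto simp: Cn_def grid_point_def)
  qed
  moreover have "2 * B \<le> 8 * exp 1 * (fact m) powr (1 - 1/q) * sqrt (2 * real n * ln (98 * real n * real m))"
  proof -
    have nm: "real n \<ge> 1" "real m \<ge> 1" using n m by auto
    have nm1: "1 \<le> real n * real m" using nm mult_mono[of 1 "real n" 1 "real m"] by simp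
    define y where "y = real n * real m"
    have y1: "1 \<le> y" using nm1 by (simp only: y_def)
    have y98: "98 * real n * real m = 98 * y" by (simp only: y_def mult.assoc)
    have "real (2 * T + 1) = 48 * y + 1" by (simp add: T_def y_def)
    then have "2 * K = 4 * (48 * y + 1) ^ (2 * n)" by (simp only: K_def)
    also have "\<dots> \<le> 2 ^ (2 * n) * (49 * y) ^ (2 * n)"
    proof (intro mult_mono power_mono)
      have "(2::real) ^ 2 \<le> 2 ^ (2 * n)" using n by (intro power_increasing) auto
      then show "4 \<le> (2::real) ^ (2 * n)" by simp
    qed (use y1 in \<open>simp_all add: zero_le_power\<close>)
    also have "\<dots> = (2 * (49 * y)) ^ (2 * n)" by (rule power_mult_distrib[symmetric])
    also have "2 * (49 * y) = 98 * real n * real m" unfolding y98 by simp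
    finally have "ln (2 * K) \<le> ln ((98 * real n * real m) ^ (2 * n))" using K1 by simp
    also have "\<dots> = 2 * real n * ln (98 * real n * real m)" using n m by (simp add: ln_realpow)
    finally have "sqrt (ln (2 * K)) \<le> sqrt (2 * real n * ln (98 * real n * real m))" by simp
    then have "8 * \<sigma> * sqrt (ln (2 * K)) \<le> 8 * \<sigma> * sqrt (2 * real n * ln (98 * real n * real m))"
      using \<sigma> by (intro mult_left_mono) auto
    then show ?thesis by (simp add: B_def \<sigma>_def mult_ac)
  qed
  then have "2 * B * r ^ m \<le> 8 * exp 1 * (fact m) powr (1 - 1/q) * sqrt (2 * real n * ln (98 * real n * real m)) * r ^ m"
    if "r \<ge> 0" for r using that by (intro mult_right_mono) auto
  then have "hom_bound n (ereal q) m c (8 * exp 1 * (fact m) powr (1 - 1/q) * sqrt (2 * real n * ln (98 * real n * real m)))"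
    using \<open>hom_bound n (ereal q) m c (2 * B)\<close> lp_norm_nonneg[OF q' n] unfolding hom_bound_def by (meson order_trans)
  then show ?thesis using e(1) unfolding c_def by blast
qed

section \<open>Upper bounds\<close>

definition recip_exponent :: "ereal \<Rightarrow> real"
  where "recip_exponent p = (if p = \<infinity> then 0 else 1 / real_of_ereal p)"

definition min2 :: "ereal \<Rightarrow> real"
  where "min2 p = (if p = \<infinity> then 2 else min (real_of_ereal p) 2)"

lemma min2_bounds: "1 \<le> p \<Longrightarrow> 1 \<le> min2 p \<and> min2 p \<le> 2"
  by (cases p rule: exponent_cases) (auto simp: min2_def)

lemma lp_norm_constant:
  assumes "1 \<le> p" "0 < n"
  shows "lp_norm n p (\<lambda>k. if k < n then c else 0) = cmod c * real n powr recip_exponent p"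
  using assms(1)
proof (cases p rule: exponent_cases)
  case 1
  have "(\<lambda>k. cmod (if k < n then c else 0)) ` {..<n} = {cmod c}" using assms by force
  then show ?thesis using 1 assms by (simp add: lp_norm_inf recip_exponent_def)
next
  case (2 r)
  then show ?thesis using assms by (simp add: lp_norm_ereal recip_exponent_def powr_mult powr_powr)
qed

text \<open>
  The random polynomials are estimated on balls with exponent at most 2. This transfers the estimate to \<open>p > 2\<close>, by
  Hoelder's inequality.
\<close>

lemma lp_norm_min2_le:
  assumes p: "1 \<le> p" "0 < n"
  shows "lp_norm n (ereal (min2 p)) z \<le> real n powr (1 / min2 p - recip_exponent p) * lp_norm n p z"
  using p(1)
proof (cases p rule: exponent_cases)
  case 1
  define M where "M = lp_norm n p z"
  have "lp_norm n (ereal 2) z \<le> lp_norm n (ereal 2) (\<lambda>k. if k < n then of_real M else 0)"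
    using component_le_lp_norm[OF p(1), of _ n z] lp_norm_nonneg[OF p, of z] p
    by (intro lp_norm_mono) (auto simp: M_def)
  also have "\<dots> = M * real n powr (1/2)"
    using p lp_norm_nonneg[OF p, of z] by (subst lp_norm_constant) (auto simp: recip_exponent_def M_def)
  finally show ?thesis using 1 by (simp add: min2_def recip_exponent_def M_def mult.commute)
next
  case (2 r)
  show ?thesis
  proof (cases "r \<le> 2")
    case True
    then show ?thesis using 2 p by (simp add: min2_def recip_exponent_def)
  next
    case False
    have "(\<Sum>k<n. cmod (z k) powr 2) \<le> real (card {..<n}) powr (1 - 1/(r/2)) * (\<Sum>k<n. (cmod (z k) powr 2) powr (r/2)) powr (1/(r/2))"
      using False by (intro power_mean_sum) auto
    also have "(\<Sum>k<n. (cmod (z k) powr 2) powr (r/2)) = (\<Sum>k<n. cmod (z k) powr r)"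
      by (simp only: powr_powr) simp
    finally have "(\<Sum>k<n. cmod (z k) powr 2) powr (1/2)
        \<le> (real n powr (1 - 2/r) * (\<Sum>k<n. cmod (z k) powr r) powr (2/r)) powr (1/2)"
      by (intro powr_mono2 sum_nonneg) auto
    also have "\<dots> = real n powr (1/2 - 1/r) * (\<Sum>k<n. cmod (z k) powr r) powr (1/r)"
      by (simp only: powr_mult powr_powr) (simp add: diff_divide_distrib)
    finally show ?thesis using False 2 by (simp only: min2_def recip_exponent_def lp_norm_ereal) (simp add: min_def)
  qed
qed

text \<open>
  On the vector with all coordinates equal to \<open>t\<close>, the multinomial theorem evaluates the monomial sum of the random
  polynomial as \<open>(n * t) ^ m\<close>. It is at most the sup norm of the polynomial on the unit ball.
\<close>

theorem bohr_radius_power_le: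
  assumes p: "1 \<le> p" and n: "0 < n" and m: "0 < m"
  shows "bohr_radius n p ^ m \<le> 8 * exp 1 * sqrt (2 * real n * ln (98 * real n * real m))
    * (fact m / real n ^ m) powr (1 - 1 / min2 p)"
proof -
  define q where "q = min2 p"
  define \<nu> where "\<nu> = recip_exponent p"
  define \<rho> where "\<rho> = bohr_radius n p"
  have q: "1 \<le> q" "q \<le> 2" using min2_bounds[OF p] by (auto simp: q_def)
  have q': "1 \<le> ereal q" using q by simp
  have b: "bohr_property n p \<rho>" unfolding \<rho>_def by (rule bohr_radius_greatest(1)[OF p n])
  define X where "X = sqrt (2 * real n * ln (98 * real n * real m))"
  define M where "M = 8 * exp 1 * (fact m) powr (1 - 1/q) * X"
  have "1 \<le> real n * real m" using n m mult_mono[of 1 "real n" 1 "real m"] by simp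
  then have X: "X > 0" using n by (simp add: X_def mult.assoc)
  have M: "M > 0" using X by (simp add: M_def)
  have np: "real n powr s > 0" for s using n by simp
  obtain e where e: "\<forall>\<alpha>. e \<alpha> = 1 \<or> e \<alpha> = -1" "hom_bound n (ereal q) m (\<lambda>\<alpha>. complex_of_real (e \<alpha> * multinom n \<alpha>)) M"
    using random_polynomial[OF n m q] unfolding M_def X_def by blast
  define M' where "M' = M * (real n powr (1/q - \<nu>)) ^ m"
  have M': "M' > 0" using M np by (simp add: M'_def)
  define c where "c = (\<lambda>\<alpha>. complex_of_real (e \<alpha> * multinom n \<alpha> / M'))"
  have hb: "hom_bound n p m c 1"
    unfolding hom_bound_def
  proof
    fix z assume z: "z \<in> Cn n"
    have "hpoly n m c z = hpoly n m (\<lambda>\<alpha>. complex_of_real (e \<alpha> * multinom n \<alpha>)) z / of_real M'"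
      by (simp add: hpoly_def c_def sum_divide_distrib)
    then have "cmod (hpoly n m c z) = cmod (hpoly n m (\<lambda>\<alpha>. complex_of_real (e \<alpha> * multinom n \<alpha>)) z) / M'"
      using M' by (simp add: norm_divide)
    also have "\<dots> \<le> (M * lp_norm n (ereal q) z ^ m) / M'"
      using hboundD[OF e(2) z] M' by (intro divide_right_mono) auto
    also have "\<dots> \<le> (M * (real n powr (1/q - \<nu>) * lp_norm n p z) ^ m) / M'"
      using lp_norm_min2_le[OF p n, of z] lp_norm_nonneg[OF q' n, of z] M M'
      by (intro divide_right_mono mult_left_mono power_mono) (auto simp: q_def \<nu>_def)
    also have "\<dots> = 1 * lp_norm n p z ^ m" using M M' np by (simp add: M'_def power_mult_distrib)
    finally show "cmod (hpoly n m c z) \<le> 1 * lp_norm n p z ^ m" .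
  qed
  \<comment> \<open>\<open>t\<close> is chosen such that the constant vector \<open>z\<close> has norm \<open>r\<close>\<close>
  have key: "r ^ m \<le> 8 * exp 1 * X * (fact m / real n ^ m) powr (1 - 1/q)" if r: "0 < r" "r < \<rho>" for r
  proof -
    define t where "t = r * real n powr (- \<nu>)"
    have t: "t > 0" using r np by (simp add: t_def)
    define z where "z = (\<lambda>k. if k < n then complex_of_real t else 0)"
    have "lp_norm n p z = t * real n powr \<nu>"
      unfolding z_def \<nu>_def lp_norm_constant[OF p n] using t by simp
    also have "\<dots> = r" using n by (simp add: t_def powr_minus)
    finally have z: "z \<in> lp_ball n p \<rho>" using r by (simp add: lp_ball_def z_def Cn_def)
    have "(\<Sum>\<alpha>\<in>MI n m. cmod (c \<alpha> * monomial n \<alpha> z)) = (\<Sum>\<alpha>\<in>MI n m. multinom n \<alpha> * (\<Prod>k<n. t ^ \<alpha> k) / M')"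
    proof (rule sum.cong[OF refl])
      fix \<alpha>
      have "\<bar>e \<alpha>\<bar> = 1" using e(1)[rule_format, of \<alpha>] by auto
      moreover have "multinom n \<alpha> > 0" using multinom_ge_1[of n \<alpha>] by linarith
      moreover have "cmod (monomial n \<alpha> z) = (\<Prod>k<n. t ^ \<alpha> k)"
        unfolding monomial_def prod_norm[symmetric] norm_power using t by (intro prod.cong) (auto simp: z_def)
      ultimately show "cmod (c \<alpha> * monomial n \<alpha> z) = multinom n \<alpha> * (\<Prod>k<n. t ^ \<alpha> k) / M'"
        using M' by (simp add: c_def norm_mult norm_divide abs_mult)
    qed
    also have "\<dots> = (\<Sum>k<n. t) ^ m / M'"
      unfolding sum_divide_distrib[symmetric] multinomial_theorem ..
    finally have "(real n * t) ^ m / M' \<le> 1"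
      using bohr_property_hpoly[OF b p n m hb z] by simp
    then have "(real n * t) ^ m \<le> M'" using M' by simp
    then have "(real n * real n powr (- \<nu>)) ^ m * r ^ m \<le> M * (real n powr (1/q - \<nu>)) ^ m"
      by (simp add: t_def M'_def power_mult_distrib mult_ac)
    also have "real n * real n powr (- \<nu>) = real n powr (1 - 1/q) * real n powr (1/q - \<nu>)"
      using n by (simp add: powr_mult_base flip: powr_add)
    finally have "(real n powr (1/q - \<nu>)) ^ m * ((real n powr (1 - 1/q)) ^ m * r ^ m) \<le> (real n powr (1/q - \<nu>)) ^ m * M"
      by (simp add: power_mult_distrib mult_ac)
    then have "(real n powr (1 - 1/q)) ^ m * r ^ m \<le> M" using np by simp
    then have "r ^ m \<le> M / (real n powr (1 - 1/q)) ^ m" using np by (simp add: pos_le_divide_eq mult.commute)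
    also have "(real n powr (1 - 1/q)) ^ m = (real n ^ m) powr (1 - 1/q)" by (simp add: power_powr_commute)
    finally show ?thesis by (simp add: M_def powr_divide mult_ac)
  qed
  have "\<rho> ^ m \<le> 8 * exp 1 * X * (fact m / real n ^ m) powr (1 - 1/q)"
  proof (cases "\<rho> > 0")
    case True
    show ?thesis
    proof (rule tendsto_upperbound)
      show "((\<lambda>r. r ^ m) \<longlongrightarrow> \<rho> ^ m) (at_left \<rho>)" by (intro tendsto_intros)
      show "\<forall>\<^sub>F r in at_left \<rho>. r ^ m \<le> 8 * exp 1 * X * (fact m / real n ^ m) powr (1 - 1/q)"
        using key True by (auto simp: eventually_at_left_field)
    qed simp
  next
    case False
    have "bohr_property n p 0" by (simp add: bohr_property_def lp_ball_empty[OF p n])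
    then have "\<rho> = 0" using False bohr_radius_greatest(2)[OF p n, of 0] by (simp add: \<rho>_def)
    then show ?thesis using m X by (simp add: zero_power)
  qed
  then show ?thesis by (simp add: \<rho>_def X_def q_def)
qed

lemma bohr_radius_nonneg: "1 \<le> p \<Longrightarrow> 0 < n \<Longrightarrow> 0 \<le> bohr_radius n p"
  by (rule bohr_radius_greatest(2)) (auto simp: bohr_property_def lp_ball_empty)

text \<open>
  The induction step is \<open>e \<le> (1 + 1/m) ^ (m + 1)\<close>. The factor \<open>e powr (-m)\<close> is needed for the constant 1 in the
  asymptotics.
\<close>

lemma fact_le_Stirling:
  assumes "m > 0" shows "fact m \<le> exp 1 * real m * (real m / exp 1) ^ m"
  using assms
proof (induction m rule: nat_induct_non_zero)
  case 1
  show ?case by simp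
next
  case (Suc m)
  have m: "real m > 0" using Suc by simp
  have "ln (real m / real (Suc m)) \<le> real m / real (Suc m) - 1"
    using m by (intro ln_le_minus_one) auto
  then have "1 / real (Suc m) \<le> ln (real (Suc m) / real m)"
    using m by (simp add: ln_div field_simps)
  then have "1 \<le> real (Suc m) * ln (real (Suc m) / real m)"
    by (simp add: field_simps)
  also have "\<dots> = ln ((real (Suc m) / real m) ^ Suc m)"
    using m by (subst ln_realpow) auto
  finally have "exp 1 \<le> (real (Suc m) / real m) ^ Suc m"
    using m by (subst (asm) ln_ge_iff) auto
  then have k: "exp 1 * real m ^ Suc m \<le> real (Suc m) ^ Suc m"
    using m by (simp add: power_divide pos_le_divide_eq del: power_Suc)
  have "fact (Suc m) \<le> real (Suc m) * (exp 1 * real m * (real m / exp 1) ^ m)"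
    using Suc by (simp del: of_nat_Suc)
  also have "\<dots> = exp 1 * real (Suc m) * (exp 1 * real m ^ Suc m) / exp 1 ^ Suc m"
    by (simp add: power_divide)
  also have "\<dots> \<le> exp 1 * real (Suc m) * real (Suc m) ^ Suc m / exp 1 ^ Suc m"
    using k by (intro divide_right_mono mult_left_mono) auto
  finally show ?case by (simp add: power_divide)
qed

text \<open>
  The degree of the random polynomials that nearly minimizes the upper bound of the Bohr radius.
\<close>

definition log_degree :: "nat \<Rightarrow> nat"
  where "log_degree n = nat \<lceil>ln (real n)\<rceil>"

lemma log_degree:
  assumes "n \<ge> 2"
  shows "0 < log_degree n" "ln (real n) \<le> log_degree n" "real (log_degree n) \<le> ln (real n) + 1"
    "real n \<le> exp 1 ^ log_degree n"
    "ln (98 * real n * real (log_degree n)) \<le> 8 * real (log_degree n)"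
proof -
  have L: "ln (real n) > 0" using assms by simp
  show m0: "0 < log_degree n" using L by (simp add: log_degree_def)
  show m1: "ln (real n) \<le> log_degree n" "real (log_degree n) \<le> ln (real n) + 1"
    using L by (auto simp: log_degree_def)
  have "real n = exp (ln (real n))" using assms by simp
  also have "\<dots> \<le> exp (real (log_degree n))" using m1 by simp
  also have "\<dots> = exp 1 ^ log_degree n" by (simp add: exp_of_nat_mult[of _ 1, simplified])
  finally show "real n \<le> exp 1 ^ log_degree n" .
  have "ln (98 * real n * real (log_degree n)) = ln 98 + ln (real n) + ln (real (log_degree n))"
    using assms m0 by (simp add: ln_mult)
  also have "\<dots> \<le> 6 + real (log_degree n) + real (log_degree n)"
  proof (intro add_mono m1)
    have "(98::real) \<le> (5/2) ^ 6" by (simp add: power_divide)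
    also have "\<dots> \<le> exp 1 ^ 6" using exp_lower_Taylor_quadratic[of 1] by (intro power_mono) auto
    also have "\<dots> = exp 6" by (simp flip: exp_of_nat_mult)
    finally have "ln 98 \<le> ln (exp (6::real))" by (subst ln_le_cancel_iff) auto
    then show "ln 98 \<le> (6::real)" by simp
    show "ln (real (log_degree n)) \<le> real (log_degree n)" using m0 by (intro ln_bound) auto
  qed
  also have "\<dots> \<le> 8 * real (log_degree n)" using m0 by simp
  finally show "ln (98 * real n * real (log_degree n)) \<le> 8 * real (log_degree n)" .
qed

theorem bohr_radius_le_log:
  assumes p: "1 \<le> p" and n: "n \<ge> 2"
  shows "bohr_radius n p \<le> 900 * (ln (real n) / real n) powr (1 - 1 / min2 p)"
proof -
  define m where "m = log_degree n"
  define s where "s = 1 - 1 / min2 p"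
  note m = log_degree[OF n, folded m_def]
  have n0: "0 < n" using n by simp
  have s: "0 \<le> s" "s \<le> 1" using min2_bounds[OF p] by (auto simp: s_def)
  have ln0: "0 \<le> ln (98 * real n * real m)"
  proof -
    have "1 \<le> 98 * real n * real m"
      using n m(1) mult_mono[of 1 "real n" 1 "real m"] by simp
    then show ?thesis by simp
  qed
  have L: "ln (real n) \<ge> 1/2"
  proof -
    have "exp (1/2) \<le> (2::real)" by (rule exp_half_le2)
    also have "\<dots> \<le> real n" using n by simp
    finally show ?thesis using n by (subst ln_ge_iff) auto
  qed
  have "bohr_radius n p ^ m \<le> 8 * exp 1 * sqrt (2 * real n * ln (98 * real n * real m)) * (fact m / real n ^ m) powr s"
    unfolding s_def by (rule bohr_radius_power_le[OF p n0 m(1)])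
  also have "\<dots> \<le> 300 ^ m * ((real m / real n) powr s) ^ m"
  proof (intro mult_mono)
    have "sqrt (2 * real n * ln (98 * real n * real m)) \<le> sqrt (2 * exp 1 ^ m * (8 * exp 1 ^ m))"
    proof (intro real_sqrt_le_mono mult_mono)
      have "real m \<le> exp (real m)" using exp_ge_add_one_self[of "real m"] by linarith
      then have "8 * real m \<le> 8 * exp 1 ^ m" by (simp add: exp_of_nat_mult[of _ 1, simplified])
      then show "ln (98 * real n * real m) \<le> 8 * exp 1 ^ m" using m(5) by linarith
    qed (use m(4) ln0 in auto)
    also have "\<dots> \<le> sqrt ((4 * exp 1 ^ m)\<^sup>2)"
      by (intro real_sqrt_le_mono) (simp add: power2_eq_square)
    also have "\<dots> = 4 * exp 1 ^ m" by (subst real_sqrt_abs) simp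
    also have "\<dots> \<le> 4 * 3 ^ m" using exp_le by (intro mult_left_mono power_mono) auto
    finally have "sqrt (2 * real n * ln (98 * real n * real m)) \<le> 4 * 3 ^ m" .
    then have "8 * exp 1 * sqrt (2 * real n * ln (98 * real n * real m)) \<le> 8 * 3 * (4 * 3 ^ m)"
      using exp_le ln0 by (intro mult_mono real_sqrt_ge_zero mult_nonneg_nonneg) auto
    also have "\<dots> = 96 ^ 1 * 3 ^ m" by simp
    also have "\<dots> \<le> 100 ^ m * 3 ^ m"
    proof (intro mult_right_mono)
      have "(96::real) ^ 1 \<le> 100 ^ 1" by simp
      also have "\<dots> \<le> 100 ^ m" using m(1) by (intro power_increasing) auto
      finally show "(96::real) ^ 1 \<le> 100 ^ m" .
    qed simp
    finally show "8 * exp 1 * sqrt (2 * real n * ln (98 * real n * real m)) \<le> 300 ^ m"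
      by (simp flip: power_mult_distrib)
    have "fact m \<le> real m ^ m" using fact_le_power[of m, where 'a = real] by simp
    then have "(fact m / real n ^ m) powr s \<le> ((real m / real n) ^ m) powr s"
      using s by (intro powr_mono2) (auto simp: power_divide divide_right_mono)
    then show "(fact m / real n ^ m) powr s \<le> ((real m / real n) powr s) ^ m" by (simp add: power_powr_commute)
  qed auto
  also have "\<dots> = (300 * (real m / real n) powr s) ^ m" by (simp add: power_mult_distrib)
  finally have "bohr_radius n p ^ m \<le> (300 * (real m / real n) powr s) ^ m" .
  then have "bohr_radius n p \<le> 300 * (real m / real n) powr s"
    using m(1) by (subst (asm) power_mono_iff) (auto simp: bohr_radius_nonneg[OF p n0])
  also have "\<dots> \<le> 300 * (3 * (ln (real n) / real n)) powr s"
    using m(3) L s n by (intro mult_left_mono powr_mono2) (auto simp: divide_right_mono)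
  also have "\<dots> = 300 * (3 powr s * (ln (real n) / real n) powr s)" by (simp only: powr_mult)
  also have "\<dots> \<le> 300 * (3 * (ln (real n) / real n) powr s)"
    using powr_mono[of s 1 "3::real"] s by (intro mult_left_mono mult_right_mono) auto
  finally show ?thesis by (simp add: s_def)
qed

text \<open>
  After taking \<open>m\<close>-th roots, the factors \<open>n powr (1/(2m))\<close> of the sup norm and \<open>e powr (-1/2)\<close> of Stirling's bound
  cancel because \<open>n \<le> e ^ m\<close>. All that remains are the root of a multiple of \<open>m\<close> and
  \<open>sqrt (m / ln n)\<close>, and both tend to 1.
\<close>

theorem bohr_radius_polydisc_le:
  assumes n: "n \<ge> 2"
  shows "bohr_radius n \<infinity> / sqrt (ln (real n) / real n)
    \<le> (8 * exp 1 * sqrt (16 * exp 1) * (real (log_degree n))) powr (1 / real (log_degree n)) * sqrt ((ln (real n) + 1) / ln (real n))"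
proof -
  define m where "m = log_degree n"
  note m = log_degree[OF n, folded m_def]
  have n0: "0 < n" using n by simp
  have L: "ln (real n) > 0" using n by simp
  define D where "D = 8 * exp 1 * sqrt (16 * exp 1) * real m"
  have D: "D > 0" using m(1) by (simp add: D_def)
  define R where "R = bohr_radius n \<infinity>"
  have R0: "R \<ge> 0" unfolding R_def using n0 by (intro bohr_radius_nonneg) auto
  have "R ^ m \<le> 8 * exp 1 * sqrt (2 * real n * ln (98 * real n * real m)) * (fact m / real n ^ m) powr (1 - 1 / min2 \<infinity>)"
    unfolding R_def by (rule bohr_radius_power_le[OF _ n0 m(1)]) simp
  also have "(fact m / real n ^ m) powr (1 - 1 / min2 \<infinity>) = sqrt (fact m / real n ^ m)"
    by (simp add: min2_def powr_half_sqrt)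
  also have "8 * exp 1 * sqrt (2 * real n * ln (98 * real n * real m)) * sqrt (fact m / real n ^ m)
      = 8 * exp 1 * sqrt (2 * real n * ln (98 * real n * real m) * (fact m / real n ^ m))"
    by (simp only: real_sqrt_mult mult.assoc)
  also have "\<dots> \<le> 8 * exp 1 * sqrt (2 * exp 1 ^ m * (8 * real m) * (exp 1 * real m * (real m / exp 1) ^ m / real n ^ m))"
  proof (intro mult_left_mono real_sqrt_le_mono mult_mono divide_right_mono fact_le_Stirling m)
    have "1 \<le> 98 * real n * real m"
      using n m(1) mult_mono[of 1 "real n" 1 "real m"] by simp
    then show "0 \<le> ln (98 * real n * real m)" by simp
  qed auto
  also have "2 * exp 1 ^ m * (8 * real m) * (exp 1 * real m * (real m / exp 1) ^ m / real n ^ m)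
      = (16 * exp 1) * (real m)\<^sup>2 * (real m / real n) ^ m"
    by (simp add: power_divide power2_eq_square)
  also have "8 * exp 1 * sqrt \<dots> = D * sqrt (real m / real n) ^ m"
    by (simp add: D_def real_sqrt_mult real_sqrt_power mult_ac)
  also have "D = (D powr (1 / real m)) ^ m"
    using D m(1) by (simp add: powr_power)
  finally have "R ^ m \<le> (D powr (1 / real m) * sqrt (real m / real n)) ^ m" by (simp add: power_mult_distrib)
  then have "R \<le> D powr (1 / real m) * sqrt (real m / real n)"
    using m(1) R0 by (subst (asm) power_mono_iff) auto
  then have "R / sqrt (ln (real n) / real n) \<le> D powr (1 / real m) * sqrt (real m / real n) / sqrt (ln (real n) / real n)"
    using L n by (intro divide_right_mono) auto
  also have "\<dots> = D powr (1 / real m) * sqrt (real m / ln (real n))"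
    using L n by (simp add: real_sqrt_divide)
  also have "\<dots> \<le> D powr (1 / real m) * sqrt ((ln (real n) + 1) / ln (real n))"
    using m(3) L by (intro mult_left_mono real_sqrt_le_mono divide_right_mono) auto
  finally show ?thesis by (simp add: R_def D_def m_def)
qed

lemma log_degree_at_top: "filterlim log_degree at_top sequentially"
proof -
  have "filterlim (\<lambda>n::nat. ln (real n)) at_top sequentially" by real_asymp
  then have "filterlim (\<lambda>n. real (log_degree n)) at_top sequentially"
    by (rule filterlim_at_top_mono) (auto simp: log_degree_def eventually_sequentially intro!: exI[of _ 1])
  then show ?thesis by (simp add: filterlim_sequentially_iff_filterlim_real)
qed

section \<open>The Bohr radius\<close>

theorem bohr_radius_polydisc_asymptotic:
  "(\<lambda>n. bohr_radius n \<infinity> / sqrt (ln (real n) / real n)) \<longlonglongrightarrow> 1"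
proof (rule order_tendstoI)
  fix a :: real assume a: "a < 1"
  define \<epsilon> where "\<epsilon> = (1 - max a 0) / 2"
  have \<epsilon>: "0 < \<epsilon>" "\<epsilon> < 1" "a < 1 - \<epsilon>" using a by (auto simp: \<epsilon>_def max_def field_simps)
  show "\<forall>\<^sub>F n in sequentially. a < bohr_radius n \<infinity> / sqrt (ln (real n) / real n)"
    using bohr_radius_polydisc_eventually_ge[OF \<epsilon>(1,2)] eventually_ge_at_top[of 2]
  proof eventually_elim
    case (elim n)
    have "sqrt (ln (real n) / real n) > 0" using elim by simp
    then have "1 - \<epsilon> \<le> bohr_radius n \<infinity> / sqrt (ln (real n) / real n)"
      using elim by (simp only: pos_le_divide_eq)
    then show ?case using \<epsilon> by simp
  qed
next
  fix a :: real assume a: "1 < a"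
  define C where "C = 8 * exp 1 * sqrt (16 * exp (1::real))"
  have C: "C > 0" by (simp add: C_def)
  have "(\<lambda>m::nat. (C * real m) powr (1 / real m)) \<longlonglongrightarrow> 1"
    using C by real_asymp
  then have "((\<lambda>n. (C * real (log_degree n)) powr (1 / real (log_degree n))) \<longlonglongrightarrow> 1)"
    by (rule filterlim_compose[OF _ log_degree_at_top])
  moreover have "(\<lambda>n::nat. sqrt ((ln (real n) + 1) / ln (real n))) \<longlonglongrightarrow> 1" by real_asymp
  ultimately have t: "(\<lambda>n. (C * real (log_degree n)) powr (1 / real (log_degree n)) * sqrt ((ln (real n) + 1) / ln (real n))) \<longlonglongrightarrow> 1 * 1"
    by (rule tendsto_mult)
  have "\<forall>\<^sub>F n in sequentially. (C * real (log_degree n)) powr (1 / real (log_degree n)) * sqrt ((ln (real n) + 1) / ln (real n)) < a"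
    using order_tendstoD(2)[OF t, of a] a by simp
  then show "\<forall>\<^sub>F n in sequentially. bohr_radius n \<infinity> / sqrt (ln (real n) / real n) < a"
    using eventually_ge_at_top[of 2]
  proof eventually_elim
    case (elim n)
    then show ?case using bohr_radius_polydisc_le[of n] by (simp add: C_def mult.assoc)
  qed
qed

theorem theorem2p15:
  shows "(\<forall>p::ereal. 1 \<le> p \<longrightarrow> bohr_radius 1 p = 1 / 3) \<and>
    (\<exists>C::real. C \<ge> 1 \<and>
      (\<forall>n::nat. \<forall>p::real. n \<ge> 2 \<and> 1 \<le> p \<longrightarrow>
         1 / C * (ln (real n) / real n) powr (1 - 1 / min p 2) \<le> bohr_radius n (ereal p) \<and>
         bohr_radius n (ereal p) \<le> C * (ln (real n) / real n) powr (1 - 1 / min p 2))) \<and>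
    (\<lambda>n. bohr_radius n \<infinity> / sqrt (ln (real n) / real n)) \<longlonglongrightarrow> 1"
proof (intro conjI allI impI)
  fix p :: ereal assume "1 \<le> p"
  then show "bohr_radius 1 p = 1 / 3"
    using bohr_radius_1_ge bohr_radius_1_le by (intro antisym)
next
  have e: "exp 1 \<le> (3::real)" "exp 2 \<le> (9::real)"
  proof -
    show e1: "exp 1 \<le> (3::real)" by (rule exp_le)
    have "exp 2 = exp 1 * (exp 1 :: real)" by (simp add: mult_exp_exp)
    also have "\<dots> \<le> 3 * 3" using e1 by (intro mult_mono) auto
    finally show "exp 2 \<le> (9::real)" by simp
  qed
  show "\<exists>C::real. C \<ge> 1 \<and>
      (\<forall>n::nat. \<forall>p::real. n \<ge> 2 \<and> 1 \<le> p \<longrightarrow>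
         1 / C * (ln (real n) / real n) powr (1 - 1 / min p 2) \<le> bohr_radius n (ereal p) \<and>
         bohr_radius n (ereal p) \<le> C * (ln (real n) / real n) powr (1 - 1 / min p 2))"
  \<comment> \<open>900 is the constant of the upper bound; it exceeds \<open>32 * exp 2\<close>, which comes from the lower bounds\<close>
  proof (intro exI[of _ 900] conjI allI impI)
    fix n :: nat and p :: real assume np: "n \<ge> 2 \<and> 1 \<le> p"
    then have n: "n \<ge> 2" and p: "1 \<le> p" "1 \<le> ereal p" by auto
    show "bohr_radius n (ereal p) \<le> 900 * (ln (real n) / real n) powr (1 - 1 / min p 2)"
      using bohr_radius_le_log[OF p(2) n] by (simp add: min2_def)
    define X where "X = (ln (real n) / real n) powr (1 - 1 / min p 2)"
    have X0: "X \<ge> 0" by (simp add: X_def)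
    have "1 / 900 * X \<le> bohr_radius n (ereal p)"
    proof (cases "p \<le> 2")
      case True
      have "exp 1 * exp 1 \<le> 3 * (3::real)" using e by (intro mult_mono) auto
      then have "1 / 900 * X \<le> 1 / (16 * exp 1 * exp 1) * X"
        using X0 by (intro mult_right_mono) (auto simp: field_simps)
      also have "\<dots> \<le> bohr_radius n (ereal p)"
        using bohr_radius_ge_lp[OF n p(1) True] True by (simp add: X_def)
      finally show ?thesis .
    next
      case False
      have "1 / 900 * X \<le> 1 / (16 * exp 2 * 2) * X"
        using X0 e by (intro mult_right_mono) (auto simp: field_simps)
      also have "\<dots> \<le> bohr_radius n (ereal p)"
        using bohr_radius_ge_sqrt[OF n p(2)] False by (simp add: X_def min_def)
      finally show ?thesis .
    qed
    then show "1 / 900 * (ln (real n) / real n) powr (1 - 1 / min p 2) \<le> bohr_radius n (ereal p)"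
      by (simp add: X_def)
  qed simp
next
  show "(\<lambda>n. bohr_radius n \<infinity> / sqrt (ln (real n) / real n)) \<longlonglongrightarrow> 1"
    by (rule bohr_radius_polydisc_asymptotic)
qed

end
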